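(* For each $n\ge1$ let $\{d^n_i\}_{i=1}^n$ be non-negative integers with even sum, and suppose the degree sequence is bounded, i.e. $\sup_{n\ge1}\max_{1\le i\le n}d^n_i<\infty$. Let $G_n=G(n,\{d^n_i\}_{i=1}^n)$ be the corresponding configuration model, and let $D_n$ be the degree of a uniformly randomly chosen vertex of $G_n$. Let $F$ be a real-valued function on finite multigraphs that is invariant under graph isomorphisms, additive, and $M$-Lipschitz under switchings for some $M<\infty$; put $F_n=F(G_n)$. Suppose that (i) there is a random variable $D$ such that, as $n\to\infty$, $$D_n\xrightarrow{d}D,\qquad \mathbb E[D_n]\to\mathbb E[D]\in(0,\infty),\qquad \frac{\mathbb E[D_n(D_n-1)]}{\mathbb E[D_n]}\to\frac{\mathbb E[D(D-1)]}{\mathbb E[D]}\in[0,1);$$ (ii) $\mathrm{Var}(F(G_n))=\Omega(n)$. Then, as $n\to\infty$, $$\frac{F_n-\mathbb E(F_n)}{\sqrt{\mathrm{Var}(F_n)}}\xrightarrow{d}Z,$$ where $Z$ is a standard normal random variable.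
   Context: Configuration model: given degrees $d^n_1,\dots,d^n_n$ with even sum, attach $d^n_i$ half-edges to vertex $i\in[n]=\{1,\dots,n\}$; let $\mathcal H_n$ be the set of all half-edges and $\mathcal M_n$ the set of perfect matchings of $\mathcal H_n$. For $m\in\mathcal M_n$ let $G(m)$ be the multigraph on $[n]$ (self-loops and multiple edges allowed) with one edge between $i$ and $j$ for each matched pair consisting of a half-edge at $i$ and a half-edge at $j$. Then $G_n=G(m)$ with $m$ uniformly random in $\mathcal M_n$. Additive: $F(G)=F(G_1)+F(G_2)$ whenever $G$ is the vertex-disjoint union of $G_1$ and $G_2$. Switching: $m,m'\in\mathcal M_n$ differ by a switching, written $m\sim m'$, if there are $i_1,i_2,i_3,i_4\in\mathcal H_n$ with $(i_1,i_2),(i_3,i_4)\in m$ and $m'=m-\{(i_1,i_2),(i_3,i_4)\}+\{(i_1,i_3),(i_2,i_4)\}$. $F$ is $M$-Lipschitz under switchings if $|F(G(m))-F(G(m'))|\le M$ whenever $m\sim m'$ (for all $n$, with $M$ not depending on $n$). $a_n=\Omega(b_n)$ means there is $c>0$ with $a_n\ge c\,b_n$ for all large $n$. *)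

theory Defs
  imports
    "HOL-Probability.Probability"
    "HOL-Library.Uprod"
    "HOL-Library.Landau_Symbols"
begin

text \<open>
  Multigraphs with self-loops and multiple edges: an edge is an unordered pair of vertices
  (a self-loop at \<open>v\<close> is \<open>Upair v v\<close>), and the edges form a multiset.
\<close>

datatype 'v mgraph = MGraph (verts: "'v set") (edges: "'v uprod multiset")

definition finite_mgraph :: "'v mgraph \<Rightarrow> bool" where
  "finite_mgraph G \<longleftrightarrow> finite (verts G) \<and> (\<forall>e\<in>#edges G. set_uprod e \<subseteq> verts G)"

definition mgraph_iso :: "'v mgraph \<Rightarrow> 'w mgraph \<Rightarrow> bool" where
  "mgraph_iso G H \<longleftrightarrow>
     (\<exists>f. bij_betw f (verts G) (verts H) \<and> edges H = image_mset (map_uprod f) (edges G))"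

definition mgraph_union :: "'v mgraph \<Rightarrow> 'v mgraph \<Rightarrow> 'v mgraph" where
  "mgraph_union G H = MGraph (verts G \<union> verts H) (edges G + edges H)"

text \<open>A self-loop contributes 2 to the degree of its vertex.\<close>

definition mdegree :: "'v mgraph \<Rightarrow> 'v \<Rightarrow> nat" where
  "mdegree G v =
     (\<Sum>e\<in>#edges G. if e = Upair v v then 2 else if v \<in> set_uprod e then 1 else 0)"

text \<open>
  Graph functionals are taken on multigraphs with vertices in \<^typ>\<open>nat\<close>; every finite
  multigraph is isomorphic to one of these, and nothing is assumed about values of the
  type \<^typ>\<open>nat mgraph\<close> that are not finite multigraphs.
\<close>

definition iso_invariant :: "(nat mgraph \<Rightarrow> real) \<Rightarrow> bool" where
  "iso_invariant F \<longleftrightarrow>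
     (\<forall>G H. finite_mgraph G \<longrightarrow> finite_mgraph H \<longrightarrow> mgraph_iso G H \<longrightarrow> F G = F H)"

definition mgraph_additive :: "(nat mgraph \<Rightarrow> real) \<Rightarrow> bool" where
  "mgraph_additive F \<longleftrightarrow>
     (\<forall>G H. finite_mgraph G \<longrightarrow> finite_mgraph H \<longrightarrow> verts G \<inter> verts H = {} \<longrightarrow>
        F (mgraph_union G H) = F G + F H)"

text \<open>
  The configuration model for the degrees \<open>d 1, \<dots>, d n\<close>; the half-edges at vertex \<open>i\<close> are the
  pairs \<open>(i, k)\<close> with \<open>k < d i\<close>.
\<close>

definition half_edges :: "nat \<Rightarrow> (nat \<Rightarrow> nat) \<Rightarrow> (nat \<times> nat) set" where
  "half_edges n d = (SIGMA i:{1..n}. {..<d i})"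

definition perfect_matchings :: "'a set \<Rightarrow> 'a uprod set set" where
  "perfect_matchings H =
     {m. (\<forall>e\<in>m. proper_uprod e \<and> set_uprod e \<subseteq> H) \<and> (\<forall>h\<in>H. \<exists>!e. e \<in> m \<and> h \<in> set_uprod e)}"

definition matching_graph :: "nat \<Rightarrow> (nat \<times> nat) uprod set \<Rightarrow> nat mgraph" where
  "matching_graph n m = MGraph {1..n} (image_mset (map_uprod fst) (mset_set m))"

definition config_model :: "nat \<Rightarrow> (nat \<Rightarrow> nat) \<Rightarrow> nat mgraph pmf" where
  "config_model n d =
     map_pmf (matching_graph n) (pmf_of_set (perfect_matchings (half_edges n d)))"

text \<open>The law of the degree of a uniformly random vertex of the configuration model.\<close>

definition degree_pmf :: "nat \<Rightarrow> (nat \<Rightarrow> nat) \<Rightarrow> nat pmf" where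
  "degree_pmf n d =
     bind_pmf (config_model n d) (\<lambda>G. map_pmf (mdegree G) (pmf_of_set (verts G)))"

definition switching :: "'a uprod set \<Rightarrow> 'a uprod set \<Rightarrow> bool" where
  "switching m m' \<longleftrightarrow>
     (\<exists>i1 i2 i3 i4. Upair i1 i2 \<in> m \<and> Upair i3 i4 \<in> m \<and>
        m' = (m - {Upair i1 i2, Upair i3 i4}) \<union> {Upair i1 i3, Upair i2 i4})"

definition switching_lipschitz ::
  "(nat \<Rightarrow> nat \<Rightarrow> nat) \<Rightarrow> real \<Rightarrow> (nat mgraph \<Rightarrow> real) \<Rightarrow> bool" where
  "switching_lipschitz d M F \<longleftrightarrow>
     (\<forall>n\<ge>1. \<forall>m\<in>perfect_matchings (half_edges n (d n)).
        \<forall>m'\<in>perfect_matchings (half_edges n (d n)).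
          switching m m' \<longrightarrow> \<bar>F (matching_graph n m) - F (matching_graph n m')\<bar> \<le> M)"

end

theory Submission
  imports Defs "HOL-Real_Asymp.Real_Asymp"
begin

text \<open>
  A uniform perfect matching is the image of a fixed pairing of positions under a uniform
  permutation \<open>p\<close>, so \<open>F(G\<^sub>n)\<close> becomes a function \<open>g\<close> of \<open>p\<close>. Revealing \<open>p 0, p 1, \<dots>\<close> one by one
  gives martingale increments \<open>D\<^sub>j\<close>, and resampling at step \<open>j\<close> amounts to composing \<open>p\<close> with a
  transposition \<open>(j k)\<close>, \<open>k \<ge> j\<close>, i.e. to a switching. With \<open>L\<^sub>j g\<close> the difference between \<open>g\<close> and its
  average over \<open>k\<close>, this yields \<open>E[(g - E g) \<phi>(g)] \<approx> E[T \<phi>'(g)]\<close> for \<open>T = \<Sum>\<^sub>j D\<^sub>j L\<^sub>j g\<close>, and \<open>E T\<close> is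
  the variance of \<open>g\<close>. Taking sine and cosine for \<open>\<phi>\<close>, the characteristic function solves
  \<open>y' = - t y\<close> up to an error that vanishes as soon as \<open>Var T = o(n\<^sup>2)\<close>.

  By additivity, second differences of \<open>g\<close> along two transpositions vanish unless these touch a common
  component. Hence \<open>Var T\<close> is controlled by the number of pairs of half-edges in a common component:
  pairs at bounded distance are few because the degrees are bounded, and in the subcritical regime
  the expected number of pairs at distance at least \<open>r\<close> is at most \<open>\<epsilon>\<^sub>r n\<close> with \<open>\<epsilon>\<^sub>r \<longlonglongrightarrow> 0\<close>, by
  counting paths.
\<close>

section \<open>Averages over permutations and a Stein identity\<close>

text \<open>Step \<open>j\<close> swaps only with \<open>k \<ge> j\<close>, because then averaging
  over the swaps and conditioning on \<open>p 0, ..., p j\<close> combine, in either order, to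
  conditioning on \<open>p 0, ..., p (j - 1)\<close>. The price is that step \<open>j\<close>
  averages over only \<open>N - j\<close> positions, so a late position \<open>k\<close> collects
  the weight \<open>\<Sum>j\<le>k. 1 / (N - j)\<close>, which is unbounded in \<open>N\<close>;
  Hardy's inequality controls these weights in mean square. A second obstacle is that the increments
  are conditional expectations and hence not local in \<open>p\<close>: their response to a swap
  involves conditional expectations of counts of touching swaps, and an inequality dual to Doob's
  reduces these to the counts themselves. The outcome is
  \<open>Var T \<le> C N (b^2 + E[number of far pairs])\<close>, where \<open>b\<close> bounds the
  near pairs of one position. The final error is \<open>sqrt (Var T) / Var g\<close> plus a Taylor
  term of order \<open>N / (Var g) powr (3/2)\<close>. With a variance at least of order
  \<open>n\<close>, it suffices that far pairs be few compared with \<open>n\<close>, without any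
  rate.\<close>

definition mean :: "'b set \<Rightarrow> ('b \<Rightarrow> real) \<Rightarrow> real" where
  "mean A g = (\<Sum>x\<in>A. g x) / real (card A)"

lemma mean_cong: "(\<And>x. x \<in> A \<Longrightarrow> g x = h x) \<Longrightarrow> mean A g = mean A h"
  unfolding mean_def by (simp cong: sum.cong)

lemma mean_add: "mean A (\<lambda>x. g x + h x) = mean A g + mean A h"
  by (simp add: mean_def sum.distrib add_divide_distrib)

lemma mean_diff: "mean A (\<lambda>x. g x - h x) = mean A g - mean A h"
  by (simp add: mean_def sum_subtractf diff_divide_distrib)

lemma mean_cmult: "mean A (\<lambda>x. c * g x) = c * mean A g"
  by (simp add: mean_def sum_distrib_left)

lemma mean_multc: "mean A (\<lambda>x. g x * c) = mean A g * c"
  by (simp add: mean_def sum_distrib_right)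

lemma mean_sum: "mean A (\<lambda>x. \<Sum>i\<in>I. g i x) = (\<Sum>i\<in>I. mean A (g i))"
  unfolding mean_def sum_divide_distrib[symmetric] by (subst sum.swap) simp

lemma mean_swap: "mean A (\<lambda>x. mean B (\<lambda>y. g x y)) = mean B (\<lambda>y. mean A (\<lambda>x. g x y))"
  unfolding mean_def sum_divide_distrib[symmetric] by (subst sum.swap) (simp add: field_simps)

lemma mean_const: "finite A \<Longrightarrow> A \<noteq> {} \<Longrightarrow> mean A (\<lambda>_. c) = c"
  by (simp add: mean_def)

lemma mean_mono: "(\<And>x. x \<in> A \<Longrightarrow> g x \<le> h x) \<Longrightarrow> mean A g \<le> mean A h"
  unfolding mean_def by (intro divide_right_mono sum_mono) auto

lemma mean_nonneg: "(\<And>x. x \<in> A \<Longrightarrow> 0 \<le> g x) \<Longrightarrow> 0 \<le> mean A g"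
  unfolding mean_def by (intro divide_nonneg_nonneg sum_nonneg) auto

lemma mean_le_const:
  "finite A \<Longrightarrow> A \<noteq> {} \<Longrightarrow> (\<And>x. x \<in> A \<Longrightarrow> g x \<le> c) \<Longrightarrow> mean A g \<le> c"
  using mean_mono[of A g "\<lambda>_. c"] by (simp add: mean_const)

lemma abs_mean_le: "\<bar>mean A g\<bar> \<le> mean A (\<lambda>x. \<bar>g x\<bar>)"
  unfolding mean_def by (simp add: divide_right_mono)

lemma mean_reindex: "bij_betw r B A \<Longrightarrow> mean A g = mean B (\<lambda>x. g (r x))"
  unfolding mean_def using sum.reindex_bij_betw[of r B A g] bij_betw_same_card[of r B A] by simp

lemma mean_Times: "mean (A \<times> B) (\<lambda>(x, y). g x y) = mean A (\<lambda>x. mean B (g x))"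
  unfolding mean_def sum.cartesian_product[symmetric]
  by (simp add: sum_divide_distrib[symmetric] card_cartesian_product mult.commute)

lemma mean_mult_le: "(mean A (\<lambda>x. g x * h x))\<^sup>2 \<le> mean A (\<lambda>x. (g x)\<^sup>2) * mean A (\<lambda>x. (h x)\<^sup>2)"
proof -
  have "(\<Sum>x\<in>A. g x * h x)\<^sup>2 \<le> (\<Sum>x\<in>A. (g x)\<^sup>2) * (\<Sum>x\<in>A. (h x)\<^sup>2)"
    by (rule Cauchy_Schwarz_ineq_sum)
  then show ?thesis
    unfolding mean_def by (simp add: power_divide power2_eq_square[of "real (card A)"] divide_right_mono)
qed

lemma square_mean_le:
  assumes "finite A" "A \<noteq> {}"
  shows "(mean A g)\<^sup>2 \<le> mean A (\<lambda>x. (g x)\<^sup>2)"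
  using mean_mult_le[of A g "\<lambda>_. 1"] mean_const[OF assms, of 1] by simp

abbreviation swp :: "nat \<Rightarrow> nat \<Rightarrow> nat \<Rightarrow> nat" where
  "swp \<equiv> Transposition.transpose"

text \<open>The stabiliser of the positions below \<open>j\<close>. Being a group, it is mapped onto
  itself by translations and by inversion, and the averaging identities below come from reindexing
  by these.\<close>

definition perms :: "nat \<Rightarrow> nat \<Rightarrow> (nat \<Rightarrow> nat) set" where
  "perms N j = {p. p permutes {j..<N}}"

text \<open>For \<open>p \<in> perms N 0\<close> the maps \<open>p \<circ> r\<close> are exactly the
  permutations that agree with \<open>p\<close> below \<open>j\<close>, so this is conditional
  expectation given \<open>p 0, ..., p (j - 1)\<close>.\<close>

definition tail_mean :: "nat \<Rightarrow> nat \<Rightarrow> ((nat \<Rightarrow> nat) \<Rightarrow> real) \<Rightarrow> (nat \<Rightarrow> nat) \<Rightarrow> real" where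
  "tail_mean N j g p = mean (perms N j) (\<lambda>r. g (p \<circ> r))"

definition swap_mean :: "nat \<Rightarrow> nat \<Rightarrow> ((nat \<Rightarrow> nat) \<Rightarrow> real) \<Rightarrow> (nat \<Rightarrow> nat) \<Rightarrow> real" where
  "swap_mean N j g p = mean {j..<N} (\<lambda>k. g (p \<circ> swp j k))"

abbreviation expect :: "nat \<Rightarrow> ((nat \<Rightarrow> nat) \<Rightarrow> real) \<Rightarrow> real" where
  "expect N \<equiv> mean (perms N 0)"

lemma finite_perms [simp]: "finite (perms N j)"
  by (simp add: perms_def finite_permutations)

lemma id_in_perms [simp]: "id \<in> perms N j"
  by (simp add: perms_def permutes_id)

lemma perms_nonempty [simp]: "perms N j \<noteq> {}"
  using id_in_perms by blast

lemma card_perms: "card (perms N 0) = fact N"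
  unfolding perms_def by (rule card_permutations) auto

lemma perms_comp: "p \<in> perms N j \<Longrightarrow> q \<in> perms N j \<Longrightarrow> p \<circ> q \<in> perms N j"
  by (simp add: perms_def permutes_compose)

lemma perms_inv: "p \<in> perms N j \<Longrightarrow> inv p \<in> perms N j"
  by (simp add: perms_def permutes_inv)

lemma perms_mono: "i \<le> j \<Longrightarrow> perms N j \<subseteq> perms N i"
  unfolding perms_def by (auto intro: permutes_subset)

lemma perms_0: "p \<in> perms N j \<Longrightarrow> p \<in> perms N 0"
  using perms_mono[of 0 j N] by auto

lemma swp_in_perms: "i \<in> {j..<N} \<Longrightarrow> k \<in> {j..<N} \<Longrightarrow> swp i k \<in> perms N j"
  by (simp add: perms_def permutes_swap_id)

lemma perms_inv_o: "p \<in> perms N j \<Longrightarrow> p \<circ> inv p = id" "p \<in> perms N j \<Longrightarrow> inv p \<circ> p = id"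
  by (auto simp: perms_def permutes_inv_o)

lemma perms_less: "p \<in> perms N 0 \<Longrightarrow> i < N \<Longrightarrow> p i < N"
  unfolding perms_def using permutes_in_image[of p "{0..<N}" i] by auto

lemma perms_inj: "p \<in> perms N 0 \<Longrightarrow> inj p"
  unfolding perms_def by (auto intro: permutes_inj)

lemma bij_comp_left: "s \<in> perms N j \<Longrightarrow> bij_betw (\<lambda>r. s \<circ> r) (perms N j) (perms N j)"
  by (rule bij_betwI[where g = "\<lambda>r. inv s \<circ> r"])
     (auto simp: perms_comp perms_inv perms_inv_o o_assoc)

lemma bij_comp_right: "s \<in> perms N j \<Longrightarrow> bij_betw (\<lambda>r. r \<circ> s) (perms N j) (perms N j)"
  by (rule bij_betwI[where g = "\<lambda>r. r \<circ> inv s"])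
     (auto simp: perms_comp perms_inv perms_inv_o o_assoc[symmetric])

lemma bij_inv: "bij_betw inv (perms N j) (perms N j)"
  by (rule bij_betwI[where g = inv])
     (auto simp: perms_inv perms_def inv_inv_eq permutes_bij intro: permutes_inv)

lemma expect_comp: "s \<in> perms N j \<Longrightarrow> expect N (\<lambda>p. g (p \<circ> s)) = expect N g"
  using mean_reindex[OF bij_comp_right[OF perms_0]] by metis

lemma tail_mean_comp:
  assumes "s \<in> perms N j"
  shows "tail_mean N j g (p \<circ> s) = tail_mean N j g p"
  using mean_reindex[OF bij_comp_left[OF assms], of "\<lambda>r. g (p \<circ> r)"]
  by (simp add: tail_mean_def o_assoc)

lemma tail_mean_last [simp]: "tail_mean N N g p = g p"
  by (simp add: tail_mean_def perms_def mean_def)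

lemma tail_mean_0: "p \<in> perms N 0 \<Longrightarrow> tail_mean N 0 g p = expect N g"
  using tail_mean_comp[of p N 0 g id] by (simp add: tail_mean_def)

lemma tail_mean_tail_mean:
  assumes "j \<le> k"
  shows "tail_mean N k (tail_mean N j g) p = tail_mean N j g p"
proof -
  have "tail_mean N k (tail_mean N j g) p = mean (perms N k) (\<lambda>r. tail_mean N j g p)"
    unfolding tail_mean_def[of N k]
    by (intro mean_cong) (use assms perms_mono in \<open>auto intro!: tail_mean_comp\<close>)
  then show ?thesis by (simp add: mean_const)
qed

text \<open>As \<open>r\<close> fixes \<open>j\<close>, the index \<open>k\<close> is recovered as
  the image of \<open>j\<close>, and cancelling the transposition then recovers
  \<open>r\<close>.\<close>

lemma perms_decomp:
  assumes "j < N"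
  shows "bij_betw (\<lambda>(k, r). swp j k \<circ> r) ({j..<N} \<times> perms N (Suc j)) (perms N j)"
proof -
  have ins: "{j..<N} = insert j {Suc j..<N}" using assms by auto
  have "inj_on (\<lambda>(k, r). swp j k \<circ> r) ({j..<N} \<times> perms N (Suc j))"
  proof (rule inj_onI, clarify)
    fix k r k' r'
    assume r: "r \<in> perms N (Suc j)" "r' \<in> perms N (Suc j)"
      and eq: "swp j k \<circ> r = swp j k' \<circ> r'"
    have fix_j: "r j = j" "r' j = j"
      using r by (auto simp: perms_def permutes_not_in)
    have k: "k = k'"
      using fun_cong[OF eq, of j] fix_j by simp
    have "swp j k \<circ> (swp j k \<circ> r) = swp j k \<circ> (swp j k \<circ> r')"
      using eq k by simp
    then have "r = r'"
      by (simp add: o_assoc)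
    with k show "k = k' \<and> r = r'" by simp
  qed
  moreover have "(\<lambda>(k, r). swp j k \<circ> r) ` ({j..<N} \<times> perms N (Suc j)) = perms N j"
    unfolding perms_def ins permutes_insert by auto
  ultimately show ?thesis by (simp add: bij_betw_def)
qed

lemma tail_mean_swap:
  assumes "j < N"
  shows "tail_mean N j g p = swap_mean N j (tail_mean N (Suc j) g) p"
proof -
  have "tail_mean N j g p = mean ({j..<N} \<times> perms N (Suc j)) (\<lambda>(k, r). g (p \<circ> (swp j k \<circ> r)))"
    unfolding tail_mean_def mean_reindex[OF perms_decomp[OF assms]]
    by (intro mean_cong) auto
  then show ?thesis
    by (simp add: mean_Times swap_mean_def tail_mean_def o_assoc)
qed

text \<open>Inverting the factorisation puts the transposition to the right of \<open>r\<close>.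
  Both orders are used: \<open>tail_mean_swap\<close> makes \<open>swap_mean\<close> annihilate the
  increments, this one writes an increment as a conditional expectation of
  \<open>swap_gap\<close>.\<close>

lemma tail_mean_swap':
  assumes "j < N"
  shows "tail_mean N j g p = tail_mean N (Suc j) (swap_mean N j g) p"
proof -
  have "tail_mean N j g p = mean (perms N j) (\<lambda>r. g (p \<circ> inv r))"
    unfolding tail_mean_def by (rule mean_reindex[OF bij_inv])
  also have "\<dots> = mean ({j..<N} \<times> perms N (Suc j)) (\<lambda>(k, r). g (p \<circ> inv (swp j k \<circ> r)))"
    unfolding mean_reindex[OF perms_decomp[OF assms]]
    by (intro mean_cong) auto
  also have "\<dots> = mean {j..<N} (\<lambda>k. mean (perms N (Suc j)) (\<lambda>r. g (p \<circ> (inv r \<circ> swp j k))))"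
    unfolding mean_Times
    by (intro mean_cong) (auto simp: perms_def o_inv_distrib permutes_bij)
  also have "\<dots> = mean (perms N (Suc j)) (\<lambda>r. mean {j..<N} (\<lambda>k. g (p \<circ> (inv r \<circ> swp j k))))"
    by (rule mean_swap)
  also have "\<dots> = mean (perms N (Suc j)) (\<lambda>r. mean {j..<N} (\<lambda>k. g (p \<circ> (r \<circ> swp j k))))"
    by (rule mean_reindex[OF bij_inv, symmetric])
  finally show ?thesis
    by (simp add: swap_mean_def tail_mean_def o_assoc)
qed

text \<open>Self-adjointness: translating \<open>p\<close> by \<open>inv r\<close> moves the
  averaging from \<open>g\<close> to \<open>h\<close>, and inversion permutes the subgroup.\<close>

lemma expect_tail_mean_mult:
  "expect N (\<lambda>p. tail_mean N j g p * h p) = expect N (\<lambda>p. g p * tail_mean N j h p)"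
proof -
  have "expect N (\<lambda>p. tail_mean N j g p * h p) = mean (perms N j) (\<lambda>r. expect N (\<lambda>p. g (p \<circ> r) * h p))"
    unfolding tail_mean_def mean_multc[symmetric] by (rule mean_swap)
  also have "\<dots> = mean (perms N j) (\<lambda>r. expect N (\<lambda>p. g p * h (p \<circ> inv r)))"
  proof (rule mean_cong)
    fix r assume r: "r \<in> perms N j"
    show "expect N (\<lambda>p. g (p \<circ> r) * h p) = expect N (\<lambda>p. g p * h (p \<circ> inv r))"
      using expect_comp[OF r, of "\<lambda>p. g p * h (p \<circ> inv r)"] r
      by (simp add: o_assoc[symmetric] perms_inv_o)
  qed
  also have "\<dots> = mean (perms N j) (\<lambda>r. expect N (\<lambda>p. g p * h (p \<circ> r)))"
    by (rule mean_reindex[OF bij_inv, symmetric])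
  also have "\<dots> = expect N (\<lambda>p. g p * tail_mean N j h p)"
    unfolding tail_mean_def mean_cmult[symmetric] by (rule mean_swap)
  finally show ?thesis .
qed

lemma expect_tail_mean: "expect N (tail_mean N j g) = expect N g"
proof -
  have "tail_mean N j (\<lambda>_. 1) = (\<lambda>_. 1)"
    by (auto simp: tail_mean_def mean_const)
  then show ?thesis
    using expect_tail_mean_mult[of N j g "\<lambda>_. 1"] by simp
qed

lemma expect_swap_mean_mult:
  assumes "j < N"
  shows "expect N (\<lambda>p. swap_mean N j g p * h p) = expect N (\<lambda>p. g p * swap_mean N j h p)"
proof -
  have "expect N (\<lambda>p. swap_mean N j g p * h p)
      = mean {j..<N} (\<lambda>k. expect N (\<lambda>p. g (p \<circ> swp j k) * h p))"
    unfolding swap_mean_def mean_multc[symmetric] by (rule mean_swap)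
  also have "\<dots> = mean {j..<N} (\<lambda>k. expect N (\<lambda>p. g p * h (p \<circ> swp j k)))"
  proof (rule mean_cong)
    fix k assume k: "k \<in> {j..<N}"
    have "swp j k \<in> perms N j"
      using k by (intro swp_in_perms) auto
    from expect_comp[OF this, of "\<lambda>p. g p * h (p \<circ> swp j k)"]
    show "expect N (\<lambda>p. g (p \<circ> swp j k) * h p) = expect N (\<lambda>p. g p * h (p \<circ> swp j k))"
      by (simp add: o_assoc[symmetric])
  qed
  also have "\<dots> = expect N (\<lambda>p. g p * swap_mean N j h p)"
    unfolding swap_mean_def mean_cmult[symmetric] by (rule mean_swap)
  finally show ?thesis .
qed

lemma tail_mean_diff: "tail_mean N j (\<lambda>p. g p - h p) p = tail_mean N j g p - tail_mean N j h p"
  by (simp add: tail_mean_def mean_diff)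

section \<open>Martingale increments and the Stein kernel\<close>

definition swap_gap :: "nat \<Rightarrow> nat \<Rightarrow> ((nat \<Rightarrow> nat) \<Rightarrow> real) \<Rightarrow> (nat \<Rightarrow> nat) \<Rightarrow> real" where
  "swap_gap N j g p = g p - swap_mean N j g p"

definition increment :: "nat \<Rightarrow> nat \<Rightarrow> ((nat \<Rightarrow> nat) \<Rightarrow> real) \<Rightarrow> (nat \<Rightarrow> nat) \<Rightarrow> real" where
  "increment N j g p = tail_mean N (Suc j) g p - tail_mean N j g p"

lemma increment_eq_tail_mean:
  "j < N \<Longrightarrow> increment N j g p = tail_mean N (Suc j) (swap_gap N j g) p"
  unfolding increment_def swap_gap_def tail_mean_diff by (simp add: tail_mean_swap')

lemma sum_increment:
  assumes "p \<in> perms N 0"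
  shows "(\<Sum>j<N. increment N j g p) = g p - expect N g"
  using sum_lessThan_telescope[of "\<lambda>j. tail_mean N j g p" N] tail_mean_0[OF assms, of g]
  by (simp add: increment_def)

text \<open>Resampling position \<open>j\<close> turns the first term of the increment into the
  second, and leaves the second, which does not depend on \<open>p j\<close>, unchanged.\<close>

lemma swap_mean_increment:
  assumes "j < N"
  shows "swap_mean N j (increment N j g) p = 0"
proof -
  have "swap_mean N j (tail_mean N j g) p = mean {j..<N} (\<lambda>k. tail_mean N j g p)"
    unfolding swap_mean_def using assms
    by (intro mean_cong tail_mean_comp swp_in_perms) auto
  then show ?thesis
    using assms
    by (simp add: increment_def[abs_def] swap_mean_def mean_diff mean_const
        tail_mean_swap[OF assms, of g p, unfolded swap_mean_def])
qed

text \<open>The increment is orthogonal to every \<open>swap_mean N j h\<close>: move the average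
  onto the increment, where it vanishes.\<close>

lemma expect_increment_mult:
  assumes "j < N"
  shows "expect N (\<lambda>p. increment N j g p * h p) = expect N (\<lambda>p. increment N j g p * swap_gap N j h p)"
  using expect_swap_mean_mult[OF assms, of "increment N j g" h]
  by (simp add: swap_mean_increment[OF assms] swap_gap_def right_diff_distrib mean_diff)
     (simp add: mean_def)

definition stein_kernel :: "nat \<Rightarrow> ((nat \<Rightarrow> nat) \<Rightarrow> real) \<Rightarrow> (nat \<Rightarrow> nat) \<Rightarrow> real" where
  "stein_kernel N g p = (\<Sum>j<N. increment N j g p * swap_gap N j g p)"

text \<open>A covariance formula by telescoping: \<open>h = g\<close> yields the variance,
  \<open>h = \<phi> \<circ> g\<close> the Stein identity.\<close>

lemma expect_centered_mult:
  "expect N (\<lambda>p. (g p - expect N g) * h p) =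
   (\<Sum>j<N. expect N (\<lambda>p. increment N j g p * swap_gap N j h p))"
proof -
  have "expect N (\<lambda>p. (g p - expect N g) * h p)
      = expect N (\<lambda>p. \<Sum>j<N. increment N j g p * h p)"
    by (intro mean_cong) (simp add: sum_increment[symmetric] sum_distrib_right)
  also have "\<dots> = (\<Sum>j<N. expect N (\<lambda>p. increment N j g p * swap_gap N j h p))"
    unfolding mean_sum by (intro sum.cong) (auto intro: expect_increment_mult)
  finally show ?thesis .
qed

definition perm_variance :: "nat \<Rightarrow> ((nat \<Rightarrow> nat) \<Rightarrow> real) \<Rightarrow> real" where
  "perm_variance N g = expect N (\<lambda>p. (g p - expect N g)\<^sup>2)"

lemma expect_stein_kernel: "expect N (stein_kernel N g) = perm_variance N g"
proof -
  have "perm_variance N g = expect N (\<lambda>p. (g p - expect N g) * g p) - expect N (\<lambda>p. (g p - expect N g) * expect N g)"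
    unfolding perm_variance_def mean_diff[symmetric]
    by (intro mean_cong) (simp add: power2_eq_square algebra_simps)
  moreover have "expect N (\<lambda>p. (g p - expect N g) * expect N g) = 0"
    by (simp add: mean_multc mean_diff mean_const)
  ultimately show ?thesis
    by (simp add: expect_centered_mult stein_kernel_def[abs_def] mean_sum)
qed

lemma swap_gap_eq_mean:
  "j < N \<Longrightarrow> swap_gap N j g p = mean {j..<N} (\<lambda>k. g p - g (p \<circ> swp j k))"
  by (simp add: swap_gap_def swap_mean_def mean_diff mean_const)

definition swap_lipschitz :: "nat \<Rightarrow> real \<Rightarrow> ((nat \<Rightarrow> nat) \<Rightarrow> real) \<Rightarrow> bool" where
  "swap_lipschitz N K g \<longleftrightarrow>
     (\<forall>p\<in>perms N 0. \<forall>j<N. \<forall>k<N. \<bar>g p - g (p \<circ> swp j k)\<bar> \<le> K)"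

lemma swap_gap_le:
  assumes "swap_lipschitz N K g" "p \<in> perms N 0" "j < N"
  shows "\<bar>swap_gap N j g p\<bar> \<le> K"
  unfolding swap_gap_eq_mean[OF assms(3)] using assms
  by (intro order_trans[OF abs_mean_le] mean_le_const) (auto simp: swap_lipschitz_def)

lemma abs_tail_mean_le: "\<bar>tail_mean N j g p\<bar> \<le> tail_mean N j (\<lambda>p. \<bar>g p\<bar>) p"
  unfolding tail_mean_def by (rule abs_mean_le)

lemma tail_mean_mono:
  "p \<in> perms N 0 \<Longrightarrow> (\<And>q. q \<in> perms N 0 \<Longrightarrow> g q \<le> h q) \<Longrightarrow> tail_mean N j g p \<le> tail_mean N j h p"
  unfolding tail_mean_def by (intro mean_mono) (auto intro: perms_comp perms_0)

lemma tail_mean_const [simp]: "tail_mean N j (\<lambda>_. c) p = c"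
  by (simp add: tail_mean_def mean_const)

lemma increment_le:
  assumes "swap_lipschitz N K g" "p \<in> perms N 0" "j < N"
  shows "\<bar>increment N j g p\<bar> \<le> K"
  unfolding increment_eq_tail_mean[OF assms(3)]
  using tail_mean_mono[OF assms(2), of "\<lambda>p. \<bar>swap_gap N j g p\<bar>" "\<lambda>_. K"] swap_gap_le[OF assms(1) _ assms(3)]
  by (intro order_trans[OF abs_tail_mean_le]) auto

text \<open>First-order expansion at \<open>g p\<close> along each transposition. A jump is at most
  \<open>K\<close>, so the averaged remainder is at most \<open>B * K\<^sup>2\<close>; the increment
  contributes the third factor \<open>K\<close>.\<close>

lemma increment_swap_gap_taylor:
  assumes lip: "swap_lipschitz N K g" and p: "p \<in> perms N 0" and j: "j < N" and B: "0 \<le> B"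
    and taylor: "\<And>x y. \<bar>\<phi> x - \<phi> y - \<phi>' x * (x - y)\<bar> \<le> B * (x - y)\<^sup>2"
  shows "\<bar>increment N j g p * swap_gap N j (\<lambda>p. \<phi> (g p)) p - increment N j g p * swap_gap N j g p * \<phi>' (g p)\<bar> \<le> B * K ^ 3"
proof -
  have K: "0 \<le> K" using swap_gap_le[OF lip p j] by linarith
  have "\<bar>swap_gap N j (\<lambda>p. \<phi> (g p)) p - swap_gap N j g p * \<phi>' (g p)\<bar>
      = \<bar>mean {j..<N} (\<lambda>k. \<phi> (g p) - \<phi> (g (p \<circ> swp j k)) - \<phi>' (g p) * (g p - g (p \<circ> swp j k)))\<bar>"
    by (simp add: swap_gap_eq_mean[OF j] mean_diff mean_cmult mult.commute)
  also have "\<dots> \<le> B * K\<^sup>2"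
  proof (intro order_trans[OF abs_mean_le] mean_le_const)
    fix k assume k: "k \<in> {j..<N}"
    have "\<bar>g p - g (p \<circ> swp j k)\<bar> \<le> K"
      using lip p j k by (auto simp: swap_lipschitz_def)
    then have "(g p - g (p \<circ> swp j k))\<^sup>2 \<le> K\<^sup>2"
      using K by (simp add: abs_le_square_iff[symmetric])
    then show "\<bar>\<phi> (g p) - \<phi> (g (p \<circ> swp j k)) - \<phi>' (g p) * (g p - g (p \<circ> swp j k))\<bar> \<le> B * K\<^sup>2"
      by (intro order_trans[OF taylor] mult_left_mono B)
  qed (use j in auto)
  finally have "\<bar>increment N j g p\<bar> * \<bar>swap_gap N j (\<lambda>p. \<phi> (g p)) p - swap_gap N j g p * \<phi>' (g p)\<bar> \<le> K * (B * K\<^sup>2)"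
    by (intro mult_mono increment_le[OF lip p j] K) auto
  then show ?thesis
    by (simp add: abs_mult[symmetric] algebra_simps power2_eq_square power3_eq_cube)
qed

lemma stein_bound:
  assumes lip: "swap_lipschitz N K g" and B: "0 \<le> B"
    and taylor: "\<And>x y. \<bar>\<phi> x - \<phi> y - \<phi>' x * (x - y)\<bar> \<le> B * (x - y)\<^sup>2"
    and bdd: "\<And>x. \<bar>\<phi>' x\<bar> \<le> B'"
  shows "\<bar>expect N (\<lambda>p. (g p - expect N g) * \<phi> (g p)) - perm_variance N g * expect N (\<lambda>p. \<phi>' (g p))\<bar>
    \<le> B' * sqrt (perm_variance N (stein_kernel N g)) + N * (B * K ^ 3)"
proof -
  let ?T = "stein_kernel N g"
  have B': "0 \<le> B'" using bdd[of 0] by linarith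
  have 1: "\<bar>expect N (\<lambda>p. (g p - expect N g) * \<phi> (g p)) - expect N (\<lambda>p. ?T p * \<phi>' (g p))\<bar> \<le> N * (B * K ^ 3)"
  proof -
    have "expect N (\<lambda>p. (g p - expect N g) * \<phi> (g p)) - expect N (\<lambda>p. ?T p * \<phi>' (g p)) =
      (\<Sum>j<N. expect N (\<lambda>p. increment N j g p * swap_gap N j (\<lambda>p. \<phi> (g p)) p
        - increment N j g p * swap_gap N j g p * \<phi>' (g p)))"
      unfolding expect_centered_mult stein_kernel_def sum_distrib_right mean_sum mean_diff sum_subtractf
      by simp
    also have "\<bar>\<dots>\<bar> \<le> (\<Sum>j<N. B * K ^ 3)"
      by (intro order_trans[OF sum_abs] sum_mono order_trans[OF abs_mean_le] mean_le_const
            increment_swap_gap_taylor[OF lip _ _ B taylor]) auto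
    finally show ?thesis by simp
  qed
  \<comment> \<open>Replacing the kernel by its mean, the variance of \<open>g\<close>, costs at
    most its mean absolute deviation, hence its standard deviation.\<close>
  have 2: "\<bar>expect N (\<lambda>p. ?T p * \<phi>' (g p)) - perm_variance N g * expect N (\<lambda>p. \<phi>' (g p))\<bar> \<le> B' * sqrt (perm_variance N ?T)"
  proof -
    have "expect N (\<lambda>p. ?T p * \<phi>' (g p)) - perm_variance N g * expect N (\<lambda>p. \<phi>' (g p))
       = expect N (\<lambda>p. (?T p - perm_variance N g) * \<phi>' (g p))"
      by (simp add: left_diff_distrib mean_diff mean_cmult)
    also have "\<bar>\<dots>\<bar> \<le> expect N (\<lambda>p. \<bar>?T p - perm_variance N g\<bar> * B')"
      by (intro order_trans[OF abs_mean_le] mean_mono) (auto simp: abs_mult intro!: mult_left_mono bdd)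
    also have "\<dots> = B' * expect N (\<lambda>p. \<bar>?T p - perm_variance N g\<bar>)"
      by (simp add: mean_multc)
    also have "\<dots> \<le> B' * sqrt (perm_variance N ?T)"
    proof (intro mult_left_mono real_le_rsqrt B')
      show "(expect N (\<lambda>p. \<bar>?T p - perm_variance N g\<bar>))\<^sup>2 \<le> perm_variance N ?T"
        unfolding perm_variance_def[of N ?T] expect_stein_kernel
        using square_mean_le[of "perms N 0" "\<lambda>p. \<bar>?T p - perm_variance N g\<bar>"] by simp
    qed
    finally show ?thesis .
  qed
  show ?thesis using 1 2 by linarith
qed

section \<open>Fluctuations of the Stein kernel\<close>

lemma square_sum_le:
  fixes x y :: real
  shows "(x + y)\<^sup>2 \<le> 2 * x\<^sup>2 + 2 * y\<^sup>2"
  using sum_squares_ge_zero[of "x - y" 0] by (simp add: power2_eq_square algebra_simps)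

lemma tail_mean_square_le: "(tail_mean N j g p)\<^sup>2 \<le> tail_mean N j (\<lambda>p. (g p)\<^sup>2) p"
  unfolding tail_mean_def by (rule square_mean_le) auto

text \<open>An Efron-Stein type bound. With \<open>P\<close> the conditional expectation and
  \<open>L\<close> the gap, a self-adjoint idempotent turns \<open>E[P(L) L]\<close> into
  \<open>E[P(L)^2]\<close>, and Jensen removes \<open>P\<close>. It will be applied to the Stein
  kernel.\<close>

lemma perm_variance_le: "perm_variance N g \<le> (\<Sum>j<N. expect N (\<lambda>p. (swap_gap N j g p)\<^sup>2))"
proof -
  have "expect N (\<lambda>p. increment N j g p * swap_gap N j g p) \<le> expect N (\<lambda>p. (swap_gap N j g p)\<^sup>2)"
    if j: "j < N" for j
  proof -
    let ?L = "swap_gap N j g" and ?P = "tail_mean N (Suc j)"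
    have "expect N (\<lambda>p. increment N j g p * ?L p) = expect N (\<lambda>p. ?P (?P ?L) p * ?L p)"
      by (simp add: increment_eq_tail_mean[OF j] tail_mean_tail_mean)
    also have "\<dots> = expect N (\<lambda>p. (?P ?L p)\<^sup>2)"
      by (subst expect_tail_mean_mult) (simp add: power2_eq_square)
    also have "\<dots> \<le> expect N (?P (\<lambda>p. (?L p)\<^sup>2))"
      by (intro mean_mono tail_mean_square_le)
    finally show ?thesis by (simp add: expect_tail_mean)
  qed
  then show ?thesis
    unfolding expect_stein_kernel[symmetric] stein_kernel_def[abs_def] mean_sum
    by (intro sum_mono) auto
qed

text \<open>
  A dual form of Doob's \<open>L\<^sup>2\<close> inequality: expand the square and use that the terms with the
  smaller index are fixed by the later averages.
\<close>

lemma sum_tail_mean_square_le: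
  assumes nonneg: "\<And>j p. 0 \<le> x j p"
  shows "expect N (\<lambda>p. (\<Sum>j<n. tail_mean N (Suc j) (x j) p)\<^sup>2) \<le> 4 * expect N (\<lambda>p. (\<Sum>j<n. x j p)\<^sup>2)"
proof -
  define e where "e j = tail_mean N (Suc j) (x j)" for j
  have e: "0 \<le> e j p" for j p
    unfolding e_def tail_mean_def by (intro mean_nonneg nonneg)
  define S where "S p = (\<Sum>j<n. e j p)" for p
  define R where "R p = (\<Sum>j<n. x j p)" for p
  have e_mult: "expect N (\<lambda>p. e j p * e k p) = expect N (\<lambda>p. e j p * x k p)" if "j \<le> k" for j k
    using expect_tail_mean_mult[of N "Suc k" "e j" "x k"] that
    by (simp add: e_def tail_mean_tail_mean)
  have "expect N (\<lambda>p. (S p)\<^sup>2) \<le> expect N (\<lambda>p. 2 * (\<Sum>j<n. \<Sum>k<n. of_bool (j \<le> k) * (e j p * e k p)))"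
  proof (intro mean_mono)
    fix p
    have "(S p)\<^sup>2 = (\<Sum>j<n. \<Sum>k<n. e j p * e k p)"
      by (simp add: S_def power2_eq_square sum_product)
    also have "\<dots> \<le> (\<Sum>j<n. \<Sum>k<n. of_bool (j \<le> k) * (e j p * e k p) + of_bool (k \<le> j) * (e k p * e j p))"
      by (intro sum_mono) (auto simp: e mult.commute)
    also have "\<dots> = (\<Sum>j<n. \<Sum>k<n. of_bool (j \<le> k) * (e j p * e k p)) + (\<Sum>k<n. \<Sum>j<n. of_bool (k \<le> j) * (e k p * e j p))"
      by (simp only: sum.distrib) (subst (2) sum.swap, rule refl)
    finally show "(S p)\<^sup>2 \<le> 2 * (\<Sum>j<n. \<Sum>k<n. of_bool (j \<le> k) * (e j p * e k p))"
      by simp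
  qed
  also have "\<dots> = 2 * (\<Sum>j<n. \<Sum>k<n. of_bool (j \<le> k) * expect N (\<lambda>p. e j p * e k p))"
    by (simp only: mean_cmult mean_sum)
  also have "\<dots> = 2 * (\<Sum>j<n. \<Sum>k<n. of_bool (j \<le> k) * expect N (\<lambda>p. e j p * x k p))"
    by (intro arg_cong[of _ _ "(*) 2"] sum.cong) (auto simp: e_mult)
  also have "\<dots> \<le> 2 * (\<Sum>j<n. \<Sum>k<n. expect N (\<lambda>p. e j p * x k p))"
    by (intro mult_left_mono sum_mono) (auto intro!: mean_nonneg mult_nonneg_nonneg e nonneg)
  also have "\<dots> = 2 * expect N (\<lambda>p. S p * R p)"
    by (simp add: S_def R_def sum_product mean_sum)
  finally have *: "expect N (\<lambda>p. (S p)\<^sup>2) \<le> 2 * expect N (\<lambda>p. S p * R p)" .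
  have S2: "0 \<le> expect N (\<lambda>p. (S p)\<^sup>2)" and R2: "0 \<le> expect N (\<lambda>p. (R p)\<^sup>2)"
    by (auto intro!: mean_nonneg)
  \<comment> \<open>Cauchy-Schwarz for \<open>E[S R]\<close>; cancelling one factor
    \<open>E[S^2]\<close> leaves the constant \<open>4\<close>, the square of the \<open>2\<close>
    from symmetrisation.\<close>
  have "(expect N (\<lambda>p. (S p)\<^sup>2))\<^sup>2 \<le> (2 * expect N (\<lambda>p. S p * R p))\<^sup>2"
    using * S2 by (intro power_mono)
  also have "\<dots> \<le> 4 * (expect N (\<lambda>p. (S p)\<^sup>2) * expect N (\<lambda>p. (R p)\<^sup>2))"
    using mean_mult_le[of "perms N 0" S R] by (simp add: power_mult_distrib)
  finally have "expect N (\<lambda>p. (S p)\<^sup>2) * expect N (\<lambda>p. (S p)\<^sup>2) \<le> expect N (\<lambda>p. (S p)\<^sup>2) * (4 * expect N (\<lambda>p. (R p)\<^sup>2))"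
    by (simp add: power2_eq_square mult_ac)
  then have "expect N (\<lambda>p. (S p)\<^sup>2) \<le> 4 * expect N (\<lambda>p. (R p)\<^sup>2)"
    using S2 R2 by (cases "expect N (\<lambda>p. (S p)\<^sup>2) = 0") (auto simp: mult_le_cancel_left)
  then show ?thesis by (simp add: S_def R_def e_def)
qed

section \<open>Hardy's inequality for tail averages\<close>

lemma hardy_aux:
  fixes y :: "nat \<Rightarrow> real"
  shows "(\<Sum>i<n. ((\<Sum>l\<le>i. y l) / Suc i)\<^sup>2) + n * ((\<Sum>l<n. y l) / n)\<^sup>2
     \<le> 2 * (\<Sum>i<n. ((\<Sum>l\<le>i. y l) / Suc i) * y i)"
proof (induction n)
  case (Suc n)
  define a where "a = (\<Sum>l<n. y l) / n"
  define b where "b = (\<Sum>l\<le>n. y l) / Suc n"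
  have b: "((\<Sum>l<n. y l) + y n) / real (Suc n) = b"
    by (simp add: b_def lessThan_Suc_atMost[symmetric])
  have y: "y n = real (Suc n) * b - real n * a"
    by (simp add: a_def b_def lessThan_Suc_atMost[symmetric] del: of_nat_Suc)
  \<comment> \<open>The extra term of the statement, \<open>n\<close> times the squared mean, is a
    potential that closes the induction: the step leaves exactly the square
    \<open>n * (a - b)^2\<close>.\<close>
  have "2 * (b * y n) - (b\<^sup>2 + Suc n * b\<^sup>2 - n * a\<^sup>2) = n * (a - b)\<^sup>2"
    unfolding y by (simp add: power2_eq_square algebra_simps)
  also have "\<dots> \<ge> 0" by simp
  finally show ?case
    using Suc by (simp only: b sum.lessThan_Suc b_def[symmetric] a_def[symmetric] distrib_left)
qed simp

text \<open>By \<open>2 A y \<le> A^2 / 2 + 2 y^2\<close> half of the left side is absorbed, which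
  produces Hardy's constant \<open>4\<close>.\<close>

lemma hardy_prefix:
  fixes y :: "nat \<Rightarrow> real"
  shows "(\<Sum>i<n. ((\<Sum>l\<le>i. y l) / Suc i)\<^sup>2) \<le> 4 * (\<Sum>i<n. (y i)\<^sup>2)"
proof -
  define A where "A i = (\<Sum>l\<le>i. y l) / Suc i" for i
  have "(\<Sum>i<n. (A i)\<^sup>2) + n * ((\<Sum>l<n. y l) / n)\<^sup>2 \<le> 2 * (\<Sum>i<n. A i * y i)"
    unfolding A_def by (rule hardy_aux)
  moreover have "0 \<le> n * ((\<Sum>l<n. y l) / n)\<^sup>2" by simp
  ultimately have "(\<Sum>i<n. (A i)\<^sup>2) \<le> 2 * (\<Sum>i<n. A i * y i)" by linarith
  moreover have "2 * (\<Sum>i<n. A i * y i) \<le> (\<Sum>i<n. (A i)\<^sup>2 / 2 + 2 * (y i)\<^sup>2)"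
    unfolding sum_distrib_left
  proof (intro sum_mono)
    fix i
    show "2 * (A i * y i) \<le> (A i)\<^sup>2 / 2 + 2 * (y i)\<^sup>2"
      using zero_le_power2[of "A i - 2 * y i"] by (simp add: power2_eq_square algebra_simps)
  qed
  ultimately show ?thesis
    by (simp add: A_def sum.distrib sum_divide_distrib[symmetric] sum_distrib_left[symmetric])
qed

text \<open>Reversing the indices turns averages over tails into prefix averages.\<close>

lemma hardy:
  fixes y :: "nat \<Rightarrow> real"
  shows "(\<Sum>i<N. (mean {i..<N} y)\<^sup>2) \<le> 4 * (\<Sum>i<N. (y i)\<^sup>2)"
proof -
  have "(\<Sum>i<N. (mean {i..<N} y)\<^sup>2) = (\<Sum>i<N. (mean {N - Suc i..<N} y)\<^sup>2)"
    by (rule sum.nat_diff_reindex[symmetric])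
  also have "\<dots> = (\<Sum>i<N. ((\<Sum>l\<le>i. y (N - Suc l)) / Suc i)\<^sup>2)"
  proof (intro sum.cong refl)
    fix i assume "i \<in> {..<N}"
    then have i: "i < N" by simp
    have "(\<Sum>l\<le>i. y (N - Suc l)) = (\<Sum>l\<in>{N - Suc i..<N}. y l)"
      by (rule sum.reindex_bij_witness[of _ "\<lambda>l. N - Suc l" "\<lambda>l. N - Suc l"]) (use i in auto)
    then show "(mean {N - Suc i..<N} y)\<^sup>2 = ((\<Sum>l\<le>i. y (N - Suc l)) / Suc i)\<^sup>2"
      using i by (simp add: mean_def)
  qed
  also have "\<dots> \<le> 4 * (\<Sum>i<N. (y (N - Suc i))\<^sup>2)"
    by (rule hardy_prefix)
  also have "(\<Sum>i<N. (y (N - Suc i))\<^sup>2) = (\<Sum>i<N. (y i)\<^sup>2)"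
    by (rule sum.nat_diff_reindex)
  finally show ?thesis .
qed

text \<open>The total weight that position \<open>k\<close> receives from the averages over
  \<open>{j..<N}\<close> with \<open>j \<le> k\<close>. For \<open>k < N\<close> it is a difference
  of harmonic numbers and reaches order \<open>ln N\<close> at the last position, so only its square
  sum is controlled.\<close>

definition tail_weight :: "nat \<Rightarrow> nat \<Rightarrow> real" where
  "tail_weight N k = (\<Sum>j\<le>k. 1 / real (N - j))"

lemma tail_weight_nonneg: "0 \<le> tail_weight N k"
  unfolding tail_weight_def by (intro sum_nonneg) auto

lemma sum_mean_tail: "(\<Sum>j<N. mean {j..<N} y) = (\<Sum>k<N. tail_weight N k * y k)"
proof -
  have "(\<Sum>j<N. mean {j..<N} y) = (\<Sum>j<N. \<Sum>k\<in>{j..<N}. y k / real (N - j))"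
    by (simp add: mean_def sum_divide_distrib)
  also have "\<dots> = (\<Sum>k<N. \<Sum>j\<le>k. y k / real (N - j))"
    unfolding sum.Sigma[OF finite_lessThan ballI, OF finite_atLeastLessThan]
      sum.Sigma[OF finite_lessThan ballI, OF finite_atMost]
    by (rule sum.reindex_bij_witness[of _ "\<lambda>(k, j). (j, k)" "\<lambda>(k, j). (j, k)"]) auto
  finally show ?thesis
    by (simp add: tail_weight_def sum_distrib_right)
qed

text \<open>Duality: exchanging sums writes the square sum of \<open>?h\<close> as the sum of the
  tail averages of \<open>?h\<close>. Cauchy-Schwarz against the constant \<open>1\<close>, followed
  by Hardy, bounds it by a multiple of its own square root.\<close>

lemma sum_tail_weight_square_le: "(\<Sum>k<N. (tail_weight N k)\<^sup>2) \<le> 4 * real N"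
proof -
  let ?h = "tail_weight N"
  let ?s = "\<Sum>k<N. (?h k)\<^sup>2"
  have s: "0 \<le> ?s" by (intro sum_nonneg) auto
  have "?s = (\<Sum>j<N. mean {j..<N} ?h * 1)"
    by (simp add: sum_mean_tail power2_eq_square)
  then have "?s\<^sup>2 \<le> (\<Sum>j<N. (mean {j..<N} ?h)\<^sup>2) * (\<Sum>j<N. 1\<^sup>2)"
    using Cauchy_Schwarz_ineq_sum[of "\<lambda>j. mean {j..<N} ?h" "\<lambda>_. 1" "{..<N}"] by simp
  also have "\<dots> \<le> (4 * ?s) * (\<Sum>j<N. 1\<^sup>2)"
    by (intro mult_right_mono hardy) auto
  finally have "?s * ?s \<le> ?s * (4 * real N)"
    by (simp add: power2_eq_square mult_ac)
  then show ?thesis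
    using s by (cases "?s = 0") (auto simp: mult_le_cancel_left)
qed

text \<open>Absolute values sit inside the average, unlike in \<open>swap_gap\<close>: in a product,
  the difference of one factor is multiplied by a value of the other that varies with
  \<open>l\<close>, so signed averages could not be used.\<close>

definition local_variation :: "nat \<Rightarrow> nat \<Rightarrow> ((nat \<Rightarrow> nat) \<Rightarrow> real) \<Rightarrow> (nat \<Rightarrow> nat) \<Rightarrow> real" where
  "local_variation N i g p = mean {i..<N} (\<lambda>l. \<bar>g p - g (p \<circ> swp i l)\<bar>)"

lemma local_variation_nonneg: "0 \<le> local_variation N i g p"
  unfolding local_variation_def by (intro mean_nonneg) auto

lemma swap_gap_mult_le:
  assumes i: "i < N" and p: "p \<in> perms N 0"
    and g: "\<And>q. q \<in> perms N 0 \<Longrightarrow> \<bar>g q\<bar> \<le> K" and h: "\<And>q. q \<in> perms N 0 \<Longrightarrow> \<bar>h q\<bar> \<le> K"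
  shows "\<bar>swap_gap N i (\<lambda>p. g p * h p) p\<bar> \<le> K * (local_variation N i g p + local_variation N i h p)"
proof -
  have "\<bar>swap_gap N i (\<lambda>p. g p * h p) p\<bar> \<le> mean {i..<N} (\<lambda>l. K * (\<bar>g p - g (p \<circ> swp i l)\<bar> + \<bar>h p - h (p \<circ> swp i l)\<bar>))"
    unfolding swap_gap_eq_mean[OF i]
  proof (intro order_trans[OF abs_mean_le] mean_mono)
    fix l assume l: "l \<in> {i..<N}"
    define q where "q = p \<circ> swp i l"
    have q: "q \<in> perms N 0"
      unfolding q_def using l i by (intro perms_comp p perms_0[OF swp_in_perms[of i i N l]]) auto
    have "g p * h p - g q * h q = (g p - g q) * h p + g q * (h p - h q)"
      by (simp add: algebra_simps)
    also have "\<bar>\<dots>\<bar> \<le> \<bar>g p - g q\<bar> * \<bar>h p\<bar> + \<bar>g q\<bar> * \<bar>h p - h q\<bar>"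
      by (metis abs_mult abs_triangle_ineq)
    also have "\<dots> \<le> \<bar>g p - g q\<bar> * K + K * \<bar>h p - h q\<bar>"
      by (intro add_mono mult_mono g h p q) (auto intro: order_trans[OF _ g[OF p]])
    finally show "\<bar>g p * h p - g (p \<circ> swp i l) * h (p \<circ> swp i l)\<bar> \<le> K * (\<bar>g p - g (p \<circ> swp i l)\<bar> + \<bar>h p - h (p \<circ> swp i l)\<bar>)"
      by (simp add: q_def algebra_simps)
  qed
  then show ?thesis
    by (simp add: local_variation_def mean_cmult mean_add)
qed

lemma swp_comp:
  assumes "inj r" "surj r"
  shows "swp i l \<circ> r = r \<circ> swp (inv r i) (inv r l)"
proof -
  obtain i' l' where "i = r i'" "l = r l'" using assms(2) by (metis surjD)
  then show ?thesis
    using assms(1) by (auto simp: fun_eq_iff Transposition.transpose_def inj_eq)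
qed

text \<open>Averaging over all \<open>l \<ge> i\<close> lets the variation pass under the
  conditional expectation: moving the transposition past \<open>r\<close> replaces \<open>l\<close>
  by \<open>inv r l\<close>, which merely permutes \<open>{i..<N}\<close>.\<close>

lemma local_variation_tail_mean_le:
  assumes "i < N" "j < N"
  shows "local_variation N i (tail_mean N (Suc j) g) p \<le> tail_mean N (Suc j) (local_variation N i g) p"
proof (cases "i \<le> j")
  \<comment> \<open>For \<open>i > j\<close> the transposition acts only on positions above
    \<open>j\<close>, over which \<open>tail_mean\<close> already averages, so nothing
    varies.\<close>
  case False
  have "local_variation N i (tail_mean N (Suc j) g) p = mean {i..<N} (\<lambda>l. 0)"
    unfolding local_variation_def
    by (rule mean_cong) (use False in \<open>auto intro!: tail_mean_comp[symmetric] swp_in_perms\<close>)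
  also have "\<dots> \<le> tail_mean N (Suc j) (local_variation N i g) p"
    unfolding tail_mean_def by (auto simp: mean_def intro!: divide_nonneg_nonneg sum_nonneg local_variation_nonneg)
  finally show ?thesis .
next
  case True
  have "local_variation N i (tail_mean N (Suc j) g) p
     \<le> mean {i..<N} (\<lambda>l. mean (perms N (Suc j)) (\<lambda>r. \<bar>g (p \<circ> r) - g (p \<circ> r \<circ> swp i (inv r l))\<bar>))"
    unfolding local_variation_def tail_mean_def mean_diff[symmetric]
  proof (intro mean_mono order_trans[OF abs_mean_le])
    fix l r assume r: "r \<in> perms N (Suc j)"
    have "r i = i"
      using r True by (auto simp: perms_def intro: permutes_not_in)
    then have "inv r i = i"
      using perms_inj[OF perms_0[OF r]] by (metis inv_f_f)
    moreover have "surj r" using r permutes_surj unfolding perms_def by blast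
    ultimately have "swp i l \<circ> r = r \<circ> swp i (inv r l)"
      using swp_comp[of r i l] perms_inj[OF perms_0[OF r]] by simp
    then show "\<bar>g (p \<circ> r) - g (p \<circ> swp i l \<circ> r)\<bar> \<le> \<bar>g (p \<circ> r) - g (p \<circ> r \<circ> swp i (inv r l))\<bar>"
      by (simp add: o_assoc[symmetric])
  qed
  also have "\<dots> = mean (perms N (Suc j)) (\<lambda>r. mean {i..<N} (\<lambda>l. \<bar>g (p \<circ> r) - g (p \<circ> r \<circ> swp i (inv r l))\<bar>))"
    by (rule mean_swap)
  also have "\<dots> = tail_mean N (Suc j) (local_variation N i g) p"
    unfolding tail_mean_def local_variation_def
  proof (rule mean_cong)
    fix r assume "r \<in> perms N (Suc j)"
    then have "inv r \<in> perms N i"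
      using True perms_mono[of i "Suc j" N] by (intro perms_inv) auto
    then have "bij_betw (inv r) {i..<N} {i..<N}"
      by (auto simp: perms_def permutes_imp_bij)
    from mean_reindex[OF this, of "\<lambda>l. \<bar>g (p \<circ> r) - g (p \<circ> r \<circ> swp i l)\<bar>"]
    show "mean {i..<N} (\<lambda>l. \<bar>g (p \<circ> r) - g (p \<circ> r \<circ> swp i (inv r l))\<bar>) = mean {i..<N} (\<lambda>l. \<bar>g (p \<circ> r) - g (p \<circ> r \<circ> swp i l)\<bar>)"
      by simp
  qed
  finally show ?thesis .
qed


section \<open>Decoupled transpositions and the variance of the kernel\<close>

definition touching :: "(nat \<Rightarrow> nat \<Rightarrow> bool) \<Rightarrow> nat \<Rightarrow> nat \<Rightarrow> nat \<Rightarrow> nat \<Rightarrow> bool" where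
  "touching c i l j k \<longleftrightarrow> c i j \<or> c i k \<or> c l j \<or> c l k"

text \<open>Up to the factor \<open>2 * K\<close>, this will bound the effect of a random swap at
  \<open>i\<close> on the gap at \<open>j\<close>, since only touching transpositions have a nonzero
  mixed second difference.\<close>

definition interaction :: "nat \<Rightarrow> (nat \<Rightarrow> nat \<Rightarrow> bool) \<Rightarrow> nat \<Rightarrow> nat \<Rightarrow> real" where
  "interaction N c i j = mean {i..<N} (\<lambda>l. mean {j..<N} (\<lambda>k. of_bool (touching c i l j k)))"

lemma interaction_nonneg: "0 \<le> interaction N c i j"
  unfolding interaction_def by (intro mean_nonneg) auto

definition swaps_decouple :: "nat \<Rightarrow> ((nat \<Rightarrow> nat) \<Rightarrow> nat \<Rightarrow> nat \<Rightarrow> bool) \<Rightarrow> ((nat \<Rightarrow> nat) \<Rightarrow> real) \<Rightarrow> bool" where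
  "swaps_decouple N c g \<longleftrightarrow>
     (\<forall>p\<in>perms N 0. \<forall>i<N. \<forall>l<N. \<forall>j<N. \<forall>k<N. \<not> touching (c p) i l j k \<longrightarrow>
        g p - g (p \<circ> swp j k) = g (p \<circ> swp i l) - g (p \<circ> swp i l \<circ> swp j k))"

lemma local_variation_swap_gap_le:
  assumes lip: "swap_lipschitz N K g" and dec: "swaps_decouple N c g"
    and p: "p \<in> perms N 0" and i: "i < N" and j: "j < N"
  shows "local_variation N i (swap_gap N j g) p \<le> 2 * K * interaction N (c p) i j"
proof -
  have "local_variation N i (swap_gap N j g) p
      \<le> mean {i..<N} (\<lambda>l. mean {j..<N} (\<lambda>k. 2 * K * of_bool (touching (c p) i l j k)))"
    unfolding local_variation_def swap_gap_eq_mean[OF j] mean_diff[symmetric]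
  proof (intro mean_mono order_trans[OF abs_mean_le])
    fix l k assume lk: "l \<in> {i..<N}" "k \<in> {j..<N}"
    have q: "p \<circ> swp i l \<in> perms N 0"
      using lk i by (intro perms_comp p perms_0[OF swp_in_perms[of i i N l]]) auto
    have "\<bar>g p - g (p \<circ> swp j k)\<bar> \<le> K" "\<bar>g (p \<circ> swp i l) - g (p \<circ> swp i l \<circ> swp j k)\<bar> \<le> K"
      using lip p q lk j unfolding swap_lipschitz_def by auto
    moreover have "g p - g (p \<circ> swp j k) = g (p \<circ> swp i l) - g (p \<circ> swp i l \<circ> swp j k)"
      if "\<not> touching (c p) i l j k"
      using dec p lk i j that unfolding swaps_decouple_def by auto
    ultimately show "\<bar>g p - g (p \<circ> swp j k) - (g (p \<circ> swp i l) - g (p \<circ> swp i l \<circ> swp j k))\<bar>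
      \<le> 2 * K * of_bool (touching (c p) i l j k)"
      by (cases "touching (c p) i l j k") auto
  qed
  also have "\<dots> = 2 * K * interaction N (c p) i j"
    by (simp add: interaction_def mean_cmult)
  finally show ?thesis .
qed

lemma swap_gap_sum: "swap_gap N i (\<lambda>p. \<Sum>j\<in>J. g j p) p = (\<Sum>j\<in>J. swap_gap N i (g j) p)"
  by (simp add: swap_gap_def swap_mean_def mean_sum sum_subtractf)

lemma increment_fun: "j < N \<Longrightarrow> increment N j g = tail_mean N (Suc j) (swap_gap N j g)"
  by (rule ext) (rule increment_eq_tail_mean)

text \<open>Leibniz rule for each product in the kernel: both factors are bounded by
  \<open>K\<close>, and each varies by at most \<open>2 * K\<close> times an interaction,
  conditionally averaged in the case of the increment.\<close>

lemma swap_gap_stein_kernel_le: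
  assumes lip: "swap_lipschitz N K g" and dec: "swaps_decouple N c g"
    and p: "p \<in> perms N 0" and i: "i < N"
  shows "\<bar>swap_gap N i (stein_kernel N g) p\<bar>
    \<le> 2 * K\<^sup>2 * ((\<Sum>j<N. interaction N (c p) i j) + (\<Sum>j<N. tail_mean N (Suc j) (\<lambda>p. interaction N (c p) i j) p))"
proof -
  have K: "0 \<le> K" using swap_gap_le[OF lip p i] by linarith
  have "\<bar>swap_gap N i (\<lambda>p. increment N j g p * swap_gap N j g p) p\<bar>
      \<le> 2 * K\<^sup>2 * (interaction N (c p) i j + tail_mean N (Suc j) (\<lambda>p. interaction N (c p) i j) p)"
    if j: "j < N" for j
  proof -
    have "local_variation N i (increment N j g) p \<le> tail_mean N (Suc j) (local_variation N i (swap_gap N j g)) p"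
      unfolding increment_fun[OF j] by (rule local_variation_tail_mean_le[OF i j])
    also have "\<dots> \<le> tail_mean N (Suc j) (\<lambda>p. 2 * K * interaction N (c p) i j) p"
      by (intro tail_mean_mono p local_variation_swap_gap_le lip dec i j)
    also have "\<dots> = 2 * K * tail_mean N (Suc j) (\<lambda>p. interaction N (c p) i j) p"
      by (simp add: tail_mean_def mean_cmult)
    finally have 1: "local_variation N i (increment N j g) p \<le> 2 * K * tail_mean N (Suc j) (\<lambda>p. interaction N (c p) i j) p" .
    have "\<bar>swap_gap N i (\<lambda>p. increment N j g p * swap_gap N j g p) p\<bar>
        \<le> K * (local_variation N i (increment N j g) p + local_variation N i (swap_gap N j g) p)"
      by (rule swap_gap_mult_le[OF i p increment_le[OF lip _ j] swap_gap_le[OF lip _ j]])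
    also have "\<dots> \<le> K * (2 * K * tail_mean N (Suc j) (\<lambda>p. interaction N (c p) i j) p + 2 * K * interaction N (c p) i j)"
      by (intro mult_left_mono add_mono 1 local_variation_swap_gap_le lip dec p i j K)
    finally show ?thesis by (simp add: power2_eq_square algebra_simps)
  qed
  then have "(\<Sum>j<N. \<bar>swap_gap N i (\<lambda>p. increment N j g p * swap_gap N j g p) p\<bar>) \<le>
     (\<Sum>j<N. 2 * K\<^sup>2 * (interaction N (c p) i j + tail_mean N (Suc j) (\<lambda>p. interaction N (c p) i j) p))"
    by (intro sum_mono) auto
  then show ?thesis
    unfolding stein_kernel_def[abs_def] swap_gap_sum sum.distrib[symmetric]
    using order_trans[OF sum_abs] by (simp add: sum_distrib_left)
qed

text \<open>The constant is \<open>40 = 8 * (1 + 4)\<close>: \<open>8\<close> from squaring the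
  bound on the gap, \<open>4\<close> from the dual Doob inequality.\<close>

lemma perm_variance_stein_kernel_le:
  assumes lip: "swap_lipschitz N K g" and dec: "swaps_decouple N c g"
  shows "perm_variance N (stein_kernel N g)
    \<le> 40 * K ^ 4 * expect N (\<lambda>p. \<Sum>i<N. (\<Sum>j<N. interaction N (c p) i j)\<^sup>2)"
proof -
  have "expect N (\<lambda>p. (swap_gap N i (stein_kernel N g) p)\<^sup>2) \<le> 40 * K ^ 4 * expect N (\<lambda>p. (\<Sum>j<N. interaction N (c p) i j)\<^sup>2)"
    if i: "i < N" for i
  proof -
    define S where "S p = (\<Sum>j<N. interaction N (c p) i j)" for p
    define R where "R p = (\<Sum>j<N. tail_mean N (Suc j) (\<lambda>p. interaction N (c p) i j) p)" for p
    have "expect N (\<lambda>p. (swap_gap N i (stein_kernel N g) p)\<^sup>2) \<le> expect N (\<lambda>p. 8 * K ^ 4 * ((S p)\<^sup>2 + (R p)\<^sup>2))"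
    proof (intro mean_mono)
      fix p assume p: "p \<in> perms N 0"
      have "\<bar>swap_gap N i (stein_kernel N g) p\<bar> \<le> 2 * K\<^sup>2 * (S p + R p)"
        using swap_gap_stein_kernel_le[OF lip dec p i] by (simp add: S_def R_def)
      then have "\<bar>swap_gap N i (stein_kernel N g) p\<bar>\<^sup>2 \<le> (2 * K\<^sup>2 * (S p + R p))\<^sup>2"
        by (intro power_mono) auto
      also have "\<dots> = 4 * K ^ 4 * (S p + R p)\<^sup>2"
        by (simp add: power_mult_distrib)
      also have "\<dots> \<le> 4 * K ^ 4 * (2 * (S p)\<^sup>2 + 2 * (R p)\<^sup>2)"
        by (intro mult_left_mono square_sum_le) auto
      finally show "(swap_gap N i (stein_kernel N g) p)\<^sup>2 \<le> 8 * K ^ 4 * ((S p)\<^sup>2 + (R p)\<^sup>2)"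
        by (simp add: algebra_simps)
    qed
    also have "\<dots> = 8 * K ^ 4 * (expect N (\<lambda>p. (S p)\<^sup>2) + expect N (\<lambda>p. (R p)\<^sup>2))"
      by (simp only: mean_cmult mean_add)
    also have "\<dots> \<le> 8 * K ^ 4 * (expect N (\<lambda>p. (S p)\<^sup>2) + 4 * expect N (\<lambda>p. (S p)\<^sup>2))"
      unfolding S_def R_def
      by (intro mult_left_mono add_left_mono sum_tail_mean_square_le interaction_nonneg) auto
    finally show ?thesis by (simp add: S_def)
  qed
  then have "(\<Sum>i<N. expect N (\<lambda>p. (swap_gap N i (stein_kernel N g) p)\<^sup>2))
     \<le> (\<Sum>i<N. 40 * K ^ 4 * expect N (\<lambda>p. (\<Sum>j<N. interaction N (c p) i j)\<^sup>2))"
    by (intro sum_mono) auto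
  then show ?thesis
    using perm_variance_le[of N "stein_kernel N g"] by (simp add: mean_sum sum_distrib_left[symmetric])
qed

text \<open>Union bound over the four ways of touching. Summation over \<open>j\<close> turns
  averages over \<open>k \<ge> j\<close> into \<open>tail_weight\<close>, while the average over
  \<open>l\<close> stays outside, to be handled by Hardy.\<close>

lemma sum_interaction_le:
  assumes "i < N"
  shows "(\<Sum>j<N. interaction N c i j) \<le>
     (\<Sum>k<N. of_bool (c i k)) + (\<Sum>k<N. tail_weight N k * of_bool (c i k))
     + mean {i..<N} (\<lambda>l. \<Sum>k<N. of_bool (c l k)) + mean {i..<N} (\<lambda>l. \<Sum>k<N. tail_weight N k * of_bool (c l k))"
proof -
  have "interaction N c i j \<le> of_bool (c i j) + mean {j..<N} (\<lambda>k. of_bool (c i k))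
     + mean {i..<N} (\<lambda>l. of_bool (c l j)) + mean {i..<N} (\<lambda>l. mean {j..<N} (\<lambda>k. of_bool (c l k)))"
    if "j < N" for j
  proof -
    have "interaction N c i j \<le> mean {i..<N} (\<lambda>l. mean {j..<N} (\<lambda>k.
        of_bool (c i j) + of_bool (c i k) + of_bool (c l j) + of_bool (c l k)))"
      unfolding interaction_def by (intro mean_mono) (auto simp: touching_def)
    then show ?thesis
      using assms that by (simp add: mean_add mean_const)
  qed
  then have "(\<Sum>j<N. interaction N c i j) \<le> (\<Sum>j<N. of_bool (c i j) + mean {j..<N} (\<lambda>k. of_bool (c i k))
     + mean {i..<N} (\<lambda>l. of_bool (c l j)) + mean {i..<N} (\<lambda>l. mean {j..<N} (\<lambda>k. of_bool (c l k))))"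
    by (intro sum_mono) auto
  then show ?thesis
    by (simp only: sum.distrib sum_mean_tail mean_sum[symmetric])
qed

text \<open>Cauchy-Schwarz within each row. Near pairs form a symmetric matrix with row sums at most
  \<open>b\<close>, so a Schur test applies; for far pairs the full square sum of \<open>w\<close>
  is conceded and only their number counts.\<close>

lemma weighted_row_sums_le:
  fixes w :: "nat \<Rightarrow> real"
  assumes sym: "\<And>i k. i < N \<Longrightarrow> k < N \<Longrightarrow> near i k \<Longrightarrow> near k i"
    and row: "\<And>i. i < N \<Longrightarrow> card {k. k < N \<and> near i k} \<le> b"
    and cover: "\<And>i k. i < N \<Longrightarrow> k < N \<Longrightarrow> c i k \<Longrightarrow> near i k \<or> far i k"
    and w: "\<And>k. 0 \<le> w k"
  shows "(\<Sum>i<N. (\<Sum>k<N. w k * of_bool (c i k))\<^sup>2)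
    \<le> 2 * (\<Sum>k<N. (w k)\<^sup>2) * ((real b)\<^sup>2 + (\<Sum>i<N. \<Sum>k<N. of_bool (far i k)))"
proof -
  define s where "s = (\<Sum>k<N. (w k)\<^sup>2)"
  have row': "(\<Sum>k<N. of_bool (near i k)) \<le> real b" if "i < N" for i
  proof -
    have "(\<Sum>k<N. of_bool (near i k)) = real (card {k. k < N \<and> near i k})"
      by (simp add: Int_def)
    with row[OF that] show ?thesis by simp
  qed
  have cs: "(\<Sum>k<N. w k * of_bool (q i k))\<^sup>2 \<le> (\<Sum>k<N. (w k)\<^sup>2 * of_bool (q i k)) * (\<Sum>k<N. of_bool (q i k))"
    for i and q :: "nat \<Rightarrow> nat \<Rightarrow> bool"
  proof -
    have eq: "(\<Sum>k<N. (w k * of_bool (q i k)) * of_bool (q i k)) = (\<Sum>k<N. w k * of_bool (q i k))"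
      "(\<Sum>k<N. (w k * of_bool (q i k))\<^sup>2) = (\<Sum>k<N. (w k)\<^sup>2 * of_bool (q i k))"
      "(\<Sum>k<N. (of_bool (q i k))\<^sup>2) = (\<Sum>k<N. of_bool (q i k) :: real)"
      by (intro sum.cong refl; simp)+
    show ?thesis
      using Cauchy_Schwarz_ineq_sum[of "\<lambda>k. w k * of_bool (q i k)" "\<lambda>k. of_bool (q i k)" "{..<N}"]
      unfolding eq .
  qed
  have near: "(\<Sum>i<N. (\<Sum>k<N. w k * of_bool (near i k))\<^sup>2) \<le> (real b)\<^sup>2 * s"
  proof -
    have "(\<Sum>i<N. (\<Sum>k<N. w k * of_bool (near i k))\<^sup>2) \<le> (\<Sum>i<N. (\<Sum>k<N. (w k)\<^sup>2 * of_bool (near i k)) * b)"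
      by (intro sum_mono order_trans[OF cs] mult_left_mono row' sum_nonneg) auto
    also have "\<dots> = b * (\<Sum>i<N. \<Sum>k<N. (w k)\<^sup>2 * of_bool (near i k))"
      by (simp only: sum_distrib_left sum_distrib_right mult_ac)
    also have "\<dots> = b * (\<Sum>k<N. (w k)\<^sup>2 * (\<Sum>i<N. of_bool (near i k)))"
      by (subst sum.swap) (simp only: sum_distrib_left)
    also have "\<dots> \<le> b * (\<Sum>k<N. (w k)\<^sup>2 * b)"
    proof (intro mult_left_mono sum_mono)
      fix k assume "k \<in> {..<N}"
      then have k: "k < N" by simp
      have "(\<Sum>i<N. of_bool (near i k)) \<le> (\<Sum>i<N. of_bool (near k i) :: real)"
        using sym k by (intro sum_mono) (auto simp: of_bool_def)
      then show "(\<Sum>i<N. of_bool (near i k)) \<le> real b"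
        using row'[OF k] by linarith
    qed auto
    also have "\<dots> = (real b)\<^sup>2 * s"
      by (simp add: s_def sum_distrib_left sum_distrib_right power2_eq_square mult_ac)
    finally show ?thesis .
  qed
  have far: "(\<Sum>i<N. (\<Sum>k<N. w k * of_bool (far i k))\<^sup>2) \<le> s * (\<Sum>i<N. \<Sum>k<N. of_bool (far i k))"
  proof -
    have "(\<Sum>k<N. (w k)\<^sup>2 * of_bool (far i k)) \<le> s" for i
      unfolding s_def by (intro sum_mono) auto
    then have "(\<Sum>i<N. (\<Sum>k<N. w k * of_bool (far i k))\<^sup>2) \<le> (\<Sum>i<N. s * (\<Sum>k<N. of_bool (far i k)))"
      by (intro sum_mono order_trans[OF cs] mult_right_mono sum_nonneg) auto
    then show ?thesis by (simp add: sum_distrib_left)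
  qed
  have "(\<Sum>i<N. (\<Sum>k<N. w k * of_bool (c i k))\<^sup>2)
      \<le> (\<Sum>i<N. ((\<Sum>k<N. w k * of_bool (near i k)) + (\<Sum>k<N. w k * of_bool (far i k)))\<^sup>2)"
    unfolding sum.distrib[symmetric]
  proof (intro sum_mono power_mono sum_nonneg)
    fix i k assume "i \<in> {..<N}" "k \<in> {..<N}"
    then show "w k * of_bool (c i k) \<le> w k * of_bool (near i k) + w k * of_bool (far i k)"
      using cover[of i k] w[of k] by (auto simp: of_bool_def)
  qed (use w in auto)
  also have "\<dots> \<le> (\<Sum>i<N. 2 * (\<Sum>k<N. w k * of_bool (near i k))\<^sup>2 + 2 * (\<Sum>k<N. w k * of_bool (far i k))\<^sup>2)"
    by (intro sum_mono square_sum_le)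
  also have "\<dots> \<le> 2 * ((real b)\<^sup>2 * s) + 2 * (s * (\<Sum>i<N. \<Sum>k<N. of_bool (far i k)))"
    unfolding sum.distrib sum_distrib_left[symmetric] using near far by linarith
  finally show ?thesis by (simp add: s_def algebra_simps)
qed

text \<open>The rows weighted by \<open>1\<close> and by \<open>tail_weight\<close> contribute
  \<open>2\<close> and \<open>8\<close> times \<open>N * E\<close>, their tail averages four times
  as much by Hardy: \<open>4 * (2 + 8 + 8 + 32) = 200\<close>.\<close>

lemma sum_interaction_square_le:
  assumes sym: "\<And>i k. i < N \<Longrightarrow> k < N \<Longrightarrow> near i k \<Longrightarrow> near k i"
    and row: "\<And>i. i < N \<Longrightarrow> card {k. k < N \<and> near i k} \<le> b"
    and cover: "\<And>i k. i < N \<Longrightarrow> k < N \<Longrightarrow> c i k \<Longrightarrow> near i k \<or> far i k"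
  shows "(\<Sum>i<N. (\<Sum>j<N. interaction N c i j)\<^sup>2)
    \<le> 200 * real N * ((real b)\<^sup>2 + (\<Sum>i<N. \<Sum>k<N. of_bool (far i k)))"
proof -
  define X where "X i = (\<Sum>k<N. 1 * of_bool (c i k) :: real)" for i
  define Y where "Y i = (\<Sum>k<N. tail_weight N k * of_bool (c i k))" for i
  define E where "E = (real b)\<^sup>2 + (\<Sum>i<N. \<Sum>k<N. of_bool (far i k))"
  have E: "0 \<le> E" unfolding E_def by (intro add_nonneg_nonneg sum_nonneg) auto
  have "(\<Sum>i<N. (X i)\<^sup>2) \<le> 2 * (\<Sum>k<N. 1\<^sup>2) * E"
    unfolding X_def E_def by (rule weighted_row_sums_le[OF sym row cover]) auto
  then have X: "(\<Sum>i<N. (X i)\<^sup>2) \<le> 2 * (real N * E)" by simp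
  have "(\<Sum>i<N. (Y i)\<^sup>2) \<le> 2 * (\<Sum>k<N. (tail_weight N k)\<^sup>2) * E"
    unfolding Y_def E_def by (rule weighted_row_sums_le[OF sym row cover tail_weight_nonneg]) auto
  also have "\<dots> \<le> 2 * (4 * real N) * E"
    by (intro mult_right_mono mult_left_mono sum_tail_weight_square_le E) auto
  finally have Y: "(\<Sum>i<N. (Y i)\<^sup>2) \<le> 8 * (real N * E)" by simp
  have "(\<Sum>i<N. (\<Sum>j<N. interaction N c i j)\<^sup>2) \<le> (\<Sum>i<N. 4 * ((X i)\<^sup>2 + (Y i)\<^sup>2 + (mean {i..<N} X)\<^sup>2 + (mean {i..<N} Y)\<^sup>2))"
  proof (intro sum_mono)
    fix i assume "i \<in> {..<N}"
    then have le: "(\<Sum>j<N. interaction N c i j) \<le> (X i + Y i) + (mean {i..<N} X + mean {i..<N} Y)"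
      using sum_interaction_le[of i N c] by (simp add: X_def[abs_def] Y_def[abs_def])
    have "(\<Sum>j<N. interaction N c i j)\<^sup>2 \<le> ((X i + Y i) + (mean {i..<N} X + mean {i..<N} Y))\<^sup>2"
      by (intro power_mono le sum_nonneg interaction_nonneg)
    also have "\<dots> \<le> 2 * (X i + Y i)\<^sup>2 + 2 * (mean {i..<N} X + mean {i..<N} Y)\<^sup>2"
      by (rule square_sum_le)
    finally show "(\<Sum>j<N. interaction N c i j)\<^sup>2 \<le> 4 * ((X i)\<^sup>2 + (Y i)\<^sup>2 + (mean {i..<N} X)\<^sup>2 + (mean {i..<N} Y)\<^sup>2)"
      using square_sum_le[of "X i" "Y i"] square_sum_le[of "mean {i..<N} X" "mean {i..<N} Y"] by argo
  qed
  also have "\<dots> = 4 * ((\<Sum>i<N. (X i)\<^sup>2) + (\<Sum>i<N. (Y i)\<^sup>2) + (\<Sum>i<N. (mean {i..<N} X)\<^sup>2) + (\<Sum>i<N. (mean {i..<N} Y)\<^sup>2))"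
    by (simp only: sum_distrib_left[symmetric] sum.distrib)
  also have "\<dots> \<le> 4 * (2 * (real N * E) + 8 * (real N * E) + 4 * (2 * (real N * E)) + 4 * (8 * (real N * E)))"
    using X Y
    by (intro mult_left_mono add_mono order_trans[OF hardy]) auto
  finally show ?thesis by (simp add: E_def)
qed

theorem perm_variance_stein_kernel_bound:
  assumes lip: "swap_lipschitz N K g" and dec: "swaps_decouple N c g"
    and sym: "\<And>p i k. p \<in> perms N 0 \<Longrightarrow> i < N \<Longrightarrow> k < N \<Longrightarrow> near p i k \<Longrightarrow> near p k i"
    and row: "\<And>p i. p \<in> perms N 0 \<Longrightarrow> i < N \<Longrightarrow> card {k. k < N \<and> near p i k} \<le> b"
    and cover: "\<And>p i k. p \<in> perms N 0 \<Longrightarrow> i < N \<Longrightarrow> k < N \<Longrightarrow> c p i k \<Longrightarrow> near p i k \<or> far p i k"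
  shows "perm_variance N (stein_kernel N g)
    \<le> 8000 * K ^ 4 * real N * ((real b)\<^sup>2 + expect N (\<lambda>p. \<Sum>i<N. \<Sum>k<N. of_bool (far p i k)))"
proof -
  have "expect N (\<lambda>p. \<Sum>i<N. (\<Sum>j<N. interaction N (c p) i j)\<^sup>2)
     \<le> expect N (\<lambda>p. 200 * real N * ((real b)\<^sup>2 + (\<Sum>i<N. \<Sum>k<N. of_bool (far p i k))))"
  proof (intro mean_mono)
    fix p assume p: "p \<in> perms N 0"
    show "(\<Sum>i<N. (\<Sum>j<N. interaction N (c p) i j)\<^sup>2) \<le> 200 * real N * ((real b)\<^sup>2 + (\<Sum>i<N. \<Sum>k<N. of_bool (far p i k)))"
      by (rule sum_interaction_square_le[of N "near p"]) (use sym[OF p] row[OF p] cover[OF p] in blast)+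
  qed
  also have "\<dots> = 200 * real N * ((real b)\<^sup>2 + expect N (\<lambda>p. \<Sum>i<N. \<Sum>k<N. of_bool (far p i k)))"
    by (simp only: mean_cmult mean_add mean_const finite_perms perms_nonempty not_False_eq_True)
  finally have "40 * K ^ 4 * expect N (\<lambda>p. \<Sum>i<N. (\<Sum>j<N. interaction N (c p) i j)\<^sup>2)
     \<le> 40 * K ^ 4 * (200 * real N * ((real b)\<^sup>2 + expect N (\<lambda>p. \<Sum>i<N. \<Sum>k<N. of_bool (far p i k))))"
    by (intro mult_left_mono) auto
  then show ?thesis
    using perm_variance_stein_kernel_le[OF lip dec] by (simp add: mult_ac)
qed

section \<open>Chains in a uniform pairing\<close>

text \<open>The fixed pairing of positions, \<open>2 u\<close> with \<open>2 u + 1\<close>. A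
  permutation \<open>p\<close> sends positions to half-edges and \<open>v\<close> sends half-edges
  to vertices; the paths below run through positions.\<close>

definition partner :: "nat \<Rightarrow> nat" where
  "partner i = (if even i then Suc i else i - 1)"

lemma partner_partner [simp]: "partner (partner i) = i"
  by (auto simp: partner_def elim: oddE)

lemma partner_neq [simp]: "partner i \<noteq> i" "i \<noteq> partner i"
  by (auto simp: partner_def elim: oddE)

lemma partner_less: "even N \<Longrightarrow> i < N \<Longrightarrow> partner i < N"
  by (auto simp: partner_def elim!: oddE evenE)

lemma partner_eq_iff: "partner i = j \<longleftrightarrow> i = partner j"
  by (metis partner_partner)

definition sibling_pairs :: "nat \<Rightarrow> (nat \<Rightarrow> nat) \<Rightarrow> (nat \<times> nat) set" where
  "sibling_pairs N v = {(h, h'). h < N \<and> h' < N \<and> h \<noteq> h' \<and> v h = v h'}"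

text \<open>Reflexive on the positions below \<open>N\<close>, so that from such a position the
  reachable sets of \<open>adjacency N v p ^^ r\<close> are balls increasing with
  \<open>r\<close>.\<close>

definition adjacency :: "nat \<Rightarrow> (nat \<Rightarrow> nat) \<Rightarrow> (nat \<Rightarrow> nat) \<Rightarrow> nat rel" where
  "adjacency N v p = {(i, k). i < N \<and> k < N \<and> (k = partner i \<or> v (p i) = v (p k))}"

definition connected_in :: "nat \<Rightarrow> (nat \<Rightarrow> nat) \<Rightarrow> (nat \<Rightarrow> nat) \<Rightarrow> nat \<Rightarrow> nat \<Rightarrow> bool" where
  "connected_in N v p i k \<longleftrightarrow> (i, k) \<in> (adjacency N v p)\<^sup>*"

text \<open>The part of a path that does not involve \<open>p\<close>: \<open>m\<close> blocks of
  two positions, consecutive blocks being joined by a \<open>partner\<close> step. That the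
  positions of a block share a vertex is the event added in \<open>linked_chains\<close>.\<close>

definition chain_shapes :: "nat \<Rightarrow> nat \<Rightarrow> (nat \<Rightarrow> nat) set" where
  "chain_shapes N m = {w \<in> {0..<2 * m} \<rightarrow>\<^sub>E {0..<N}. inj_on w {0..<2 * m} \<and>
     (\<forall>u. Suc u < m \<longrightarrow> w (2 * u + 2) = partner (w (2 * u + 1)))}"

definition linked_chains :: "nat \<Rightarrow> (nat \<Rightarrow> nat) \<Rightarrow> (nat \<Rightarrow> nat) \<Rightarrow> nat \<Rightarrow> (nat \<Rightarrow> nat) set" where
  "linked_chains N v p m = {w \<in> chain_shapes N m. \<forall>u<m. v (p (w (2 * u))) = v (p (w (2 * u + 1)))}"

lemma finite_sibling_pairs: "finite (sibling_pairs N v)"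
  by (rule finite_subset[of _ "{0..<N} \<times> {0..<N}"]) (auto simp: sibling_pairs_def)

lemma finite_chain_shapes: "finite (chain_shapes N m)"
  by (rule finite_subset[of _ "{0..<2 * m} \<rightarrow>\<^sub>E {0..<N}"]) (auto simp: chain_shapes_def intro: finite_PiE)

lemma finite_chains: "finite (linked_chains N v p m)"
  by (rule finite_subset[OF _ finite_chain_shapes]) (auto simp: linked_chains_def)

text \<open>Prescribing a permutation on \<open>A\<close> leaves a coset of the permutations of the complement.\<close>

lemma card_prescribed_perms_le:
  assumes A: "A \<subseteq> {0..<N}"
  shows "card {p \<in> perms N 0. \<forall>a\<in>A. p a = g a} \<le> fact (N - card A)"
proof (cases "{p \<in> perms N 0. \<forall>a\<in>A. p a = g a} = {}")
  case False
  then obtain s where s: "s \<in> perms N 0" "\<forall>a\<in>A. s a = g a" by auto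
  have "card {p \<in> perms N 0. \<forall>a\<in>A. p a = g a} \<le> card {q. q permutes ({0..<N} - A)}"
  proof (rule card_inj_on_le[of "\<lambda>p. inv s \<circ> p"])
    show "inj_on (\<lambda>p. inv s \<circ> p) {p \<in> perms N 0. \<forall>a\<in>A. p a = g a}"
      using bij_betw_imp_inj_on[OF bij_comp_left[OF perms_inv[OF s(1)]]]
      by (rule inj_on_subset) auto
    show "(\<lambda>p. inv s \<circ> p) ` {p \<in> perms N 0. \<forall>a\<in>A. p a = g a} \<subseteq> {q. q permutes ({0..<N} - A)}"
    proof clarify
      fix p assume p: "p \<in> perms N 0" "\<forall>a\<in>A. p a = g a"
      have "inv s \<circ> p \<in> perms N 0" using p s by (intro perms_comp perms_inv)
      then have "inv s \<circ> p permutes {0..<N}" by (simp add: perms_def)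
      moreover have "(inv s \<circ> p) a = a" if "a \<in> A" for a
        using p s that perms_inj[OF s(1)] by (metis comp_apply inv_f_f)
      ultimately show "inv s \<circ> p permutes ({0..<N} - A)"
        by (auto intro: permutes_superset)
    qed
  qed (auto intro: finite_permutations)
  also have "\<dots> = fact (N - card A)"
    using A by (subst card_permutations[of _ "N - card A"]) (auto simp: card_Diff_subset finite_subset)
  finally show ?thesis .
next
  case True
  then show ?thesis by (simp only: card.empty)
qed

text \<open>Choosing the sibling pair onto which \<open>p\<close> maps each of the \<open>m\<close>
  blocks prescribes \<open>p\<close> on all \<open>2 * m\<close> distinct positions of the
  chain.\<close>

lemma card_perms_with_siblings_le:
  assumes w: "w \<in> chain_shapes N m"
  shows "card {p \<in> perms N 0. w \<in> linked_chains N v p m} \<le> card (sibling_pairs N v) ^ m * fact (N - 2 * m)"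
proof -
  have inj: "inj_on w {0..<2 * m}" and ran: "\<And>t. t < 2 * m \<Longrightarrow> w t < N"
    using w by (auto simp: chain_shapes_def)
  let ?H = "{0..<m} \<rightarrow>\<^sub>E sibling_pairs N v"
  \<comment> \<open>The prescribed value at a position \<open>x\<close> of the chain:
    \<open>t\<close> is its index, \<open>t div 2\<close> its block, and the parity of
    \<open>t\<close> selects the component.\<close>
  let ?g = "\<lambda>hs x. let t = the_inv_into {0..<2 * m} w x in
      if even t then fst (hs (t div 2)) else snd (hs (t div 2) :: nat \<times> nat)"
  let ?A = "w ` {0..<2 * m}"
  have inv: "the_inv_into {0..<2 * m} w (w t) = t" if "t < 2 * m" for t
    using inj that by (intro the_inv_into_f_f) auto
  have "{p \<in> perms N 0. w \<in> linked_chains N v p m} \<subseteq> (\<Union>hs\<in>?H. {p \<in> perms N 0. \<forall>a\<in>?A. p a = ?g hs a})"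
  proof clarify
    fix p assume p: "p \<in> perms N 0" and wp: "w \<in> linked_chains N v p m"
    let ?hs = "\<lambda>u\<in>{0..<m}. (p (w (2 * u)), p (w (2 * u + 1)))"
    have "?hs \<in> ?H"
    proof (rule restrict_PiE_iff[THEN iffD2], rule ballI)
      fix u assume u: "u \<in> {0..<m}"
      have "w (2 * u) \<noteq> w (2 * u + 1)"
        using inj_onD[OF inj, of "2 * u" "2 * u + 1"] u by auto
      then have "p (w (2 * u)) \<noteq> p (w (2 * u + 1))"
        using perms_inj[OF p] by (simp add: inj_eq)
      moreover have "p (w (2 * u)) < N" "p (w (2 * u + 1)) < N"
        using u by (intro perms_less[OF p] ran; simp)+
      moreover have "v (p (w (2 * u))) = v (p (w (2 * u + 1)))"
        using wp u by (simp add: linked_chains_def)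
      ultimately show "(p (w (2 * u)), p (w (2 * u + 1))) \<in> sibling_pairs N v"
        by (simp add: sibling_pairs_def)
    qed
    moreover have "p a = ?g ?hs a" if a: "a \<in> ?A" for a
    proof -
      obtain t where t: "t < 2 * m" "a = w t" using a by auto
      have "t div 2 < m" using t by auto
      moreover have "even t \<Longrightarrow> 2 * (t div 2) = t" "odd t \<Longrightarrow> Suc (2 * (t div 2)) = t" by auto
      ultimately show ?thesis
        using t by (simp add: inv Let_def)
    qed
    ultimately show "p \<in> (\<Union>hs\<in>?H. {p \<in> perms N 0. \<forall>a\<in>?A. p a = ?g hs a})"
      using p by blast
  qed
  then have "card {p \<in> perms N 0. w \<in> linked_chains N v p m} \<le> card (\<Union>hs\<in>?H. {p \<in> perms N 0. \<forall>a\<in>?A. p a = ?g hs a})"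
    by (intro card_mono finite_UN_I finite_PiE) (auto simp: finite_sibling_pairs)
  also have "\<dots> \<le> (\<Sum>hs\<in>?H. card {p \<in> perms N 0. \<forall>a\<in>?A. p a = ?g hs a})"
    by (intro card_UN_le finite_PiE) (auto simp: finite_sibling_pairs)
  also have "\<dots> \<le> (\<Sum>hs\<in>?H. fact (N - 2 * m))"
  proof (intro sum_mono)
    fix hs
    have c: "card ?A = 2 * m" using inj by (simp add: card_image)
    have "?A \<subseteq> {0..<N}" using ran by auto
    from card_prescribed_perms_le[OF this, of "?g hs"]
    show "card {p \<in> perms N 0. \<forall>a\<in>?A. p a = ?g hs a} \<le> fact (N - 2 * m)"
      unfolding c .
  qed
  also have "\<dots> = card (sibling_pairs N v) ^ m * fact (N - 2 * m)"
    by (simp add: card_PiE)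
  finally show ?thesis .
qed

text \<open>An entry of positive even index is the partner of its predecessor, so \<open>w 0\<close>
  and the \<open>m\<close> entries of odd index determine the shape.\<close>

lemma card_chain_shapes_le:
  assumes "0 < m"
  shows "card (chain_shapes N m) \<le> N ^ Suc m"
proof -
  let ?f = "\<lambda>w. \<lambda>u\<in>{0..m}. if u = 0 then w 0 else w (2 * u - 1) :: nat"
  have "card (chain_shapes N m) \<le> card ({0..m} \<rightarrow>\<^sub>E {0..<N})"
  proof (rule card_inj_on_le[of ?f])
    show "inj_on ?f (chain_shapes N m)"
    proof (rule inj_onI)
      fix w w' assume w: "w \<in> chain_shapes N m" "w' \<in> chain_shapes N m" and eq: "?f w = ?f w'"
      have 0: "w 0 = w' 0" using fun_cong[OF eq, of 0] by simp
      have odd: "w (2 * u + 1) = w' (2 * u + 1)" if "u < m" for u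
        using fun_cong[OF eq, of "Suc u"] that by (simp split: if_splits)
      have even: "w (2 * u + 2) = w' (2 * u + 2)" if "Suc u < m" for u
        using w odd[of u] that by (auto simp: chain_shapes_def)
      show "w = w'"
      proof (rule PiE_ext)
        show "w \<in> {0..<2 * m} \<rightarrow>\<^sub>E {0..<N}" "w' \<in> {0..<2 * m} \<rightarrow>\<^sub>E {0..<N}"
          using w by (auto simp: chain_shapes_def)
        fix t assume t: "t \<in> {0..<2 * m}"
        consider "t = 0" | u where "t = 2 * u + 1" | u where "t = 2 * u + 2"
          by (cases "even t") (auto elim!: evenE oddE, metis Suc_pred mult_Suc_right neq0_conv add_2_eq_Suc' add.commute)
        then show "w t = w' t"
          using 0 odd even t by cases auto
      qed
    qed
    show "?f ` chain_shapes N m \<subseteq> {0..m} \<rightarrow>\<^sub>E {0..<N}"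
    proof (clarify, rule restrict_PiE_iff[THEN iffD2], rule ballI)
      fix w u assume w: "w \<in> chain_shapes N m" and u: "u \<in> {0..m}"
      have "w t \<in> {0..<N}" if "t < 2 * m" for t
        using w that by (auto simp: chain_shapes_def)
      moreover have "2 * u - 1 < 2 * m" "0 < 2 * m" using u assms by auto
      ultimately show "(if u = 0 then w 0 else w (2 * u - 1)) \<in> {0..<N}" by simp
    qed
  qed (auto intro: finite_PiE)
  also have "\<dots> = N ^ Suc m" by (simp add: card_PiE)
  finally show ?thesis .
qed

lemma expect_card_chains_le:
  assumes "0 < m"
  shows "expect N (\<lambda>p. real (card (linked_chains N v p m)))
    \<le> real N ^ Suc m * real (card (sibling_pairs N v)) ^ m * fact (N - 2 * m) / fact N"
proof -
  have "(\<Sum>p\<in>perms N 0. card (linked_chains N v p m)) = (\<Sum>p\<in>perms N 0. \<Sum>w\<in>chain_shapes N m. of_bool (w \<in> linked_chains N v p m))"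
    by (intro sum.cong refl)
       (auto simp: finite_chain_shapes Int_def linked_chains_def intro!: arg_cong[of _ _ card])
  also have "\<dots> = (\<Sum>w\<in>chain_shapes N m. card {p \<in> perms N 0. w \<in> linked_chains N v p m})"
    by (subst sum.swap) (auto simp: Int_def intro!: sum.cong arg_cong[of _ _ card])
  also have "\<dots> \<le> (\<Sum>w\<in>chain_shapes N m. card (sibling_pairs N v) ^ m * fact (N - 2 * m))"
    by (intro sum_mono card_perms_with_siblings_le)
  also have "\<dots> \<le> N ^ Suc m * (card (sibling_pairs N v) ^ m * fact (N - 2 * m))"
    unfolding sum_constant of_nat_id by (intro mult_right_mono card_chain_shapes_le assms) auto
  finally have "real (\<Sum>p\<in>perms N 0. card (linked_chains N v p m)) \<le> real (N ^ Suc m * (card (sibling_pairs N v) ^ m * fact (N - 2 * m)))"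
    by (simp only: of_nat_le_iff)
  then show ?thesis
    unfolding mean_def card_perms by (simp add: divide_right_mono mult_ac)
qed

lemma fact_ge_power: "k \<le> n \<Longrightarrow> (n - k) ^ k * fact (n - k) \<le> (fact n :: nat)"
proof (induction k)
  case (Suc k)
  have "(n - Suc k) ^ Suc k * fact (n - Suc k) \<le> (n - k) ^ k * ((n - k) * fact (n - Suc k))"
    using Suc.prems power_mono[of "n - Suc k" "n - k" k] by (simp add: mult_mono mult_ac)
  also have "\<dots> = (n - k) ^ k * fact (n - k)"
    using Suc.prems fact_reduce[of "n - k", where 'a = nat] by simp
  finally show ?case using Suc by simp
qed simp

text \<open>With \<open>S\<close> sibling pairs, a block costs the factor
  \<open>N S / (N - 2 m)^2\<close>: one free position, one sibling pair, two prescribed values. For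
  \<open>m\<close> small against \<open>N\<close> this is close to \<open>S / N\<close>, the mean
  offspring number when exploring the graph. The remaining \<open>N\<close> is the choice of the
  start.\<close>

lemma expect_card_chains_le_power:
  assumes m: "0 < m" "2 * m < N" and x: "real N * real (card (sibling_pairs N v)) \<le> x * (real (N - 2 * m))\<^sup>2"
  shows "expect N (\<lambda>p. real (card (linked_chains N v p m))) \<le> real N * x ^ m"
proof -
  let ?S = "real (card (sibling_pairs N v))"
  have "real N ^ Suc m * ?S ^ m * fact (N - 2 * m) = real N * (real N * ?S) ^ m * fact (N - 2 * m)"
    by (simp add: power_mult_distrib)
  also have "\<dots> \<le> real N * (x * (real (N - 2 * m))\<^sup>2) ^ m * fact (N - 2 * m)"
    using x by (intro mult_right_mono mult_left_mono power_mono) auto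
  also have "\<dots> = real N * x ^ m * (real (N - 2 * m) ^ (2 * m) * fact (N - 2 * m))"
    by (simp add: power_mult_distrib power_mult)
  also have "\<dots> \<le> real N * x ^ m * fact N"
  proof (intro mult_left_mono)
    have "real ((N - 2 * m) ^ (2 * m) * fact (N - 2 * m)) \<le> real (fact N)"
      using fact_ge_power[of "2 * m" N] m by (simp only: of_nat_le_iff)
    then show "real (N - 2 * m) ^ (2 * m) * fact (N - 2 * m) \<le> fact N" by simp
    have "0 < (real (N - 2 * m))\<^sup>2" using m by simp
    moreover have "0 \<le> x * (real (N - 2 * m))\<^sup>2" using x by (rule order_trans[rotated]) simp
    ultimately have "0 \<le> x" by (simp add: zero_le_mult_iff)
    then show "0 \<le> real N * x ^ m" by simp
  qed
  finally have "real N ^ Suc m * ?S ^ m * fact (N - 2 * m) / fact N \<le> real N * x ^ m"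
    by (simp add: pos_divide_le_eq)
  with expect_card_chains_le[OF m(1)] show ?thesis by (rule order_trans)
qed

section \<open>Paths, chains and the expected number of far pairs\<close>

lemma adjacency_refl: "i < N \<Longrightarrow> (i, i) \<in> adjacency N v p"
  by (simp add: adjacency_def)

lemma adjacency_sym: "sym (adjacency N v p)"
  by (rule symI) (auto simp: adjacency_def)

lemma sym_relpow: "sym r \<Longrightarrow> (i, k) \<in> r ^^ n \<Longrightarrow> (k, i) \<in> r ^^ n"
proof (induction n arbitrary: k)
  case (Suc n)
  then obtain j where "(i, j) \<in> r ^^ n" "(j, k) \<in> r" by auto
  with Suc show ?case by (meson relpow_Suc_I2 symD)
qed simp

lemma adjacency_relpow_mono:
  assumes "i < N" "(i, k) \<in> adjacency N v p ^^ n" "n \<le> r"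
  shows "(i, k) \<in> adjacency N v p ^^ r"
  using assms(3)
proof (induction r rule: dec_induct)
  case (step r)
  then show ?case using relpow_Suc_I2[OF adjacency_refl[OF assms(1)]] by blast
qed (use assms in auto)

text \<open>
  A shortest path alternates between matched pairs and siblings: two consecutive steps of the same
  kind could be shortened. Dropping a matched pair at either end leaves a chain.
\<close>

lemma chain_of_far_pair:
  assumes conn: "(i, k) \<in> (adjacency N v p)\<^sup>*" and i: "i < N"
    and far: "(i, k) \<notin> adjacency N v p ^^ (2 * q)" and q: "1 \<le> q"
  shows "\<exists>m\<ge>q. \<exists>w\<in>linked_chains N v p m. i \<in> {w 0, partner (w 0)} \<and> k \<in> {w (2 * m - 1), partner (w (2 * m - 1))}"
proof -
  let ?R = "adjacency N v p"
  define n where "n = (LEAST n. (i, k) \<in> ?R ^^ n)"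
  have n: "(i, k) \<in> ?R ^^ n" and min: "\<And>n'. (i, k) \<in> ?R ^^ n' \<Longrightarrow> n \<le> n'"
    unfolding n_def using conn by (auto simp: rtrancl_is_UN_relpow intro: LeastI Least_le)
  have n_gt: "2 * q < n"
    using adjacency_relpow_mono[OF i n] far by (meson not_le)
  obtain f where f: "f 0 = i" "f n = k" "\<And>t. t < n \<Longrightarrow> (f t, f (Suc t)) \<in> ?R"
    using n by (auto simp: relpow_fun_conv)
  have sub: "(f a, f b) \<in> ?R ^^ (b - a)" if "a \<le> b" "b \<le> n" for a b
    unfolding relpow_fun_conv
    by (rule exI[of _ "\<lambda>t. f (a + t)"]) (use that f in auto)
  have short: "b - a \<le> l" if ab: "a \<le> b" "b \<le> n" and l: "(f a, f b) \<in> ?R ^^ l" for a b l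
  proof -
    have "(i, k) \<in> ?R ^^ a O ?R ^^ l O ?R ^^ (n - b)"
      using sub[of 0 a] sub[of b n] l f ab by auto
    then have "(i, k) \<in> ?R ^^ (a + (l + (n - b)))"
      by (simp add: relpow_add)
    from min[OF this] ab show ?thesis by linarith
  qed
  have inj: "f a \<noteq> f b" if "a < b" "b \<le> n" for a b
    using short[of a b 0] that by auto
  have no_shortcut: "(f a, f (Suc (Suc a))) \<notin> ?R" if "Suc a < n" for a
    using short[of a "Suc (Suc a)" 1] that by auto
  have f_less: "f t < N" if "t \<le> n" for t
    using f(3)[of t] f(3)[of "t - 1"] that n_gt by (cases t) (auto simp: adjacency_def)
  define s where "s t \<longleftrightarrow> f (Suc t) = partner (f t)" for t
  have sib: "v (p (f t)) = v (p (f (Suc t)))" if "t < n" "\<not> s t" for t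
    using f(3)[OF that(1)] that(2) by (auto simp: adjacency_def s_def)
  have alt: "s (Suc t) \<longleftrightarrow> \<not> s t" if t: "Suc t < n" for t
  proof
    assume "s (Suc t)"
    then show "\<not> s t" using inj[of t "Suc (Suc t)"] t by (auto simp: s_def)
  next
    assume "\<not> s t"
    show "s (Suc t)"
    proof (rule ccontr)
      assume "\<not> s (Suc t)"
      then have "v (p (f t)) = v (p (f (Suc (Suc t))))"
        using sib[of t] sib[of "Suc t"] \<open>\<not> s t\<close> t by simp
      then have "(f t, f (Suc (Suc t))) \<in> ?R"
        using f_less t by (auto simp: adjacency_def)
      with no_shortcut t show False by blast
    qed
  qed
  \<comment> \<open>An initial matched step is skipped (\<open>e = 1\<close>), so that the chain
    begins with a sibling step.\<close>
  define e where "e = (if s 0 then 1 else 0 :: nat)"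
  have par: "s t \<longleftrightarrow> odd (t + e)" if "t < n" for t
    using that by (induction t) (auto simp: alt e_def)
  have e: "e \<le> 1" by (simp add: e_def)
  \<comment> \<open>The number of sibling steps: they occur exactly at the times
    \<open>e + 2 * u < n\<close>.\<close>
  define m where "m = (n - e + 1) div 2"
  have m_q: "q \<le> m" using n_gt e by (auto simp: m_def)
  have m0: "0 < m" using m_q q by simp
  have m_n: "e + t \<le> n" if "t < 2 * m" for t
    using that n_gt e by (auto simp: m_def)
  define w where "w = (\<lambda>t\<in>{0..<2 * m}. f (e + t))"
  have w: "w t = f (e + t)" if "t < 2 * m" for t using that by (simp add: w_def)
  have "w \<in> linked_chains N v p m"
  proof -
    have "w \<in> {0..<2 * m} \<rightarrow>\<^sub>E {0..<N}"
      unfolding w_def using m_n f_less by auto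
    moreover have "inj_on w {0..<2 * m}"
    proof (rule linorder_inj_onI)
      fix a b assume "a < b" "a \<in> {0..<2 * m}" "b \<in> {0..<2 * m}"
      then show "w a \<noteq> w b" using inj[of "e + a" "e + b"] m_n[of b] by (simp add: w)
    qed auto
    moreover have "w (2 * u + 2) = partner (w (2 * u + 1))" if "Suc u < m" for u
    proof -
      have "e + (2 * u + 1) < n" using m_n[of "2 * u + 2"] that by simp
      then show ?thesis using par[of "e + (2 * u + 1)"] that by (simp add: s_def w)
    qed
    moreover have "v (p (w (2 * u))) = v (p (w (2 * u + 1)))" if "u < m" for u
    proof -
      have "e + 2 * u < n" using m_n[of "2 * u + 1"] that by simp
      then show ?thesis using par[of "e + 2 * u"] sib[of "e + 2 * u"] that by (simp add: w)
    qed
    ultimately show ?thesis by (simp add: linked_chains_def chain_shapes_def)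
  qed
  moreover have "i \<in> {w 0, partner (w 0)}"
    using m0 f(1) by (auto simp: w e_def s_def)
  moreover have "k \<in> {w (2 * m - 1), partner (w (2 * m - 1))}"
  proof (cases "e + (2 * m - 1) = n")
    case True
    then show ?thesis using m0 f(2) by (simp add: w)
  next
    \<comment> \<open>The path ends with a matched step beyond the chain, so its end point is the
      partner of the last entry.\<close>
    case False
    then have n': "Suc (e + (2 * m - 1)) = n"
      using m0 n_gt e by (auto simp: m_def)
    have "odd (e + (2 * m - 1) + e)" using m0 by (cases m) auto
    then have "s (e + (2 * m - 1))"
      using par[of "e + (2 * m - 1)"] n' by simp
    then have "k = partner (w (2 * m - 1))"
      using n' f(2) m0 by (simp add: s_def w)
    then show ?thesis by simp
  qed
  ultimately show ?thesis using m_q by blast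
qed

lemma chains_prefix:
  assumes w: "w \<in> linked_chains N v p m" and "m' \<le> m"
  shows "restrict w {0..<2 * m'} \<in> linked_chains N v p m'"
proof -
  have "w t < N" if "t < 2 * m" for t
    using w that by (auto simp: linked_chains_def chain_shapes_def)
  moreover have "inj_on w {0..<2 * m'}"
    using w assms(2) by (auto simp: linked_chains_def chain_shapes_def intro: inj_on_subset)
  ultimately show ?thesis
    using w assms(2) by (auto simp: linked_chains_def chain_shapes_def)
qed

definition far :: "nat \<Rightarrow> (nat \<Rightarrow> nat) \<Rightarrow> nat \<Rightarrow> (nat \<Rightarrow> nat) \<Rightarrow> nat \<Rightarrow> nat \<Rightarrow> bool" where
  "far N v r p i k \<longleftrightarrow> connected_in N v p i k \<and> (i, k) \<notin> adjacency N v p ^^ r"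

text \<open>If no chain has \<open>L\<close> blocks then, by truncation, none is longer, so every
  far pair comes from a chain with \<open>q\<close> to \<open>L\<close> blocks, and each chain
  serves at most \<open>2 * 2\<close> pairs. Otherwise all \<open>N^2\<close> pairs are conceded;
  this is affordable because for \<open>L\<close> proportional to \<open>N\<close> such a chain will
  be exponentially unlikely.\<close>

lemma sum_far_le:
  assumes "1 \<le> q" "q \<le> L"
  shows "(\<Sum>i<N. \<Sum>k<N. of_bool (far N v (2 * q) p i k) :: real)
    \<le> 4 * (\<Sum>m=q..L. real (card (linked_chains N v p m))) + (real N)\<^sup>2 * real (card (linked_chains N v p L))"
proof (cases "linked_chains N v p L = {}")
  case True
  let ?E = "\<lambda>w m. {w 0, partner (w 0)} \<times> {w (2 * m - 1), partner (w (2 * m - 1))}"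
  have "{(i, k). i < N \<and> k < N \<and> far N v (2 * q) p i k} \<subseteq> (\<Union>m\<in>{q..L}. \<Union>w\<in>linked_chains N v p m. ?E w m)"
  proof clarify
    fix i k assume "i < N" "far N v (2 * q) p i k"
    then obtain m w where m: "m \<ge> q" "w \<in> linked_chains N v p m" "(i, k) \<in> ?E w m"
      using chain_of_far_pair[of i k N v p q] assms(1) unfolding far_def connected_in_def by blast
    have "m \<le> L"
      using chains_prefix[OF m(2), of L] True by (metis empty_iff nat_le_linear)
    with m show "(i, k) \<in> (\<Union>m\<in>{q..L}. \<Union>w\<in>linked_chains N v p m. ?E w m)" by auto
  qed
  then have "card {(i, k). i < N \<and> k < N \<and> far N v (2 * q) p i k} \<le> card (\<Union>m\<in>{q..L}. \<Union>w\<in>linked_chains N v p m. ?E w m)"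
    by (intro card_mono finite_UN_I finite_chains) auto
  also have "\<dots> \<le> (\<Sum>m=q..L. \<Sum>w\<in>linked_chains N v p m. 4)"
  proof (intro order_trans[OF card_UN_le] sum_mono order_trans[OF card_UN_le[OF finite_chains]])
    fix m and w :: "nat \<Rightarrow> nat"
    show "card (?E w m) \<le> 4"
      by (auto simp: card_insert_if)
  qed (auto intro: finite_chains)
  finally have "card {(i, k). i < N \<and> k < N \<and> far N v (2 * q) p i k} \<le> (\<Sum>m=q..L. card (linked_chains N v p m) * 4)"
    by simp
  moreover have "(\<Sum>i<N. \<Sum>k<N. of_bool (far N v (2 * q) p i k) :: real)
      = card {(i, k). i < N \<and> k < N \<and> far N v (2 * q) p i k}"
  proof -
    have "(\<Sum>i<N. \<Sum>k<N. of_bool (far N v (2 * q) p i k) :: real)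
        = (\<Sum>x\<in>{..<N} \<times> {..<N}. of_bool (far N v (2 * q) p (fst x) (snd x)))"
      by (simp only: sum.cartesian_product split_def)
    also have "\<dots> = card ({..<N} \<times> {..<N} \<inter> {x. far N v (2 * q) p (fst x) (snd x)})"
      by simp
    also have "{..<N} \<times> {..<N} \<inter> {x. far N v (2 * q) p (fst x) (snd x)} = {(i, k). i < N \<and> k < N \<and> far N v (2 * q) p i k}"
      by auto
    finally show ?thesis .
  qed
  ultimately have "(\<Sum>i<N. \<Sum>k<N. of_bool (far N v (2 * q) p i k) :: real) \<le> real (\<Sum>m=q..L. card (linked_chains N v p m) * 4)"
    by (simp only: of_nat_le_iff)
  then show ?thesis
    using True by (simp add: sum_distrib_left mult.commute)
next
  case False
  then have "1 \<le> card (linked_chains N v p L)"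
    using finite_chains by (simp add: Suc_leI card_gt_0_iff)
  then have "1 \<le> real (card (linked_chains N v p L))" by simp
  have "(\<Sum>i<N. \<Sum>k<N. of_bool (far N v (2 * q) p i k) :: real) \<le> (\<Sum>i<N. \<Sum>k<N. 1)"
    by (intro sum_mono) auto
  also have "\<dots> = (real N)\<^sup>2 * 1" by (simp add: power2_eq_square)
  also have "\<dots> \<le> (real N)\<^sup>2 * real (card (linked_chains N v p L))"
    by (intro mult_left_mono \<open>1 \<le> real (card (linked_chains N v p L))\<close>) simp
  also have "\<dots> \<le> 4 * (\<Sum>m=q..L. real (card (linked_chains N v p m))) + (real N)\<^sup>2 * real (card (linked_chains N v p L))"
    by (simp add: sum_nonneg)
  finally show ?thesis .
qed

lemma expect_far_le:
  assumes q: "1 \<le> q" "q \<le> L" and L: "2 * L < N" and x: "0 \<le> x" "x < 1"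
    and S: "real N * real (card (sibling_pairs N v)) \<le> x * (real (N - 2 * L))\<^sup>2"
  shows "expect N (\<lambda>p. \<Sum>i<N. \<Sum>k<N. of_bool (far N v (2 * q) p i k))
    \<le> 4 * real N * x ^ q / (1 - x) + real N ^ 3 * x ^ L"
proof -
  have linked_chains: "expect N (\<lambda>p. real (card (linked_chains N v p m))) \<le> real N * x ^ m" if m: "m \<in> {q..L}" for m
  proof (rule expect_card_chains_le_power)
    have "x * (real (N - 2 * L))\<^sup>2 \<le> x * (real (N - 2 * m))\<^sup>2"
      using m x by (intro mult_left_mono power_mono) auto
    with S show "real N * real (card (sibling_pairs N v)) \<le> x * (real (N - 2 * m))\<^sup>2" by linarith
  qed (use m q L in auto)
  have "expect N (\<lambda>p. \<Sum>i<N. \<Sum>k<N. of_bool (far N v (2 * q) p i k))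
     \<le> expect N (\<lambda>p. 4 * (\<Sum>m=q..L. real (card (linked_chains N v p m))) + (real N)\<^sup>2 * real (card (linked_chains N v p L)))"
    by (intro mean_mono sum_far_le q)
  also have "\<dots> = 4 * (\<Sum>m=q..L. expect N (\<lambda>p. real (card (linked_chains N v p m)))) + (real N)\<^sup>2 * expect N (\<lambda>p. real (card (linked_chains N v p L)))"
    by (simp only: mean_add mean_cmult mean_sum)
  also have "\<dots> \<le> 4 * (\<Sum>m=q..L. real N * x ^ m) + (real N)\<^sup>2 * (real N * x ^ L)"
    by (intro add_mono mult_left_mono sum_mono linked_chains) (use q in auto)
  also have "\<dots> \<le> 4 * (real N * (x ^ q / (1 - x))) + (real N)\<^sup>2 * (real N * x ^ L)"
  proof -
    have "(\<Sum>m=q..L. x ^ m) = (x ^ q - x ^ Suc L) / (1 - x)"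
      using x q by (subst sum_gp) auto
    also have "\<dots> \<le> x ^ q / (1 - x)"
      using x by (intro divide_right_mono) auto
    finally have "(\<Sum>m=q..L. real N * x ^ m) \<le> real N * (x ^ q / (1 - x))"
      unfolding sum_distrib_left[symmetric] by (rule mult_left_mono) simp
    then show ?thesis by (intro add_right_mono mult_left_mono) auto
  qed
  finally show ?thesis by (simp add: power3_eq_cube power2_eq_square)
qed

text \<open>One step leads to the partner or to one of at most \<open>\<Delta>\<close> positions at
  the same vertex, whatever \<open>p\<close> is.\<close>

lemma card_ball_le:
  assumes p: "p \<in> perms N 0" and \<Delta>: "\<And>x. card {h. h < N \<and> v h = x} \<le> \<Delta>"
  shows "card {k. k < N \<and> (i, k) \<in> adjacency N v p ^^ r} \<le> (\<Delta> + 1) ^ r"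
proof (induction r)
  case 0
  have "{k. k < N \<and> (i, k) \<in> adjacency N v p ^^ 0} \<subseteq> {i}" by auto
  from card_mono[OF _ this] show ?case by simp
next
  case (Suc r)
  let ?B = "{k. k < N \<and> (i, k) \<in> adjacency N v p ^^ r}"
  let ?C = "\<lambda>j. insert (partner j) {k. k < N \<and> v (p k) = v (p j)}"
  have C: "card (?C j) \<le> \<Delta> + 1" for j
  proof -
    have "card {k. k < N \<and> v (p k) = v (p j)} \<le> card {h. h < N \<and> v h = v (p j)}"
      by (rule card_inj_on_le[of p])
         (use p in \<open>auto intro: perms_less inj_on_subset[OF perms_inj]\<close>)
    then show ?thesis
      using \<Delta>[of "v (p j)"] by (simp add: card_insert_if)
  qed
  have "{k. k < N \<and> (i, k) \<in> adjacency N v p ^^ Suc r} \<subseteq> (\<Union>j\<in>?B. ?C j)"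
  proof clarify
    fix k assume "(i, k) \<in> adjacency N v p ^^ Suc r" "k < N"
    then obtain j where "(i, j) \<in> adjacency N v p ^^ r" "(j, k) \<in> adjacency N v p"
      by auto
    then show "k \<in> (\<Union>j\<in>?B. ?C j)" by (auto simp: adjacency_def)
  qed
  then have "card {k. k < N \<and> (i, k) \<in> adjacency N v p ^^ Suc r} \<le> card (\<Union>j\<in>?B. ?C j)"
    by (intro card_mono) auto
  also have "\<dots> \<le> (\<Sum>j\<in>?B. card (?C j))" by (rule card_UN_le) auto
  also have "\<dots> \<le> (\<Sum>j\<in>?B. \<Delta> + 1)" by (intro sum_mono C)
  also have "\<dots> \<le> (\<Delta> + 1) ^ r * (\<Delta> + 1)"
    unfolding sum_constant of_nat_id by (intro mult_right_mono Suc) auto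
  finally show ?case by (simp add: mult.commute)
qed

lemma perm_variance_stein_kernel_far_le:
  assumes lip: "swap_lipschitz N K g" and dec: "swaps_decouple N (connected_in N v) g"
    and \<Delta>: "\<And>x. card {h. h < N \<and> v h = x} \<le> \<Delta>"
    and q: "1 \<le> q" "q \<le> L" and L: "2 * L < N" and x: "0 \<le> x" "x < 1"
    and S: "real N * real (card (sibling_pairs N v)) \<le> x * (real (N - 2 * L))\<^sup>2"
  shows "perm_variance N (stein_kernel N g)
    \<le> 8000 * K ^ 4 * real N * ((real ((\<Delta> + 1) ^ (2 * q)))\<^sup>2 + (4 * real N * x ^ q / (1 - x) + real N ^ 3 * x ^ L))"
proof -
  let ?near = "\<lambda>p i k. (i, k) \<in> adjacency N v p ^^ (2 * q)"
  have "perm_variance N (stein_kernel N g)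
    \<le> 8000 * K ^ 4 * real N * ((real ((\<Delta> + 1) ^ (2 * q)))\<^sup>2 + expect N (\<lambda>p. \<Sum>i<N. \<Sum>k<N. of_bool (far N v (2 * q) p i k)))"
  proof (rule perm_variance_stein_kernel_bound[OF lip dec, where near = ?near])
    fix p i k assume "(i, k) \<in> adjacency N v p ^^ (2 * q)"
    then show "(k, i) \<in> adjacency N v p ^^ (2 * q)"
      by (rule sym_relpow[OF adjacency_sym])
  next
    fix p i assume "p \<in> perms N 0"
    then show "card {k. k < N \<and> ?near p i k} \<le> (\<Delta> + 1) ^ (2 * q)"
      by (rule card_ball_le[OF _ \<Delta>])
  next
    fix p i k assume "connected_in N v p i k"
    then show "?near p i k \<or> far N v (2 * q) p i k" by (auto simp: far_def)
  qed
  also have "\<dots> \<le> 8000 * K ^ 4 * real N * ((real ((\<Delta> + 1) ^ (2 * q)))\<^sup>2 + (4 * real N * x ^ q / (1 - x) + real N ^ 3 * x ^ L))"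
    by (intro mult_left_mono add_left_mono expect_far_le q L x S) auto
  finally show ?thesis .
qed

section \<open>Permutations and matchings\<close>

text \<open>Here \<open>\<eta>\<close> enumerates the half-edges. An edge arises from both of its
  positions, and the image merges the two copies. A general index set \<open>A\<close> allows a
  matching to be cut along components.\<close>

definition matching_on :: "(nat \<Rightarrow> 'h) \<Rightarrow> nat set \<Rightarrow> (nat \<Rightarrow> nat) \<Rightarrow> 'h uprod set" where
  "matching_on \<eta> A p = (\<lambda>i. Upair (\<eta> (p i)) (\<eta> (p (partner i)))) ` A"

lemma perms_inj_comp:
  assumes "inj_on \<eta> {0..<N}" "p \<in> perms N 0" "i < N" "k < N"
  shows "\<eta> (p i) = \<eta> (p k) \<longleftrightarrow> i = k"
  using assms perms_less[of p N] inj_on_eq_iff[of \<eta> "{0..<N}" "p i" "p k"] inj_eq[OF perms_inj[of p N], of i k]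
  by auto

lemma matching_edge_eq_iff:
  assumes \<eta>: "inj_on \<eta> {0..<N}" and N: "even N" and p: "p \<in> perms N 0" and "i < N" "k < N"
  shows "Upair (\<eta> (p i)) (\<eta> (p (partner i))) = Upair (\<eta> (p k)) (\<eta> (p (partner k))) \<longleftrightarrow> k = i \<or> k = partner i"
  using assms partner_less[OF N] perms_inj_comp[OF \<eta> p]
  by (auto simp: Upair_inject)

lemma matching_on_Un: "matching_on \<eta> (A \<union> B) p = matching_on \<eta> A p \<union> matching_on \<eta> B p"
  by (simp add: matching_on_def image_Un)

lemma matching_on_disjoint:
  assumes "inj_on \<eta> {0..<N}" "even N" "p \<in> perms N 0"
    and "A \<subseteq> {0..<N}" "B \<subseteq> {0..<N}" "A \<inter> B = {}" "partner ` A \<subseteq> A"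
  shows "matching_on \<eta> A p \<inter> matching_on \<eta> B p = {}"
proof (rule ccontr)
  assume "\<not> ?thesis"
  then obtain i k where ik: "i \<in> A" "k \<in> B"
    "Upair (\<eta> (p i)) (\<eta> (p (partner i))) = Upair (\<eta> (p k)) (\<eta> (p (partner k)))"
    unfolding matching_on_def by blast
  moreover have "i < N" "k < N" using ik assms(4,5) by auto
  ultimately have "k = i \<or> k = partner i"
    using matching_edge_eq_iff[OF assms(1-3), of i k] by blast
  with ik assms(6,7) show False by auto
qed

lemma matching_on_cong:
  assumes "\<And>i. i \<in> A \<Longrightarrow> p i = q i" "partner ` A \<subseteq> A"
  shows "matching_on \<eta> A p = matching_on \<eta> A q"
  unfolding matching_on_def using assms by (intro image_cong) auto

lemma matching_on_perfect:
  assumes \<eta>: "bij_betw \<eta> {0..<N} H" and N: "even N" and p: "p \<in> perms N 0"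
  shows "matching_on \<eta> {0..<N} p \<in> perfect_matchings H"
proof -
  have inj: "inj_on \<eta> {0..<N}" and ran: "\<eta> ` {0..<N} = H" using \<eta> by (auto simp: bij_betw_def)
  have pp: "bij_betw p {0..<N} {0..<N}" using p by (simp add: perms_def permutes_imp_bij)
  have H: "H = (\<lambda>i. \<eta> (p i)) ` {0..<N}"
    using bij_betw_trans[OF pp \<eta>] by (auto simp: bij_betw_def comp_def)
  note eqs = perms_inj_comp[OF inj p] partner_less[OF N]
  show ?thesis
    unfolding perfect_matchings_def
  proof (intro CollectI conjI ballI)
    fix e assume "e \<in> matching_on \<eta> {0..<N} p"
    then obtain i where "i < N" "e = Upair (\<eta> (p i)) (\<eta> (p (partner i)))"
      by (auto simp: matching_on_def)
    then show "proper_uprod e" "set_uprod e \<subseteq> H"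
      using eqs by (auto simp: H)
  next
    fix h assume "h \<in> H"
    then obtain i where i: "i < N" "h = \<eta> (p i)" by (auto simp: H)
    show "\<exists>!e. e \<in> matching_on \<eta> {0..<N} p \<and> h \<in> set_uprod e"
    proof (rule ex1I[of _ "Upair (\<eta> (p i)) (\<eta> (p (partner i)))"])
      show "Upair (\<eta> (p i)) (\<eta> (p (partner i))) \<in> matching_on \<eta> {0..<N} p \<and> h \<in> set_uprod (Upair (\<eta> (p i)) (\<eta> (p (partner i))))"
        using i by (auto simp: matching_on_def)
      fix e assume e: "e \<in> matching_on \<eta> {0..<N} p \<and> h \<in> set_uprod e"
      then obtain k where k: "k < N" "e = Upair (\<eta> (p k)) (\<eta> (p (partner k)))"
        by (auto simp: matching_on_def)
      with e i eqs have "i = k \<or> i = partner k" by auto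
      then show "e = Upair (\<eta> (p i)) (\<eta> (p (partner i)))"
        using k by (auto simp: Upair_inject)
    qed
  qed
qed

lemma swp_in_perms_0: "i < N \<Longrightarrow> k < N \<Longrightarrow> p \<in> perms N 0 \<Longrightarrow> p \<circ> swp i k \<in> perms N 0"
  by (intro perms_comp swp_in_perms) auto

text \<open>Exchanging the values at \<open>j\<close> and \<open>k\<close> rewires only the edges at
  these two positions: nothing changes if \<open>k\<close> is \<open>j\<close> or its partner, and
  otherwise the result is a switching.\<close>

lemma matching_on_swap_cases:
  assumes \<eta>: "bij_betw \<eta> {0..<N} H" and N: "even N" and p: "p \<in> perms N 0" and j: "j < N" and k: "k < N"
  shows "matching_on \<eta> {0..<N} (p \<circ> swp j k) = matching_on \<eta> {0..<N} p
    \<or> switching (matching_on \<eta> {0..<N} p) (matching_on \<eta> {0..<N} (p \<circ> swp j k))"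
proof -
  let ?q = "p \<circ> swp j k" and ?A = "{j, partner j, k, partner k}"
  let ?B = "{0..<N} - ?A"
  have inj: "inj_on \<eta> {0..<N}" using \<eta> by (auto simp: bij_betw_def)
  have A: "?A \<subseteq> {0..<N}" using j k partner_less[OF N] by auto
  then have N_eq: "{0..<N} = ?A \<union> ?B" by blast
  have B: "partner ` ?B \<subseteq> ?B" using partner_less[OF N] by (auto simp: partner_eq_iff)
  have "matching_on \<eta> ?B ?q = matching_on \<eta> ?B p"
    by (rule matching_on_cong[OF _ B]) (auto simp: transpose_apply_other)
  then have q: "matching_on \<eta> {0..<N} ?q = matching_on \<eta> ?A ?q \<union> matching_on \<eta> ?B p"
    by (subst N_eq) (simp only: matching_on_Un)
  have p_eq: "matching_on \<eta> {0..<N} p = matching_on \<eta> ?A p \<union> matching_on \<eta> ?B p"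
    by (subst N_eq) (simp only: matching_on_Un)
  have disj: "matching_on \<eta> ?A p \<inter> matching_on \<eta> ?B p = {}"
    by (rule matching_on_disjoint[OF inj N p A]) auto
  \<comment> \<open>The second edge is listed with \<open>partner k\<close> before \<open>k\<close>
    to fit the pattern of \<open>switching\<close>: the new edges join \<open>j\<close> to
    \<open>partner k\<close> and \<open>partner j\<close> to \<open>k\<close>.\<close>
  have pA: "matching_on \<eta> ?A p = {Upair (\<eta> (p j)) (\<eta> (p (partner j))), Upair (\<eta> (p (partner k))) (\<eta> (p k))}"
    by (auto simp: matching_on_def Upair_inject)
  consider "k = j" | "k = partner j" | "k \<noteq> j" "k \<noteq> partner j" by blast
  then show ?thesis
  proof cases
    case 1
    then show ?thesis by simp
  next
    case 2
    have "matching_on \<eta> ?A ?q = matching_on \<eta> ?A p"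
      unfolding pA unfolding matching_on_def 2 by (auto simp: Upair_inject)
    then show ?thesis using q p_eq by simp
  next
    case 3
    have ne: "partner j \<noteq> k" "partner k \<noteq> j" "partner j \<noteq> partner k"
      using 3 partner_eq_iff[of k j] partner_eq_iff[of j "partner k"] by auto
    have "?q j = p k" "?q k = p j" "?q (partner j) = p (partner j)" "?q (partner k) = p (partner k)"
      using 3 ne by (auto simp: transpose_apply_other)
    then have "matching_on \<eta> ?A ?q = {Upair (\<eta> (p j)) (\<eta> (p (partner k))), Upair (\<eta> (p (partner j))) (\<eta> (p k))}"
      unfolding matching_on_def by (auto simp: Upair_inject)
    then have m': "matching_on \<eta> {0..<N} ?q = matching_on \<eta> ?B p \<union> {Upair (\<eta> (p j)) (\<eta> (p (partner k))), Upair (\<eta> (p (partner j))) (\<eta> (p k))}"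
      unfolding q by (simp only: Un_commute)
    have diff: "matching_on \<eta> {0..<N} p - {Upair (\<eta> (p j)) (\<eta> (p (partner j))), Upair (\<eta> (p (partner k))) (\<eta> (p k))} = matching_on \<eta> ?B p"
      using disj unfolding p_eq pA by blast
    have "switching (matching_on \<eta> {0..<N} p) (matching_on \<eta> {0..<N} ?q)"
      unfolding switching_def m'
    proof (intro exI conjI)
      show "Upair (\<eta> (p j)) (\<eta> (p (partner j))) \<in> matching_on \<eta> {0..<N} p"
        "Upair (\<eta> (p (partner k))) (\<eta> (p k)) \<in> matching_on \<eta> {0..<N} p"
        unfolding p_eq pA by blast+
    qed (simp only: diff)
    then show ?thesis ..
  qed
qed

section \<open>Graphs of partial matchings and decoupling by additivity\<close>

definition graph_on :: "(nat \<Rightarrow> nat \<times> nat) \<Rightarrow> nat set \<Rightarrow> nat set \<Rightarrow> (nat \<Rightarrow> nat) \<Rightarrow> nat mgraph" where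
  "graph_on \<eta> V A p = MGraph V (image_mset (map_uprod fst) (mset_set (matching_on \<eta> A p)))"

lemma graph_on_all: "graph_on \<eta> {1..n} {0..<N} p = matching_graph n (matching_on \<eta> {0..<N} p)"
  by (simp add: graph_on_def matching_graph_def)

lemma finite_matching_on: "finite A \<Longrightarrow> finite (matching_on \<eta> A p)"
  by (simp add: matching_on_def)

lemma finite_mgraph_graph_on:
  assumes "finite V" "finite A" "partner ` A \<subseteq> A" "\<And>i. i \<in> A \<Longrightarrow> fst (\<eta> (p i)) \<in> V"
  shows "finite_mgraph (graph_on \<eta> V A p)"
proof -
  have sub: "set_uprod (map_uprod fst e) \<subseteq> V" if "e \<in> matching_on \<eta> A p" for e
    using that assms(3,4) by (auto simp: matching_on_def image_subset_iff)
  have "finite (matching_on \<eta> A p)" by (rule finite_matching_on[OF assms(2)])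
  then show ?thesis
    using assms(1) subsetD[OF sub] by (auto simp: finite_mgraph_def graph_on_def)
qed

lemma graph_on_additive:
  assumes F: "mgraph_additive F" and \<eta>: "inj_on \<eta> {0..<N}" and N: "even N" and p: "p \<in> perms N 0"
    and V: "finite V" "V \<inter> V' = {}" "finite V'"
    and AB: "A \<inter> B = {}" "A \<union> B = {0..<N}" "partner ` A \<subseteq> A"
    and fst_A: "\<And>i. i \<in> A \<Longrightarrow> fst (\<eta> (p i)) \<in> V"
    and fst_B: "\<And>i. i \<in> B \<Longrightarrow> fst (\<eta> (p i)) \<in> V'"
  shows "F (graph_on \<eta> (V \<union> V') {0..<N} p) = F (graph_on \<eta> V A p) + F (graph_on \<eta> V' B p)"
proof -
  have sub: "A \<subseteq> {0..<N}" "B \<subseteq> {0..<N}" using AB by auto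
  then have fin: "finite A" "finite B" by (auto intro: finite_subset)
  have B: "partner ` B \<subseteq> B"
  proof clarify
    fix b assume b: "b \<in> B"
    then have "partner b \<in> A \<union> B" using sub AB(2) partner_less[OF N, of b] by auto
    moreover have "partner b \<notin> A" using AB(1,3) b by (metis IntI empty_iff image_subset_iff partner_partner)
    ultimately show "partner b \<in> B" by blast
  qed
  have "matching_on \<eta> A p \<inter> matching_on \<eta> B p = {}"
    by (rule matching_on_disjoint[OF \<eta> N p sub AB(1,3)])
  then have "graph_on \<eta> (V \<union> V') {0..<N} p = mgraph_union (graph_on \<eta> V A p) (graph_on \<eta> V' B p)"
    by (simp add: AB(2)[symmetric] graph_on_def mgraph_union_def matching_on_Un mset_set_Union finite_matching_on fin)
  then show ?thesis
    using F finite_mgraph_graph_on[of V A \<eta> p] finite_mgraph_graph_on[of V' B \<eta> p] V fin AB(3) B fst_A fst_B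
    by (simp add: mgraph_additive_def graph_on_def)
qed

lemma connected_in_sym: "connected_in N v p i k \<Longrightarrow> connected_in N v p k i"
  unfolding connected_in_def using sym_rtrancl[OF adjacency_sym] by (auto dest: symD)

lemma connected_in_trans: "connected_in N v p i j \<Longrightarrow> connected_in N v p j k \<Longrightarrow> connected_in N v p i k"
  unfolding connected_in_def by (rule rtrancl_trans)

lemma connected_in_refl: "connected_in N v p i i"
  by (simp add: connected_in_def)

text \<open>For all four permutations involved the graph splits along the components of
  \<open>j\<close> and \<open>k\<close> taken at \<open>p\<close>. One summand feels only the swap
  of \<open>j\<close> and \<open>k\<close>, the other only that of \<open>i\<close> and
  \<open>l\<close>, so the mixed second difference cancels.\<close>

lemma swaps_decouple_matching_graph:
  assumes F: "mgraph_additive F" and \<eta>: "inj_on \<eta> {0..<N}" and N: "even N"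
    and fst: "\<And>h. h < N \<Longrightarrow> fst (\<eta> h) \<in> {1..n}"
  shows "swaps_decouple N (connected_in N (\<lambda>h. fst (\<eta> h))) (\<lambda>p. F (matching_graph n (matching_on \<eta> {0..<N} p)))"
  unfolding swaps_decouple_def
proof (intro ballI allI impI)
  fix p i l j k
  assume p: "p \<in> perms N 0" and less: "i < N" "l < N" "j < N" "k < N"
    and nt: "\<not> touching (connected_in N (\<lambda>h. fst (\<eta> h)) p) i l j k"
  let ?c = "connected_in N (\<lambda>h. fst (\<eta> h)) p"
  \<comment> \<open>The components of \<open>j\<close> and of \<open>k\<close> are taken together,
    since the swap may join two different ones.\<close>
  define A where "A = {x. x < N \<and> (?c j x \<or> ?c k x)}"
  define B where "B = {0..<N} - A"
  define V where "V = (\<lambda>x. fst (\<eta> (p x))) ` A"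
  \<comment> \<open>All remaining vertices, including those without half-edges, so that
    \<open>V\<close> and \<open>V'\<close> exhaust \<open>{1..n}\<close>.\<close>
  define V' where "V' = {1..n} - V"
  have adj: "?c x y" if "x < N" "y < N" "y = partner x \<or> fst (\<eta> (p x)) = fst (\<eta> (p y))" for x y
    unfolding connected_in_def using that by (intro r_into_rtrancl) (auto simp: adjacency_def)
  have AB: "A \<inter> B = {}" "A \<union> B = {0..<N}" by (auto simp: A_def B_def)
  have A: "partner ` A \<subseteq> A"
    using adj partner_less[OF N] by (auto simp: A_def intro: connected_in_trans)
  have B: "partner ` B \<subseteq> B"
    using A partner_less[OF N] by (auto simp: B_def image_subset_iff)
  have jk: "j \<in> A" "k \<in> A" using less by (auto simp: A_def connected_in_refl)
  have il: "i \<in> B" "l \<in> B" using less nt by (auto simp: A_def B_def touching_def dest: connected_in_sym)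
  have fstB: "fst (\<eta> (p x)) \<in> V'" if "x \<in> B" for x
  proof -
    have "fst (\<eta> (p x)) \<notin> V"
    proof
      assume "fst (\<eta> (p x)) \<in> V"
      then obtain a where a: "a \<in> A" "fst (\<eta> (p a)) = fst (\<eta> (p x))" by (auto simp: V_def)
      then have "?c a x" using that by (intro adj) (auto simp: A_def B_def)
      then have "x \<in> A" using a that by (auto simp: A_def B_def intro: connected_in_trans)
      with that show False by (simp add: B_def)
    qed
    then show ?thesis using fst[OF perms_less[OF p, of x]] that by (auto simp: V'_def B_def)
  qed
  have V: "V \<subseteq> {1..n}" using fst perms_less[OF p] by (auto simp: V_def A_def)
  have VV: "V \<union> V' = {1..n}" "V \<inter> V' = {}" "finite V" "finite V'"
    using V by (auto simp: V'_def intro: finite_subset)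
  define G where "G q = F (matching_graph n (matching_on \<eta> {0..<N} q))" for q
  \<comment> \<open>The same \<open>V\<close> and \<open>V'\<close> serve every \<open>q\<close>
    that reaches the same half-edges as \<open>p\<close> from \<open>A\<close> and from
    \<open>B\<close>.\<close>
  have split: "G q = F (graph_on \<eta> V A q) + F (graph_on \<eta> V' B q)"
    if q: "q \<in> perms N 0" and qA: "q ` A = p ` A" and qB: "q ` B = p ` B" for q
  proof -
    have "F (graph_on \<eta> (V \<union> V') {0..<N} q) = F (graph_on \<eta> V A q) + F (graph_on \<eta> V' B q)"
    proof (rule graph_on_additive[OF F \<eta> N q VV(3,2,4) AB A])
      fix x assume "x \<in> A"
      then obtain y where "y \<in> A" "q x = p y" using qA by (metis imageE imageI)
      then show "fst (\<eta> (q x)) \<in> V" by (auto simp: V_def)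
    next
      fix x assume "x \<in> B"
      then obtain y where "y \<in> B" "q x = p y" using qB by (metis imageE imageI)
      then show "fst (\<eta> (q x)) \<in> V'" using fstB by simp
    qed
    then show ?thesis unfolding VV(1) graph_on_all G_def .
  qed
  have swA: "swp j k ` A = A" "swp i l ` B = B" using jk il by (simp_all add: transpose_image_eq)
  have swB: "swp j k x = x" if "x \<in> B" for x using that jk AB by (auto intro!: transpose_apply_other)
  have swA': "swp i l x = x" if "x \<in> A" for x using that il AB by (auto intro!: transpose_apply_other)
  have swB_img: "swp j k ` B = B" "swp i l ` A = A"
    using swB swA' by (auto simp: image_def)
  have perms: "p \<circ> swp j k \<in> perms N 0" "p \<circ> swp i l \<in> perms N 0" "p \<circ> swp i l \<circ> swp j k \<in> perms N 0"
    using p less by (simp_all add: swp_in_perms_0)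
  have "graph_on \<eta> V' B (p \<circ> swp j k) = graph_on \<eta> V' B p"
    "graph_on \<eta> V' B (p \<circ> swp i l \<circ> swp j k) = graph_on \<eta> V' B (p \<circ> swp i l)"
    "graph_on \<eta> V A (p \<circ> swp i l) = graph_on \<eta> V A p"
    unfolding graph_on_def
    using matching_on_cong[OF _ B, of "p \<circ> swp j k" p \<eta>]
      matching_on_cong[OF _ B, of "p \<circ> swp i l \<circ> swp j k" "p \<circ> swp i l" \<eta>]
      matching_on_cong[OF _ A, of "p \<circ> swp i l" p \<eta>] swB swA' by auto
  moreover have "graph_on \<eta> V A (p \<circ> swp i l \<circ> swp j k) = graph_on \<eta> V A (p \<circ> swp j k)"
  proof -
    have "swp i l (swp j k x) = swp j k x" if "x \<in> A" for x
      using swA(1) that by (intro swA') auto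
    then show ?thesis
      unfolding graph_on_def
      using matching_on_cong[OF _ A, of "p \<circ> swp i l \<circ> swp j k" "p \<circ> swp j k" \<eta>] by auto
  qed
  moreover have "G p = F (graph_on \<eta> V A p) + F (graph_on \<eta> V' B p)"
    by (rule split[OF p]) auto
  moreover have "G (p \<circ> swp j k) = F (graph_on \<eta> V A (p \<circ> swp j k)) + F (graph_on \<eta> V' B (p \<circ> swp j k))"
    by (rule split[OF perms(1)]) (simp_all only: image_comp[symmetric] swA swB_img)
  moreover have "G (p \<circ> swp i l) = F (graph_on \<eta> V A (p \<circ> swp i l)) + F (graph_on \<eta> V' B (p \<circ> swp i l))"
    by (rule split[OF perms(2)]) (simp_all only: image_comp[symmetric] swA swB_img)
  moreover have "G (p \<circ> swp i l \<circ> swp j k) = F (graph_on \<eta> V A (p \<circ> swp i l \<circ> swp j k)) + F (graph_on \<eta> V' B (p \<circ> swp i l \<circ> swp j k))"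
    by (rule split[OF perms(3)]) (simp_all only: image_comp[symmetric] swA swB_img)
  ultimately have "G p - G (p \<circ> swp j k) = G (p \<circ> swp i l) - G (p \<circ> swp i l \<circ> swp j k)"
    by simp
  then show "F (matching_graph n (matching_on \<eta> {0..<N} p)) - F (matching_graph n (matching_on \<eta> {0..<N} (p \<circ> swp j k))) =
    F (matching_graph n (matching_on \<eta> {0..<N} (p \<circ> swp i l))) - F (matching_graph n (matching_on \<eta> {0..<N} (p \<circ> swp i l \<circ> swp j k)))"
    by (simp add: G_def)
qed

section \<open>From uniform permutations to uniform perfect matchings\<close>

lemma finite_perfect_matching:
  assumes m: "m \<in> perfect_matchings H" and H: "finite H"
  shows "finite m"
proof (rule finite_surj[OF H])
  show "m \<subseteq> (\<lambda>h. THE e. e \<in> m \<and> h \<in> set_uprod e) ` H"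
  proof
    fix e assume e: "e \<in> m"
    obtain a b where ab: "e = Upair a b" by (cases e)
    with e m have "a \<in> H" by (auto simp: perfect_matchings_def)
    then have "\<exists>!e. e \<in> m \<and> a \<in> set_uprod e" using m by (simp add: perfect_matchings_def)
    from the1_equality[OF this, of e] show "e \<in> (\<lambda>h. THE e. e \<in> m \<and> h \<in> set_uprod e) ` H"
      using e ab \<open>a \<in> H\<close> by (auto intro!: image_eqI[of _ _ a])
  qed
qed

lemma perfect_matchings_edge_unique:
  "m \<in> perfect_matchings H \<Longrightarrow> e \<in> m \<Longrightarrow> e' \<in> m \<Longrightarrow> h \<in> set_uprod e \<Longrightarrow> h \<in> set_uprod e' \<Longrightarrow> e = e'"
  unfolding perfect_matchings_def by blast

text \<open>Number the edges of \<open>m\<close>, orient each of them and list the end points, so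
  that edge \<open>u\<close> occupies the positions \<open>2 u\<close> and \<open>2 u + 1\<close>.
  Pulling this list back along \<open>\<eta>\<close> gives the permutation.\<close>

lemma matching_on_surj:
  assumes \<eta>: "bij_betw \<eta> {0..<N} H" and m: "m \<in> perfect_matchings H"
  shows "\<exists>p\<in>perms N 0. matching_on \<eta> {0..<N} p = m"
proof -
  have H: "finite H" using \<eta> bij_betw_finite by blast
  have fin: "finite m" by (rule finite_perfect_matching[OF m H])
  obtain c where c: "bij_betw c {0..<card m} m" using ex_bij_betw_nat_finite[OF fin] by blast
  have "\<exists>x. e = Upair (fst x) (snd x)" for e :: "'a uprod"
    by (cases e) auto
  then obtain x where x: "\<And>e :: 'a uprod. e = Upair (fst (x e)) (snd (x e))" by metis
  define g where "g t = (if even t then fst (x (c (t div 2))) else snd (x (c (t div 2))))" for t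
  have edge: "c u \<in> m" "c u = Upair (g (2 * u)) (g (2 * u + 1))" if "u < card m" for u
    using bij_betwE[OF c] that x[of "c u"] by (auto simp: g_def)
  have mem: "g t \<in> set_uprod (c (t div 2))" for t
    using x[of "c (t div 2)"] by (auto simp: g_def) (metis insertI1 insertI2 set_uprod_simps)+
  have g: "bij_betw g {0..<2 * card m} H"
    unfolding bij_betw_def
  proof
    show "inj_on g {0..<2 * card m}"
    proof (rule inj_onI)
      fix s t assume st: "s \<in> {0..<2 * card m}" "t \<in> {0..<2 * card m}" "g s = g t"
      then have div: "s div 2 < card m" "t div 2 < card m" by auto
      have "c (s div 2) = c (t div 2)"
        using perfect_matchings_edge_unique[OF m edge(1)[OF div(1)] edge(1)[OF div(2)], of "g s"] mem[of s] mem[of t] st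
        by auto
      then have "s div 2 = t div 2"
        using bij_betw_imp_inj_on[OF c] div by (auto dest: inj_onD)
      moreover have "even s \<longleftrightarrow> even t"
      proof (rule ccontr)
        assume "\<not> ?thesis"
        then have "fst (x (c (s div 2))) = snd (x (c (s div 2)))"
          using st(3) \<open>s div 2 = t div 2\<close> by (auto simp: g_def split: if_splits)
        moreover have "proper_uprod (c (s div 2))"
          using m edge(1)[OF div(1)] by (simp add: perfect_matchings_def)
        ultimately show False using x[of "c (s div 2)"] by (metis proper_uprod_simps)
      qed
      ultimately show "s = t" by (metis div_mult_mod_eq even_iff_mod_2_eq_zero odd_iff_mod_2_eq_one)
    qed
    show "g ` {0..<2 * card m} = H"
    proof
      show "g ` {0..<2 * card m} \<subseteq> H"
      proof clarify
        fix t assume "t \<in> {0..<2 * card m}"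
        then have "c (t div 2) \<in> m" by (intro edge(1)) auto
        then show "g t \<in> H" using mem[of t] m by (auto simp: perfect_matchings_def)
      qed
      show "H \<subseteq> g ` {0..<2 * card m}"
      proof
        fix h assume "h \<in> H"
        then obtain e where e: "e \<in> m" "h \<in> set_uprod e" using m by (auto simp: perfect_matchings_def)
        then have "e \<in> c ` {0..<card m}" using c by (simp add: bij_betw_def)
        then obtain u where u: "u < card m" "e = c u" by auto
        with e edge(2) have "h = g (2 * u) \<or> h = g (2 * u + 1)" by auto
        moreover have "2 * u \<in> {0..<2 * card m}" "2 * u + 1 \<in> {0..<2 * card m}" using u by auto
        ultimately show "h \<in> g ` {0..<2 * card m}" by blast
      qed
    qed
  qed
  have N: "2 * card m = N"
    using bij_betw_same_card[OF g] bij_betw_same_card[OF \<eta>] by simp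
  define p where "p t = (if t < N then inv_into {0..<N} \<eta> (g t) else t)" for t
  have "bij_betw (inv_into {0..<N} \<eta> \<circ> g) {0..<N} {0..<N}"
    using bij_betw_trans[OF g bij_betw_inv_into[OF \<eta>]] by (simp add: N)
  then have "bij_betw p {0..<N} {0..<N}"
    by (rule bij_betw_cong[THEN iffD1, rotated]) (simp add: p_def)
  then have p: "p \<in> perms N 0"
    unfolding perms_def by (auto intro!: bij_imp_permutes simp: p_def)
  have \<eta>p: "\<eta> (p t) = g t" if "t < N" for t
    using that bij_betwE[OF g] \<eta> by (auto simp: p_def N bij_betw_def intro!: f_inv_into_f)
  have "matching_on \<eta> {0..<N} p = (\<lambda>t. c (t div 2)) ` {0..<N}"
    unfolding matching_on_def
  proof (intro image_cong refl)
    fix t assume t: "t \<in> {0..<N}"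
    have "partner t < N" using t N by (intro partner_less) auto
    then have "Upair (\<eta> (p t)) (\<eta> (p (partner t))) = Upair (g t) (g (partner t))"
      using t by (simp add: \<eta>p)
    also have "\<dots> = Upair (g (2 * (t div 2))) (g (2 * (t div 2) + 1))"
      by (cases "even t") (auto simp: partner_def Upair_inject elim!: evenE oddE)
    also have "\<dots> = c (t div 2)" using t N by (intro edge(2)[symmetric]) auto
    finally show "Upair (\<eta> (p t)) (\<eta> (p (partner t))) = c (t div 2)" .
  qed
  also have "\<dots> = c ` {0..<card m}"
  proof -
    have "(\<lambda>t. t div 2) ` {0..<N} = {0..<card m}"
    proof
      show "{0..<card m} \<subseteq> (\<lambda>t. t div 2) ` {0..<N}"
        using N by (auto intro!: image_eqI[of _ _ "2 * _"])
    qed (use N in auto)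
    then show ?thesis by (metis image_image)
  qed
  also have "\<dots> = m" using c by (simp add: bij_betw_def)
  finally show ?thesis using p by blast
qed

lemma mean_equal_fibres:
  assumes "finite A" and "f ` A = B" and c: "\<And>b. b \<in> B \<Longrightarrow> card {a \<in> A. f a = b} = c" and "A \<noteq> {}"
  shows "mean A (\<lambda>a. g (f a)) = mean B g"
proof -
  have B: "finite B" using assms by auto
  have sum_eq: "(\<Sum>a\<in>A. h (f a)) = real c * (\<Sum>b\<in>B. h b)" for h
  proof -
    have "(\<Sum>a\<in>A. h (f a)) = (\<Sum>b\<in>B. \<Sum>a\<in>{a \<in> A. f a = b}. h (f a))"
      by (rule sum.group[symmetric]) (use assms B in auto)
    also have "\<dots> = (\<Sum>b\<in>B. real c * h b)"
      by (intro sum.cong refl) (simp add: c)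
    finally show ?thesis by (simp add: sum_distrib_left)
  qed
  have "real (card A) = real c * real (card B)"
    using sum_eq[of "\<lambda>_. 1"] by simp
  moreover have "card A \<noteq> 0" using assms by auto
  ultimately show ?thesis
    unfolding mean_def sum_eq by (auto simp: field_simps)
qed

text \<open>All fibres are translates of the fibre over the matching of \<open>id\<close>:
  composition with \<open>s\<close> on the left relabels half-edges, which does not affect whether
  two permutations give the same matching.\<close>

lemma mean_perfect_matchings:
  assumes \<eta>: "bij_betw \<eta> {0..<N} H" and N: "even N"
  shows "mean (perfect_matchings H) g = expect N (\<lambda>p. g (matching_on \<eta> {0..<N} p))"
proof (rule mean_equal_fibres[symmetric])
  show "matching_on \<eta> {0..<N} ` perms N 0 = perfect_matchings H"
    using matching_on_perfect[OF \<eta> N] matching_on_surj[OF \<eta>] by blast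
next
  have inj: "inj_on \<eta> {0..<N}" using \<eta> by (simp add: bij_betw_def)
  let ?\<mu> = "matching_on \<eta> {0..<N}"
  have edge_inj: "Upair (\<eta> a) (\<eta> b) = Upair (\<eta> a') (\<eta> b') \<longleftrightarrow> Upair a b = Upair a' b'"
    if "a < N" "b < N" "a' < N" "b' < N" for a b a' b'
    using that inj_on_eq_iff[OF inj] by (auto simp: Upair_inject)
  have le: "?\<mu> (s \<circ> p) \<subseteq> ?\<mu> (s \<circ> q)" if s: "s \<in> perms N 0" and p: "p \<in> perms N 0" and q: "q \<in> perms N 0"
    and sub: "?\<mu> p \<subseteq> ?\<mu> q" for s p q
  proof
    fix e assume "e \<in> ?\<mu> (s \<circ> p)"
    then obtain i where i: "i < N" "e = Upair (\<eta> (s (p i))) (\<eta> (s (p (partner i))))"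
      by (auto simp: matching_on_def)
    then have "Upair (\<eta> (p i)) (\<eta> (p (partner i))) \<in> ?\<mu> p"
      by (auto simp: matching_on_def)
    then have "Upair (\<eta> (p i)) (\<eta> (p (partner i))) \<in> ?\<mu> q"
      using sub by blast
    then obtain k where k: "k < N" "Upair (\<eta> (p i)) (\<eta> (p (partner i))) = Upair (\<eta> (q k)) (\<eta> (q (partner k)))"
      by (auto simp: matching_on_def)
    then have "Upair (p i) (p (partner i)) = Upair (q k) (q (partner k))"
      using i p q partner_less[OF N] by (subst (asm) edge_inj) (auto intro: perms_less)
    then have "e = Upair (\<eta> (s (q k))) (\<eta> (s (q (partner k))))"
      using i by (auto simp: Upair_inject)
    then show "e \<in> ?\<mu> (s \<circ> q)" using k by (auto simp: matching_on_def)
  qed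
  fix m assume "m \<in> perfect_matchings H"
  then obtain s where s: "s \<in> perms N 0" "?\<mu> s = m" using matching_on_surj[OF \<eta>] by blast
  have "bij_betw (\<lambda>r. s \<circ> r) {p \<in> perms N 0. ?\<mu> p = ?\<mu> id} {p \<in> perms N 0. ?\<mu> p = m}"
  proof (rule bij_betwI[where g = "\<lambda>r. inv s \<circ> r"])
    show "(\<lambda>r. s \<circ> r) \<in> {p \<in> perms N 0. ?\<mu> p = ?\<mu> id} \<rightarrow> {p \<in> perms N 0. ?\<mu> p = m}"
    proof clarify
      fix p assume p: "p \<in> perms N 0" "?\<mu> p = ?\<mu> id"
      then have "?\<mu> (s \<circ> p) = ?\<mu> (s \<circ> id)"
        using le[OF s(1) p(1) id_in_perms] le[OF s(1) id_in_perms p(1)] by auto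
      then show "s \<circ> p \<in> perms N 0 \<and> ?\<mu> (s \<circ> p) = m" using s p by (auto intro: perms_comp)
    qed
    show "(\<lambda>r. inv s \<circ> r) \<in> {p \<in> perms N 0. ?\<mu> p = m} \<rightarrow> {p \<in> perms N 0. ?\<mu> p = ?\<mu> id}"
    proof clarify
      fix p assume p: "p \<in> perms N 0" "m = ?\<mu> p"
      then have "?\<mu> (inv s \<circ> p) = ?\<mu> (inv s \<circ> s)"
        using le[OF perms_inv[OF s(1)] p(1) s(1)] le[OF perms_inv[OF s(1)] s(1) p(1)] s(2) by auto
      then show "inv s \<circ> p \<in> perms N 0 \<and> ?\<mu> (inv s \<circ> p) = ?\<mu> id"
        using s p perms_inv_o(2)[OF s(1)] by (auto intro: perms_comp perms_inv)
    qed
  qed (auto simp: o_assoc perms_inv_o[OF s(1)])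
  then show "card {p \<in> perms N 0. ?\<mu> p = m} = card {p \<in> perms N 0. ?\<mu> p = ?\<mu> id}"
    by (rule bij_betw_same_card[symmetric])
qed auto

section \<open>The configuration model and its degrees\<close>

lemma finite_half_edges: "finite (half_edges n d)"
  by (simp add: half_edges_def)

lemma card_half_edges: "card (half_edges n d) = (\<Sum>i=1..n. d i)"
  by (simp add: half_edges_def)

lemma half_edges_enum:
  obtains \<eta> where "bij_betw \<eta> {0..<\<Sum>i=1..n. d i} (half_edges n d)"
  using ex_bij_betw_nat_finite[OF finite_half_edges, of n d] by (auto simp: card_half_edges)

lemma finite_perfect_matchings: "finite H \<Longrightarrow> finite (perfect_matchings H)"
proof -
  assume H: "finite H"
  have "perfect_matchings H \<subseteq> Pow ((\<lambda>(a, b). Upair a b) ` (H \<times> H))"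
  proof (intro subsetI PowI)
    fix m e assume m: "m \<in> perfect_matchings H" "e \<in> m"
    obtain a b where ab: "e = Upair a b" by (cases e)
    with m have "a \<in> H" "b \<in> H" by (auto simp: perfect_matchings_def)
    with ab show "e \<in> (\<lambda>(a, b). Upair a b) ` (H \<times> H)"
      by (auto intro!: image_eqI[of _ _ "(a, b)"])
  qed
  then show ?thesis by (rule finite_subset) (use H in auto)
qed

lemma perfect_matchings_nonempty:
  assumes "finite H" "even (card H)"
  shows "perfect_matchings H \<noteq> {}"
proof -
  obtain \<eta> where "bij_betw \<eta> {0..<card H} H" using ex_bij_betw_nat_finite[OF assms(1)] by blast
  from matching_on_perfect[OF this assms(2) id_in_perms] show ?thesis by blast
qed

lemma expectation_config_model:
  fixes g :: "nat mgraph \<Rightarrow> real"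
  assumes \<eta>: "bij_betw \<eta> {0..<N} (half_edges n d)" and N: "even N"
  shows "measure_pmf.expectation (config_model n d) g
    = expect N (\<lambda>p. g (matching_graph n (matching_on \<eta> {0..<N} p)))"
proof -
  let ?H = "half_edges n d"
  have "even (card ?H)" using N bij_betw_same_card[OF \<eta>] by simp
  then have "measure_pmf.expectation (config_model n d) g = mean (perfect_matchings ?H) (\<lambda>m. g (matching_graph n m))"
    by (simp add: config_model_def mean_def integral_pmf_of_set finite_perfect_matchings
        perfect_matchings_nonempty finite_half_edges)
  then show ?thesis by (simp add: mean_perfect_matchings[OF \<eta> N])
qed

text \<open>An edge contributes the number of its half-edges at \<open>v\<close>, which is
  \<open>2\<close> for a self-loop, and the edges partition the half-edges.\<close>

lemma mdegree_matching_graph: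
  assumes m: "m \<in> perfect_matchings (half_edges n d)" and v: "v \<in> {1..n}"
  shows "mdegree (matching_graph n m) v = d v"
proof -
  let ?H = "half_edges n d"
  have fin: "finite m" by (rule finite_perfect_matching[OF m finite_half_edges])
  have "mdegree (matching_graph n m) v = (\<Sum>e\<in>m. if map_uprod fst e = Upair v v then 2 else if v \<in> set_uprod (map_uprod fst e) then 1 else 0)"
    by (simp add: mdegree_def matching_graph_def sum_unfold_sum_mset image_mset.compositionality comp_def)
  also have "\<dots> = (\<Sum>e\<in>m. card {h \<in> set_uprod e. fst h = v})"
  proof (intro sum.cong refl)
    fix e assume "e \<in> m"
    then have "proper_uprod e" using m by (simp add: perfect_matchings_def)
    then obtain a b where ab: "e = Upair a b" "a \<noteq> b" by (cases e) auto
    have "{h \<in> set_uprod e. fst h = v} = (if fst a = v then {a} else {}) \<union> (if fst b = v then {b} else {})"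
      using ab by auto
    then show "(if map_uprod fst e = Upair v v then 2 else if v \<in> set_uprod (map_uprod fst e) then 1 else 0) = card {h \<in> set_uprod e. fst h = v}"
      using ab by (auto simp: Upair_inject)
  qed
  also have "\<dots> = card (\<Union>e\<in>m. {h \<in> set_uprod e. fst h = v})"
  proof (rule card_UN_disjoint[symmetric])
    show "\<forall>e\<in>m. finite {h \<in> set_uprod e. fst h = v}" by auto
    show "\<forall>e\<in>m. \<forall>e'\<in>m. e \<noteq> e' \<longrightarrow> {h \<in> set_uprod e. fst h = v} \<inter> {h \<in> set_uprod e'. fst h = v} = {}"
      using perfect_matchings_edge_unique[OF m] by blast
  qed (rule fin)
  also have "(\<Union>e\<in>m. {h \<in> set_uprod e. fst h = v}) = {h \<in> ?H. fst h = v}"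
    using m by (fastforce simp: perfect_matchings_def)
  also have "\<dots> = {v} \<times> {..<d v}"
    using v by (auto simp: half_edges_def)
  finally show ?thesis by simp
qed

text \<open>Degrees are the prescribed ones for every matching, so the randomness of the graph drops
  out and moments of the degree law become normalised sums over \<open>d\<close>.\<close>

lemma degree_pmf_eq:
  assumes n: "1 \<le> n" and ev: "even (\<Sum>i=1..n. d i)"
  shows "degree_pmf n d = map_pmf d (pmf_of_set {1..n})"
proof -
  let ?H = "half_edges n d"
  have ne: "perfect_matchings ?H \<noteq> {}" "finite (perfect_matchings ?H)"
    using perfect_matchings_nonempty[OF finite_half_edges] finite_perfect_matchings[OF finite_half_edges] ev
    by (auto simp: card_half_edges)
  have "degree_pmf n d = bind_pmf (config_model n d) (\<lambda>_. map_pmf d (pmf_of_set {1..n}))"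
    unfolding degree_pmf_def
  proof (rule bind_pmf_cong[OF refl])
    fix G assume "G \<in> set_pmf (config_model n d)"
    then obtain m where m: "m \<in> perfect_matchings ?H" "G = matching_graph n m"
      using ne by (auto simp: config_model_def)
    have "verts G = {1..n}" by (simp add: m matching_graph_def)
    then show "map_pmf (mdegree G) (pmf_of_set (verts G)) = map_pmf d (pmf_of_set {1..n})"
      using n m mdegree_matching_graph[OF m(1)] by (intro map_pmf_cong) auto
  qed
  then show ?thesis by simp
qed

lemma expectation_degree_pmf:
  assumes "1 \<le> n" "even (\<Sum>i=1..n. d i)"
  shows "measure_pmf.expectation (degree_pmf n d) (g :: nat \<Rightarrow> real) = (\<Sum>i=1..n. g (d i)) / n"
  using assms by (simp add: degree_pmf_eq integral_pmf_of_set)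

lemma card_half_edges_at:
  fixes N :: nat
  assumes \<eta>: "bij_betw \<eta> {0..<N} (half_edges n d)"
  shows "card {h. h < N \<and> fst (\<eta> h) = x} = (if x \<in> {1..n} then d x else 0)"
proof -
  have "card {h. h < N \<and> fst (\<eta> h) = x} = card (\<eta> ` {h. h < N \<and> fst (\<eta> h) = x})"
    by (intro card_image[symmetric] inj_on_subset[OF bij_betw_imp_inj_on[OF \<eta>]]) auto
  also have "\<eta> ` {h. h < N \<and> fst (\<eta> h) = x} = {e \<in> \<eta> ` {0..<N}. fst e = x}"
    by auto
  also have "\<dots> = {e \<in> half_edges n d. fst e = x}"
    using \<eta> by (simp add: bij_betw_def)
  also have "\<dots> = (if x \<in> {1..n} then {x} \<times> {..<d x} else {})"
    by (auto simp: half_edges_def)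
  finally show ?thesis by simp
qed

text \<open>The right side is \<open>n\<close> times the second factorial moment of the degree law
  and \<open>N\<close> is \<open>n\<close> times its mean, so the ratio of sibling pairs to
  half-edges is bounded by the ratio that the theorem assumes to converge.\<close>

lemma card_sibling_pairs_le:
  assumes \<eta>: "bij_betw \<eta> {0..<N} (half_edges n d)"
  shows "real (card (sibling_pairs N (\<lambda>h. fst (\<eta> h)))) \<le> (\<Sum>i=1..n. real (d i) * (real (d i) - 1))"
proof -
  define A where "A i = {h. h < N \<and> fst (\<eta> h) = i}" for i
  have A: "finite (A i)" "i \<in> {1..n} \<Longrightarrow> card (A i) = d i" for i
    using card_half_edges_at[OF \<eta>, of i] by (auto simp: A_def)
  have "sibling_pairs N (\<lambda>h. fst (\<eta> h)) \<subseteq> (\<Union>i\<in>{1..n}. A i \<times> A i - (\<lambda>h. (h, h)) ` A i)"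
  proof clarify
    fix h h' assume hh: "(h, h') \<in> sibling_pairs N (\<lambda>h. fst (\<eta> h))"
    then have "\<eta> h \<in> half_edges n d" using \<eta> by (auto simp: sibling_pairs_def bij_betw_def)
    then have "fst (\<eta> h) \<in> {1..n}" by (auto simp: half_edges_def)
    with hh show "(h, h') \<in> (\<Union>i\<in>{1..n}. A i \<times> A i - (\<lambda>h. (h, h)) ` A i)"
      by (auto simp: sibling_pairs_def A_def)
  qed
  then have "card (sibling_pairs N (\<lambda>h. fst (\<eta> h))) \<le> card (\<Union>i\<in>{1..n}. A i \<times> A i - (\<lambda>h. (h, h)) ` A i)"
    by (intro card_mono) (auto simp: A)
  also have "\<dots> \<le> (\<Sum>i=1..n. card (A i \<times> A i - (\<lambda>h. (h, h)) ` A i))"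
    by (rule card_UN_le) auto
  also have "\<dots> = (\<Sum>i=1..n. d i * d i - d i)"
  proof (intro sum.cong refl)
    fix i assume i: "i \<in> {1..n}"
    have "card ((\<lambda>h. (h, h)) ` A i) = d i"
      using A(2)[OF i] by (subst card_image) (auto simp: inj_on_def)
    then show "card (A i \<times> A i - (\<lambda>h. (h, h)) ` A i) = d i * d i - d i"
      using A(2)[OF i] A(1)[of i] by (subst card_Diff_subset) (auto simp: card_cartesian_product)
  qed
  finally have "real (card (sibling_pairs N (\<lambda>h. fst (\<eta> h)))) \<le> real (\<Sum>i=1..n. d i * d i - d i)"
    by (simp only: of_nat_le_iff)
  also have "\<dots> = (\<Sum>i=1..n. real (d i) * (real (d i) - 1))"
    by (simp add: of_nat_diff algebra_simps)
  finally show ?thesis .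
qed

section \<open>Convergence of characteristic functions\<close>

text \<open>Imaginary and real part of one estimate: the remainder of \<open>iexp (b - a)\<close>
  after its linear term, rotated by \<open>iexp a\<close>.\<close>

lemma sin_cos_taylor:
  fixes a b :: real
  shows "\<bar>sin a - sin b - cos a * (a - b)\<bar> \<le> (a - b)\<^sup>2"
    and "\<bar>cos a - cos b - (- sin a) * (a - b)\<bar> \<le> (a - b)\<^sup>2"
proof -
  let ?z = "iexp (b - a) - (1 + \<i> * complex_of_real (b - a))"
  have "cmod ?z \<le> \<bar>b - a\<bar>\<^sup>2 / 2"
    using iexp_approx1[of "b - a" 1] by (simp add: power2_eq_square)
  moreover have "cmod (iexp a * ?z) = cmod ?z" by (simp only: norm_mult norm_exp_i_times mult_1)
  moreover have "\<bar>b - a\<bar>\<^sup>2 / 2 \<le> (a - b)\<^sup>2" by (simp add: power2_commute[of b a])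
  ultimately have z: "cmod (iexp a * ?z) \<le> (a - b)\<^sup>2" by linarith
  have "iexp a * ?z = iexp b - iexp a * (1 + \<i> * complex_of_real (b - a))"
    by (simp add: right_diff_distrib exp_add[symmetric] algebra_simps)
  then have "Im (iexp a * ?z) = sin b - sin a - cos a * (b - a)" "Re (iexp a * ?z) = cos b - cos a + sin a * (b - a)"
    by (simp_all add: Re_exp Im_exp algebra_simps)
  then show "\<bar>sin a - sin b - cos a * (a - b)\<bar> \<le> (a - b)\<^sup>2" "\<bar>cos a - cos b - (- sin a) * (a - b)\<bar> \<le> (a - b)\<^sup>2"
    using order_trans[OF abs_Im_le_cmod z] order_trans[OF abs_Re_le_cmod z] by (auto simp: algebra_simps abs_le_iff)
qed

text \<open>The integrating factor \<open>exp (s^2 / 2)\<close> is at most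
  \<open>exp (t^2 / 2)\<close> between \<open>0\<close> and \<open>t\<close>, and this bound cancels
  on returning to \<open>y\<close>.\<close>

lemma gaussian_ode_bound:
  fixes y y' :: "real \<Rightarrow> real"
  assumes deriv: "\<And>s. (y has_real_derivative y' s) (at s)"
    and ode: "\<And>s. \<bar>y' s + s * y s\<bar> \<le> \<delta> * (\<bar>s\<bar> + s\<^sup>2)" and \<delta>: "0 \<le> \<delta>"
  shows "\<bar>y t - y 0 * exp (- t\<^sup>2 / 2)\<bar> \<le> \<delta> * (\<bar>t\<bar> + t\<^sup>2) * \<bar>t\<bar>"
proof -
  define h where "h s = y s * exp (s\<^sup>2 / 2)" for s
  have h: "(h has_real_derivative exp (s\<^sup>2 / 2) * (y' s + s * y s)) (at s)" for s
    unfolding h_def by (auto intro!: derivative_eq_intros deriv simp: algebra_simps)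
  have "norm (h t - h 0) \<le> exp (t\<^sup>2 / 2) * (\<delta> * (\<bar>t\<bar> + t\<^sup>2)) * norm (t - 0)"
  proof (rule field_differentiable_bound[of "closed_segment 0 t" h "\<lambda>s. exp (s\<^sup>2 / 2) * (y' s + s * y s)"])
    fix s assume s: "s \<in> closed_segment 0 t"
    show "(h has_real_derivative exp (s\<^sup>2 / 2) * (y' s + s * y s)) (at s within closed_segment 0 t)"
      using h by (rule has_field_derivative_at_within)
    have st: "\<bar>s\<bar> \<le> \<bar>t\<bar>" using s by (auto simp: closed_segment_eq_real_ivl split: if_splits)
    then have st2: "s\<^sup>2 \<le> t\<^sup>2" by (simp add: abs_le_square_iff)
    have "\<bar>y' s + s * y s\<bar> \<le> \<delta> * (\<bar>t\<bar> + t\<^sup>2)"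
      using ode[of s] mult_left_mono[OF add_mono[OF st st2] \<delta>] by linarith
    then show "norm (exp (s\<^sup>2 / 2) * (y' s + s * y s)) \<le> exp (t\<^sup>2 / 2) * (\<delta> * (\<bar>t\<bar> + t\<^sup>2))"
      unfolding norm_mult using st2 by (intro mult_mono) auto
  qed auto
  then have *: "\<bar>h t - h 0\<bar> \<le> exp (t\<^sup>2 / 2) * (\<delta> * (\<bar>t\<bar> + t\<^sup>2) * \<bar>t\<bar>)"
    by (simp add: mult_ac)
  have "h t - h 0 = exp (t\<^sup>2 / 2) * (y t - y 0 * exp (- t\<^sup>2 / 2))"
    by (simp add: h_def algebra_simps exp_minus)
  with * show ?thesis
    by (simp add: abs_mult)
qed

lemma has_derivative_mean:
  assumes "\<And>x. x \<in> A \<Longrightarrow> ((\<lambda>s. g s x) has_real_derivative g' x) (at t)"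
  shows "((\<lambda>s. mean A (g s)) has_real_derivative mean A g') (at t)"
  unfolding mean_def by (intro DERIV_cdivide DERIV_sum assms)

text \<open>For \<open>y = E[cos (t X)]\<close> the derivative is \<open>- E[X sin (t X)]\<close>,
  which the Stein bound for the sine compares with \<open>- t y\<close>; here
  \<open>y 0 = 1\<close>. The sine average is treated alike with \<open>y 0 = 0\<close>. The two
  parts of \<open>\<delta>\<close> are the relative fluctuation of the kernel and the Taylor
  error.\<close>

lemma expect_trig_bound:
  fixes g :: "(nat \<Rightarrow> nat) \<Rightarrow> real"
  assumes lip: "swap_lipschitz N K g" and K: "0 \<le> K" and s: "0 < perm_variance N g"
  defines "X \<equiv> \<lambda>p. (g p - expect N g) / sqrt (perm_variance N g)"
    and "\<delta> \<equiv> sqrt (perm_variance N (stein_kernel N g)) / perm_variance N g + N * K ^ 3 / (perm_variance N g * sqrt (perm_variance N g))"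
  shows "\<bar>expect N (\<lambda>p. cos (t * X p)) - exp (- t\<^sup>2 / 2)\<bar> \<le> \<delta> * (\<bar>t\<bar> + t\<^sup>2) * \<bar>t\<bar>"
    and "\<bar>expect N (\<lambda>p. sin (t * X p))\<bar> \<le> \<delta> * (\<bar>t\<bar> + t\<^sup>2) * \<bar>t\<bar>"
proof -
  define S where "S = perm_variance N g"
  define \<sigma> where "\<sigma> = sqrt S"
  define e where "e = expect N g"
  define T where "T = sqrt (perm_variance N (stein_kernel N g))"
  have S: "0 < S" using s by (simp add: S_def)
  have \<sigma>: "0 < \<sigma>" "S = \<sigma> * \<sigma>" using S by (auto simp: \<sigma>_def)
  have T: "0 \<le> T" unfolding T_def perm_variance_def by (intro real_sqrt_ge_zero mean_nonneg) auto
  have X: "X p = (g p - e) / \<sigma>" for p by (simp add: X_def e_def \<sigma>_def S_def)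
  have \<delta>: "\<delta> = T / S + N * K ^ 3 / (S * \<sigma>)" by (simp add: \<delta>_def T_def S_def \<sigma>_def)
  have \<delta>0: "0 \<le> \<delta>" unfolding \<delta> using T S \<sigma> K by simp
  \<comment> \<open>Division by \<open>\<sigma>\<close> passes from \<open>g\<close> to the
    normalised \<open>X\<close>; each of the two coefficients is then enlarged to
    \<open>\<delta>\<close>.\<close>
  have bound: "\<bar>E1 / \<sigma> - t * E2\<bar> \<le> \<delta> * (\<bar>t\<bar> + t\<^sup>2)"
    if "\<bar>E1 - S * (t / \<sigma> * E2)\<bar> \<le> \<bar>t / \<sigma>\<bar> * T + N * ((t / \<sigma>)\<^sup>2 * K ^ 3)" for E1 E2 t
  proof -
    have "E1 / \<sigma> - t * E2 = (E1 - S * (t / \<sigma> * E2)) / \<sigma>"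
      using \<sigma> by (simp add: field_simps)
    also have "\<bar>\<dots>\<bar> \<le> (\<bar>t / \<sigma>\<bar> * T + N * ((t / \<sigma>)\<^sup>2 * K ^ 3)) / \<sigma>"
      using that \<sigma> by (simp add: abs_divide divide_right_mono)
    also have "\<dots> = \<bar>t\<bar> * (T / S) + t\<^sup>2 * (N * K ^ 3 / (S * \<sigma>))"
      using \<sigma> by (simp add: field_simps power2_eq_square abs_divide)
    also have "\<dots> \<le> (T / S + N * K ^ 3 / (S * \<sigma>)) * (\<bar>t\<bar> + t\<^sup>2)"
    proof -
      have "0 \<le> T / S" "0 \<le> N * K ^ 3 / (S * \<sigma>)" using T S \<sigma> K by simp_all
      then show ?thesis by (simp only: distrib_left distrib_right mult.commute) (use T S \<sigma>(1) K in simp)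
    qed
    also have "\<dots> = \<delta> * (\<bar>t\<bar> + t\<^sup>2)" by (simp only: \<delta>)
    finally show ?thesis .
  qed
  have scaled: "\<bar>\<phi> (\<theta> * (x - e)) - \<phi> (\<theta> * (y - e)) - \<theta> * \<phi>' (\<theta> * (x - e)) * (x - y)\<bar> \<le> \<theta>\<^sup>2 * (x - y)\<^sup>2"
    if taylor: "\<And>a b. \<bar>\<phi> a - \<phi> b - \<phi>' a * (a - b)\<bar> \<le> (a - b)\<^sup>2" for \<phi> \<phi>' :: "real \<Rightarrow> real" and \<theta> x y
  proof -
    have "\<theta> * (x - e) - \<theta> * (y - e) = \<theta> * (x - y)" by (simp add: algebra_simps)
    then show ?thesis
      using taylor[of "\<theta> * (x - e)" "\<theta> * (y - e)"] by (simp only: power_mult_distrib mult_ac)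
  qed
  have le_1: "\<bar>t / \<sigma> * u\<bar> \<le> \<bar>t / \<sigma>\<bar>" if "\<bar>u\<bar> \<le> 1" for t u
    using mult_left_mono[OF that, of "\<bar>t / \<sigma>\<bar>"] by (simp add: abs_mult)
  have st_sin: "\<bar>expect N (\<lambda>p. (g p - e) * sin (t / \<sigma> * (g p - e))) - S * (t / \<sigma> * expect N (\<lambda>p. cos (t * X p)))\<bar>
     \<le> \<bar>t / \<sigma>\<bar> * T + N * ((t / \<sigma>)\<^sup>2 * K ^ 3)" for t
    using stein_bound[OF lip, of "(t / \<sigma>)\<^sup>2" "\<lambda>x. sin (t / \<sigma> * (x - e))" "\<lambda>x. t / \<sigma> * cos (t / \<sigma> * (x - e))" "\<bar>t / \<sigma>\<bar>",
        OF _ scaled[OF sin_cos_taylor(1)] le_1]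
    unfolding mean_cmult e_def[symmetric] S_def[symmetric] T_def[symmetric] X
    by simp
  have st_cos: "\<bar>expect N (\<lambda>p. (g p - e) * cos (t / \<sigma> * (g p - e))) - S * (t / \<sigma> * expect N (\<lambda>p. - sin (t * X p)))\<bar>
     \<le> \<bar>t / \<sigma>\<bar> * T + N * ((t / \<sigma>)\<^sup>2 * K ^ 3)" for t
    using stein_bound[OF lip, of "(t / \<sigma>)\<^sup>2" "\<lambda>x. cos (t / \<sigma> * (x - e))" "\<lambda>x. t / \<sigma> * (- sin (t / \<sigma> * (x - e)))" "\<bar>t / \<sigma>\<bar>",
        OF _ scaled[OF sin_cos_taylor(2)] le_1]
    unfolding mean_cmult e_def[symmetric] S_def[symmetric] T_def[symmetric] X
    by simp
  have mean_minus: "expect N (\<lambda>p. - q p) = - expect N q" for q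
    using mean_cmult[of "perms N 0" "-1" q] by simp
  have sinX: "expect N (\<lambda>p. X p * sin (t * X p)) = expect N (\<lambda>p. (g p - e) * sin (t / \<sigma> * (g p - e))) / \<sigma>" for t
    using mean_cmult[of "perms N 0" "1 / \<sigma>" "\<lambda>p. (g p - e) * sin (t / \<sigma> * (g p - e))"] by (simp add: X)
  have cosX: "expect N (\<lambda>p. X p * cos (t * X p)) = expect N (\<lambda>p. (g p - e) * cos (t / \<sigma> * (g p - e))) / \<sigma>" for t
    using mean_cmult[of "perms N 0" "1 / \<sigma>" "\<lambda>p. (g p - e) * cos (t / \<sigma> * (g p - e))"] by (simp add: X)
  have "\<bar>expect N (\<lambda>p. cos (t * X p)) - expect N (\<lambda>p. cos (0 * X p)) * exp (- t\<^sup>2 / 2)\<bar> \<le> \<delta> * (\<bar>t\<bar> + t\<^sup>2) * \<bar>t\<bar>"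
  proof (rule gaussian_ode_bound[OF _ _ \<delta>0])
    fix s
    show "((\<lambda>s. expect N (\<lambda>p. cos (s * X p))) has_real_derivative expect N (\<lambda>p. - (X p * sin (s * X p)))) (at s)"
      by (intro has_derivative_mean) (auto intro!: derivative_eq_intros)
    show "\<bar>expect N (\<lambda>p. - (X p * sin (s * X p))) + s * expect N (\<lambda>p. cos (s * X p))\<bar> \<le> \<delta> * (\<bar>s\<bar> + s\<^sup>2)"
      using bound[OF st_sin[of s]] by (simp only: mean_minus sinX)
  qed
  then show "\<bar>expect N (\<lambda>p. cos (t * X p)) - exp (- t\<^sup>2 / 2)\<bar> \<le> \<delta> * (\<bar>t\<bar> + t\<^sup>2) * \<bar>t\<bar>"
    by (simp add: mean_const)
  have "\<bar>expect N (\<lambda>p. sin (t * X p)) - expect N (\<lambda>p. sin (0 * X p)) * exp (- t\<^sup>2 / 2)\<bar> \<le> \<delta> * (\<bar>t\<bar> + t\<^sup>2) * \<bar>t\<bar>"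
  proof (rule gaussian_ode_bound[OF _ _ \<delta>0])
    fix s
    show "((\<lambda>s. expect N (\<lambda>p. sin (s * X p))) has_real_derivative expect N (\<lambda>p. X p * cos (s * X p))) (at s)"
      by (intro has_derivative_mean) (auto intro!: derivative_eq_intros)
    show "\<bar>expect N (\<lambda>p. X p * cos (s * X p)) + s * expect N (\<lambda>p. sin (s * X p))\<bar> \<le> \<delta> * (\<bar>s\<bar> + s\<^sup>2)"
      using bound[OF st_cos[of s]] by (simp only: mean_minus cosX)
  qed
  then show "\<bar>expect N (\<lambda>p. sin (t * X p))\<bar> \<le> \<delta> * (\<bar>t\<bar> + t\<^sup>2) * \<bar>t\<bar>"
    by (simp add: mean_const)
qed

lemma char_config_model:
  assumes \<eta>: "bij_betw \<eta> {0..<N} (half_edges n d)" and N: "even N"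
  shows "char (distr (measure_pmf (config_model n d)) borel X) t
    = Complex (expect N (\<lambda>p. cos (t * X (matching_graph n (matching_on \<eta> {0..<N} p)))))
        (expect N (\<lambda>p. sin (t * X (matching_graph n (matching_on \<eta> {0..<N} p)))))"
proof -
  let ?P = "config_model n d"
  have int: "integrable (measure_pmf ?P) (\<lambda>G. iexp (t * X G))"
    by (rule measure_pmf.integrable_const_bound[where B = 1]) auto
  have c: "char (distr (measure_pmf ?P) borel X) t = (CLINT G|measure_pmf ?P. iexp (t * X G))"
    by (simp add: char_def integral_distr)
  show ?thesis
  proof (rule complex_eqI)
    show "Re (char (distr (measure_pmf ?P) borel X) t) = Re (Complex (expect N (\<lambda>p. cos (t * X (matching_graph n (matching_on \<eta> {0..<N} p)))))
        (expect N (\<lambda>p. sin (t * X (matching_graph n (matching_on \<eta> {0..<N} p))))))"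
      unfolding c integral_Re[OF int, symmetric]
      by (simp add: Re_exp expectation_config_model[OF \<eta> N])
    show "Im (char (distr (measure_pmf ?P) borel X) t) = Im (Complex (expect N (\<lambda>p. cos (t * X (matching_graph n (matching_on \<eta> {0..<N} p)))))
        (expect N (\<lambda>p. sin (t * X (matching_graph n (matching_on \<eta> {0..<N} p))))))"
      unfolding c integral_Im[OF int, symmetric]
      by (simp add: Im_exp expectation_config_model[OF \<eta> N])
  qed
qed

section \<open>Asymptotics of the kernel variance\<close>

lemma quadratic_ratio_tendsto_0:
  fixes V :: "nat \<Rightarrow> real"
  assumes x: "0 < x" "x < 1" and V: "\<And>n. 0 \<le> V n"
    and bound: "\<And>q. 1 \<le> q \<Longrightarrow> eventually (\<lambda>n. V n \<le> real n * (B q + A * real n * x ^ q)) sequentially"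
  shows "(\<lambda>n. V n / (real n)\<^sup>2) \<longlonglongrightarrow> 0"
  unfolding tendsto_iff dist_norm
proof (intro allI impI)
  fix \<epsilon> :: real assume \<epsilon>: "0 < \<epsilon>"
  have "(\<lambda>q. A * x ^ q) \<longlonglongrightarrow> A * 0"
    using x by (intro tendsto_mult_left LIMSEQ_realpow_zero) auto
  then have "eventually (\<lambda>q. A * x ^ q < \<epsilon> / 2) sequentially"
    using \<epsilon> by (intro order_tendstoD) auto
  then have "eventually (\<lambda>q. A * x ^ q < \<epsilon> / 2 \<and> 1 \<le> q) sequentially"
    using eventually_ge_at_top[of 1] by eventually_elim auto
  \<comment> \<open>Since \<open>q\<close> is fixed before \<open>n\<close>, the term
    \<open>B q\<close> may grow arbitrarily with \<open>q\<close>: it is divided by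
    \<open>n\<close>.\<close>
  then obtain q where q: "A * x ^ q < \<epsilon> / 2" "1 \<le> q"
    by (auto simp: eventually_sequentially)
  have "(\<lambda>n. B q / real n) \<longlonglongrightarrow> 0" by real_asymp
  then have "eventually (\<lambda>n. B q / real n < \<epsilon> / 2) sequentially"
    using \<epsilon> by (intro order_tendstoD) auto
  then show "eventually (\<lambda>n. norm (V n / (real n)\<^sup>2 - 0) < \<epsilon>) sequentially"
    using bound[OF q(2)] eventually_gt_at_top[of 0]
  proof eventually_elim
    case (elim n)
    have "V n / (real n)\<^sup>2 \<le> real n * (B q + A * real n * x ^ q) / (real n)\<^sup>2"
      using elim by (intro divide_right_mono) auto
    also have "\<dots> = B q / real n + A * x ^ q"
      using elim by (simp add: field_simps power2_eq_square)
    finally have "V n / (real n)\<^sup>2 < \<epsilon>" using elim(1) q(1) by linarith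
    then show ?case using V[of n] by simp
  qed
qed

lemma power_mult_geometric_bounded:
  fixes x :: real
  assumes "0 < x" "x < 1"
  shows "\<exists>A\<ge>0. \<forall>L. (real L + 1) ^ 3 * x ^ L \<le> A"
proof -
  have "(\<lambda>L. (real L + 1) ^ 3 * x ^ L) \<longlonglongrightarrow> 0"
    using assms by real_asymp
  then have "Bseq (\<lambda>L. (real L + 1) ^ 3 * x ^ L)"
    by (rule convergent_imp_Bseq[OF convergentI])
  then obtain A where "0 < A" "\<And>L. norm ((real L + 1) ^ 3 * x ^ L) \<le> A"
    by (auto simp: Bseq_def)
  then show ?thesis
    by (intro exI[of _ A]) (auto intro: order_trans[OF abs_ge_self] simp del: abs_mult)
qed

text \<open>The room between \<open>\<nu>\<close> and \<open>x\<close> pays for the factor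
  \<open>(1 - 2 / k)^2\<close>, lost because a chain may use up to \<open>2 * N / k\<close>
  positions. As \<open>k\<close> and \<open>A\<close> do not depend on \<open>N\<close>, the last
  term stays bounded.\<close>

lemma perm_variance_stein_kernel_subcritical:
  assumes lip: "swap_lipschitz N K g" and dec: "swaps_decouple N (connected_in N v) g"
    and \<Delta>: "\<And>x. card {h. h < N \<and> v h = x} \<le> \<Delta>"
    and S: "real (card (sibling_pairs N v)) \<le> \<nu> * real N"
    and x: "0 < x" "x < 1" and k: "3 \<le> k" "\<nu> \<le> x * (1 - 2 / real k)\<^sup>2"
    and A: "\<And>L. (real L + 1) ^ 3 * x ^ L \<le> A"
    and q: "1 \<le> q" "k * q \<le> N"
  shows "perm_variance N (stein_kernel N g)
    \<le> 8000 * K ^ 4 * real N * ((real ((\<Delta> + 1) ^ (2 * q)))\<^sup>2 + (4 * real N * x ^ q / (1 - x) + real k ^ 3 * A))"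
proof -
  \<comment> \<open>A cutoff proportional to \<open>N\<close>: long enough for \<open>x ^ L\<close>
    to beat \<open>N ^ 3\<close>, short enough to leave a fixed share of the positions free.\<close>
  define L where "L = N div k"
  have kL: "k * L \<le> N" "N \<le> k * (L + 1)"
    using k dividend_less_times_div[of k N] by (auto simp: L_def)
  have qL: "q \<le> L"
    using q k by (simp add: L_def less_eq_div_iff_mult_less_eq mult.commute)
  have "3 * L \<le> k * L" using k by (intro mult_right_mono) auto
  then have LN: "2 * L < N" using kL qL q by linarith
  have sq: "(real N * (1 - 2 / real k))\<^sup>2 \<le> (real (N - 2 * L))\<^sup>2"
  proof (intro power_mono)
    have "real k * real L \<le> real N" using kL(1) by (metis of_nat_le_iff of_nat_mult)
    then have "2 * real L \<le> 2 * real N / real k" using k by (simp add: field_simps)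
    then show "real N * (1 - 2 / real k) \<le> real (N - 2 * L)"
      using LN by (simp add: of_nat_diff right_diff_distrib mult.commute)
    show "0 \<le> real N * (1 - 2 / real k)" using k by simp
  qed
  have "real N * real (card (sibling_pairs N v)) \<le> real N * (\<nu> * real N)"
    by (intro mult_left_mono S) auto
  also have "\<dots> = \<nu> * (real N)\<^sup>2" by (simp add: power2_eq_square)
  also have "\<dots> \<le> x * (1 - 2 / real k)\<^sup>2 * (real N)\<^sup>2"
    by (intro mult_right_mono k) auto
  also have "\<dots> = x * (real N * (1 - 2 / real k))\<^sup>2" by (simp add: power_mult_distrib)
  also have "\<dots> \<le> x * (real (N - 2 * L))\<^sup>2"
    using x by (intro mult_left_mono sq) auto
  finally have *: "real N * real (card (sibling_pairs N v)) \<le> x * (real (N - 2 * L))\<^sup>2" .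
  have "real N \<le> real k * (real L + 1)" using kL(2) by (metis of_nat_1 of_nat_add of_nat_le_iff of_nat_mult)
  then have "real N ^ 3 * x ^ L \<le> (real k * (real L + 1)) ^ 3 * x ^ L"
    using x by (intro mult_right_mono power_mono) auto
  also have "\<dots> = real k ^ 3 * ((real L + 1) ^ 3 * x ^ L)" by (simp add: power_mult_distrib)
  also have "\<dots> \<le> real k ^ 3 * A" by (intro mult_left_mono A) auto
  finally have far: "real N ^ 3 * x ^ L \<le> real k ^ 3 * A" .
  have "perm_variance N (stein_kernel N g)
    \<le> 8000 * K ^ 4 * real N * ((real ((\<Delta> + 1) ^ (2 * q)))\<^sup>2 + (4 * real N * x ^ q / (1 - x) + real N ^ 3 * x ^ L))"
    using x by (intro perm_variance_stein_kernel_far_le[where v = v] lip dec \<Delta> q qL LN *) auto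
  also have "\<dots> \<le> 8000 * K ^ 4 * real N * ((real ((\<Delta> + 1) ^ (2 * q)))\<^sup>2 + (4 * real N * x ^ q / (1 - x) + real k ^ 3 * A))"
    by (intro mult_left_mono add_left_mono far) auto
  finally show ?thesis .
qed

lemma swap_lipschitz_matching_graph:
  assumes "switching_lipschitz d M F" and n: "1 \<le> n"
    and \<eta>: "bij_betw \<eta> {0..<N} (half_edges n (d n))" and N: "even N"
  shows "swap_lipschitz N \<bar>M\<bar> (\<lambda>p. F (matching_graph n (matching_on \<eta> {0..<N} p)))"
  unfolding swap_lipschitz_def
proof (intro ballI allI impI)
  fix p j k assume p: "p \<in> perms N 0" and jk: "j < N" "k < N"
  let ?m = "matching_on \<eta> {0..<N} p" and ?m' = "matching_on \<eta> {0..<N} (p \<circ> swp j k)"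
  have mem: "?m \<in> perfect_matchings (half_edges n (d n))" "?m' \<in> perfect_matchings (half_edges n (d n))"
    using matching_on_perfect[OF \<eta> N] swp_in_perms_0[OF jk p] p by blast+
  show "\<bar>F (matching_graph n ?m) - F (matching_graph n ?m')\<bar> \<le> \<bar>M\<bar>"
    using matching_on_swap_cases[OF \<eta> N p jk]
  proof
    assume "?m' = ?m"
    then show ?thesis by simp
  next
    assume "switching ?m ?m'"
    then have "\<bar>F (matching_graph n ?m) - F (matching_graph n ?m')\<bar> \<le> M"
      using assms(1) n mem unfolding switching_lipschitz_def by blast
    then show ?thesis by linarith
  qed
qed

section \<open>Additive functionals of subcritical configuration models\<close>

theorem corollary3p2:
  fixes d :: "nat \<Rightarrow> nat \<Rightarrow> nat"
    and F :: "nat mgraph \<Rightarrow> real"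
    and M :: real
    and P :: "'a measure"
    and D :: "'a \<Rightarrow> real"
  defines "EF \<equiv> \<lambda>n. measure_pmf.expectation (config_model n (d n)) F"
    and "VF \<equiv> \<lambda>n. measure_pmf.variance (config_model n (d n)) F"
    and "ED \<equiv> \<lambda>n. measure_pmf.expectation (degree_pmf n (d n)) real"
    and "EDD \<equiv> \<lambda>n. measure_pmf.expectation (degree_pmf n (d n)) (\<lambda>k. real k * (real k - 1))"
  assumes even_sum: "\<And>n. n \<ge> 1 \<Longrightarrow> even (\<Sum>i=1..n. d n i)"
    and bounded_degrees: "\<exists>C. \<forall>n\<ge>1. \<forall>i\<in>{1..n}. d n i \<le> C"
    and F_iso: "iso_invariant F"
    and F_additive: "mgraph_additive F"
    and F_lipschitz: "switching_lipschitz d M F"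
    and P_prob: "prob_space P"
    and D_rv: "D \<in> borel_measurable P"
    and D_conv: "weak_conv_m (\<lambda>n. distr (measure_pmf (degree_pmf n (d n))) borel real) (distr P borel D)"
    and D_integrable: "integrable P D"
    and D_mean_conv: "ED \<longlonglongrightarrow> (\<integral>\<omega>. D \<omega> \<partial>P)"
    and D_mean_pos: "(\<integral>\<omega>. D \<omega> \<partial>P) > 0"
    and DD_integrable: "integrable P (\<lambda>\<omega>. D \<omega> * (D \<omega> - 1))"
    and D_ratio_conv: "(\<lambda>n. EDD n / ED n) \<longlonglongrightarrow> (\<integral>\<omega>. D \<omega> * (D \<omega> - 1) \<partial>P) / (\<integral>\<omega>. D \<omega> \<partial>P)"
    and D_ratio: "(\<integral>\<omega>. D \<omega> * (D \<omega> - 1) \<partial>P) / (\<integral>\<omega>. D \<omega> \<partial>P) \<in> {0..<1}"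
    and var_lower: "VF \<in> \<Omega>(\<lambda>n. real n)"
  shows "weak_conv_m
           (\<lambda>n. distr (measure_pmf (config_model n (d n))) borel (\<lambda>G. (F G - EF n) / sqrt (VF n)))
           std_normal_distribution"
proof -
  define N where "N n = (\<Sum>i=1..n. d n i)" for n
  have N_even: "even (N n)" for n
    using even_sum[of n] by (cases "n = 0") (auto simp: N_def)
  have "\<exists>\<eta>. bij_betw \<eta> {0..<N n} (half_edges n (d n))" for n
    using half_edges_enum[where n = n and d = "d n"] unfolding N_def by blast
  then obtain \<eta> where \<eta>: "\<And>n. bij_betw (\<eta> n) {0..<N n} (half_edges n (d n))" by metis
  define f where "f n p = F (matching_graph n (matching_on (\<eta> n) {0..<N n} p))" for n p
  define v where "v n h = fst (\<eta> n h)" for n h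
  have EF': "measure_pmf.expectation (config_model n (d n)) F = EF n" for n
    by (simp add: EF_def)
  have EF: "EF n = expect (N n) (f n)" for n
    using expectation_config_model[OF \<eta> N_even, of n F] by (simp add: EF_def f_def[abs_def])
  have VF: "VF n = perm_variance (N n) (f n)" for n
    using expectation_config_model[OF \<eta>[of n] N_even[of n], of "\<lambda>G. (F G - EF n)\<^sup>2"]
    by (simp add: VF_def perm_variance_def EF[symmetric] EF' f_def)
  define K where "K = \<bar>M\<bar>"
  have K: "0 \<le> K" by (simp add: K_def)
  have lip: "swap_lipschitz (N n) K (f n)" if "1 \<le> n" for n
    unfolding K_def f_def by (rule swap_lipschitz_matching_graph[OF F_lipschitz that \<eta> N_even])
  have \<eta>_vertex: "fst (\<eta> n h) \<in> {1..n}" if "h < N n" for n h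
  proof -
    have "\<eta> n h \<in> half_edges n (d n)" using bij_betwE[OF \<eta>[of n]] that by simp
    then show ?thesis by (auto simp: half_edges_def)
  qed
  have dec: "swaps_decouple (N n) (connected_in (N n) (v n)) (f n)" for n
    unfolding f_def v_def
    by (rule swaps_decouple_matching_graph[OF F_additive bij_betw_imp_inj_on[OF \<eta>] N_even \<eta>_vertex])
  obtain \<Delta> where \<Delta>: "\<And>n i. 1 \<le> n \<Longrightarrow> i \<in> {1..n} \<Longrightarrow> d n i \<le> \<Delta>"
    using bounded_degrees by blast
  have deg: "card {h. h < N n \<and> v n h = x} \<le> \<Delta>" if "1 \<le> n" for n x
    using card_half_edges_at[OF \<eta>[of n], of x] \<Delta>[OF that, of x] by (simp add: v_def)
  have N_le: "real (N n) \<le> \<Delta> * real n" if "1 \<le> n" for n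
  proof -
    have "N n \<le> (\<Sum>i=1..n. \<Delta>)" unfolding N_def by (intro sum_mono \<Delta> that)
    then have "real (N n) \<le> real (n * \<Delta>)" by (simp only: of_nat_le_iff sum_constant card_atLeastAtMost) simp
    then show ?thesis by (simp add: mult.commute)
  qed
  have ED: "ED n = real (N n) / real n" if "1 \<le> n" for n
    using expectation_degree_pmf[OF that even_sum[OF that], of real] by (simp add: ED_def N_def)
  have EDD: "EDD n = (\<Sum>i=1..n. real (d n i) * (real (d n i) - 1)) / real n" if "1 \<le> n" for n
    using expectation_degree_pmf[OF that even_sum[OF that], of "\<lambda>k. real k * (real k - 1)"] by (simp add: EDD_def)

  define \<mu> where "\<mu> = (\<integral>\<omega>. D \<omega> \<partial>P)"
  define \<nu>0 where "\<nu>0 = (\<integral>\<omega>. D \<omega> * (D \<omega> - 1) \<partial>P) / \<mu>"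
  have \<mu>: "0 < \<mu>" "ED \<longlonglongrightarrow> \<mu>" using D_mean_pos D_mean_conv by (auto simp: \<mu>_def)
  have \<nu>0: "0 \<le> \<nu>0" "\<nu>0 < 1" "(\<lambda>n. EDD n / ED n) \<longlonglongrightarrow> \<nu>0"
    using D_ratio D_ratio_conv by (auto simp: \<nu>0_def \<mu>_def)
  \<comment> \<open>Two margins below \<open>1\<close>: from \<open>\<nu>0\<close> to
    \<open>\<nu>\<close> for the convergence of the degree ratio, from \<open>\<nu>\<close> to
    \<open>x\<close> for the positions used up by long chains.\<close>
  define \<nu> where "\<nu> = (\<nu>0 + 1) / 2"
  define x where "x = (\<nu> + 1) / 2"
  have "\<nu>0 < \<nu> \<and> \<nu> < x \<and> 0 < x \<and> x < 1"
    using \<nu>0(1,2) unfolding x_def \<nu>_def by argo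
  then have \<nu>: "\<nu>0 < \<nu>" "\<nu> < x" and x: "0 < x" "x < 1" by auto
  have ED_ev: "eventually (\<lambda>n. \<mu> / 2 < ED n) sequentially"
    using \<mu> by (intro order_tendstoD(1)[OF \<mu>(2)]) auto
  \<comment> \<open>Linear growth of \<open>N n\<close> ensures that \<open>k * q \<le> N n\<close>
    eventually holds for each fixed \<open>q\<close>.\<close>
  have N_ge: "eventually (\<lambda>n. \<mu> / 2 * real n \<le> real (N n)) sequentially"
    using ED_ev eventually_ge_at_top[of 1]
  proof eventually_elim
    case (elim n)
    then show ?case by (simp add: ED field_simps)
  qed
  have S: "eventually (\<lambda>n. real (card (sibling_pairs (N n) (v n))) \<le> \<nu> * real (N n)) sequentially"
    using order_tendstoD(2)[OF \<nu>0(3) \<nu>(1)] ED_ev eventually_ge_at_top[of 1]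
  proof eventually_elim
    case (elim n)
    have "real (card (sibling_pairs (N n) (v n))) \<le> real n * EDD n"
      using card_sibling_pairs_le[OF \<eta>[of n]] elim(3) by (simp add: EDD v_def[abs_def])
    also have "\<dots> \<le> real n * (\<nu> * ED n)"
      using elim \<mu> by (intro mult_left_mono) (auto simp: pos_divide_less_eq)
    also have "\<dots> = \<nu> * real (N n)" using elim(3) by (simp add: ED)
    finally show ?case .
  qed
  \<comment> \<open>The loss factor tends to \<open>1\<close>, so the margin between
    \<open>\<nu>\<close> and \<open>x\<close> admits a fixed \<open>k\<close>.\<close>
  have "(\<lambda>k. x * (1 - 2 / real k)\<^sup>2) \<longlonglongrightarrow> x" by real_asymp
  then have "eventually (\<lambda>k. \<nu> < x * (1 - 2 / real k)\<^sup>2 \<and> 3 \<le> k) sequentially"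
    using \<nu>(2) by (intro eventually_conj order_tendstoD(1) eventually_ge_at_top)
  then obtain k where k: "3 \<le> k" "\<nu> \<le> x * (1 - 2 / real k)\<^sup>2"
    by (auto simp: eventually_sequentially intro: less_imp_le)
  obtain A where A: "0 \<le> A" "\<And>L. (real L + 1) ^ 3 * x ^ L \<le> A"
    using power_mult_geometric_bounded[OF x] by blast
  define VT where "VT n = perm_variance (N n) (stein_kernel (N n) (f n))" for n
  have VT_nonneg: "0 \<le> VT n" for n
    unfolding VT_def perm_variance_def by (intro mean_nonneg) auto
  define c1 where "c1 = 8000 * K ^ 4 * real \<Delta>"
  have c1: "0 \<le> c1" by (simp add: c1_def)
  have VT_bound: "eventually (\<lambda>n. VT n \<le> real n *
      (c1 * ((real ((\<Delta> + 1) ^ (2 * q)))\<^sup>2 + real k ^ 3 * A) + c1 * (4 * real \<Delta> / (1 - x)) * real n * x ^ q)) sequentially"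
    if q: "1 \<le> q" for q
  proof -
    have "filterlim (\<lambda>n. \<mu> / 2 * real n) at_top sequentially"
      using \<mu>(1) by real_asymp
    then have "eventually (\<lambda>n. real (k * q) \<le> \<mu> / 2 * real n) sequentially"
      by (simp only: filterlim_at_top)
    with N_ge S eventually_ge_at_top[of 1] show ?thesis
    proof eventually_elim
      case (elim n)
      have kq: "k * q \<le> N n" using elim by linarith
      let ?b = "(real ((\<Delta> + 1) ^ (2 * q)))\<^sup>2"
      have "VT n \<le> 8000 * K ^ 4 * real (N n) * (?b + (4 * real (N n) * x ^ q / (1 - x) + real k ^ 3 * A))"
        unfolding VT_def
        by (rule perm_variance_stein_kernel_subcritical[OF lip dec deg elim(2) x k A(2) q kq]) (use elim in auto)
      also have "\<dots> \<le> 8000 * K ^ 4 * (\<Delta> * real n) * (?b + (4 * (\<Delta> * real n) * x ^ q / (1 - x) + real k ^ 3 * A))"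
        using x A(1) K N_le[of n] elim
        by (intro mult_mono mult_left_mono add_left_mono add_right_mono divide_right_mono mult_right_mono
              add_nonneg_nonneg divide_nonneg_nonneg mult_nonneg_nonneg zero_le_power) auto
      also have "\<dots> = real n * (c1 * (?b + real k ^ 3 * A) + c1 * (4 * real \<Delta> / (1 - x)) * real n * x ^ q)"
        by (simp add: c1_def algebra_simps)
      finally show ?case .
    qed
  qed
  have VT_lim: "(\<lambda>n. VT n / (real n)\<^sup>2) \<longlonglongrightarrow> 0"
    by (rule quadratic_ratio_tendsto_0[OF x VT_nonneg VT_bound])
  obtain c where c: "0 < c" and VF_ge: "eventually (\<lambda>n. c * real n \<le> VF n) sequentially"
  proof -
    obtain c where "0 < c" "eventually (\<lambda>n. c * norm (real n) \<le> norm (VF n)) sequentially"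
      using landau_omega.bigE[OF var_lower] by blast
    moreover have "0 \<le> VF n" for n
      unfolding VF perm_variance_def by (intro mean_nonneg) auto
    ultimately show ?thesis by (intro that[of c]) auto
  qed
  define \<delta> where "\<delta> n = sqrt (VT n) / VF n + real (N n) * K ^ 3 / (VF n * sqrt (VF n))" for n
  have \<delta>: "\<delta> \<longlonglongrightarrow> 0"
  proof (rule tendsto_sandwich)
    show "eventually (\<lambda>n. 0 \<le> \<delta> n) sequentially"
      using VF_ge eventually_ge_at_top[of 1]
    proof eventually_elim
      case (elim n)
      have "0 \<le> c * real n" using c by simp
      then have "0 \<le> VF n" using elim by linarith
      then show ?case unfolding \<delta>_def using K VT_nonneg by simp
    qed
    \<comment> \<open>By the linear lower bound on the variance, the first term is
      \<open>o(n) / n\<close> and the second of order \<open>n / n powr (3/2)\<close>.\<close>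
    show "eventually (\<lambda>n. \<delta> n \<le> sqrt (VT n / (real n)\<^sup>2) / c + real \<Delta> * K ^ 3 / (c * sqrt (c * real n))) sequentially"
      using VF_ge eventually_ge_at_top[of 1]
    proof eventually_elim
      case (elim n)
      have cn: "0 < c * real n" using c elim by simp
      then have VF_pos: "0 < VF n" using elim by linarith
      have "sqrt (VT n) / VF n \<le> sqrt (VT n) / (c * real n)"
        using elim cn c VF_pos VT_nonneg[of n] by (intro divide_left_mono mult_pos_pos) auto
      also have "\<dots> = sqrt (VT n / (real n)\<^sup>2) / c"
        by (simp add: real_sqrt_divide mult.commute)
      finally have 1: "sqrt (VT n) / VF n \<le> sqrt (VT n / (real n)\<^sup>2) / c" .
      have "real (N n) * K ^ 3 / (VF n * sqrt (VF n)) \<le> (real \<Delta> * real n) * K ^ 3 / ((c * real n) * sqrt (c * real n))"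
        using elim cn c VF_pos N_le[of n] K
        by (intro frac_le mult_mono mult_pos_pos) auto
      also have "\<dots> = real \<Delta> * K ^ 3 / (c * sqrt (c * real n))"
        using elim by simp
      finally show ?case unfolding \<delta>_def using 1 by linarith
    qed
    have "(\<lambda>n. real \<Delta> * K ^ 3 / (c * sqrt (c * real n))) \<longlonglongrightarrow> 0"
      using c by real_asymp
    moreover have "(\<lambda>n. sqrt (VT n / (real n)\<^sup>2) / c) \<longlonglongrightarrow> sqrt 0 / c"
      using c by (intro tendsto_intros VT_lim) auto
    ultimately show "(\<lambda>n. sqrt (VT n / (real n)\<^sup>2) / c + real \<Delta> * K ^ 3 / (c * sqrt (c * real n))) \<longlonglongrightarrow> 0"
      by (auto intro: tendsto_eq_intros)
  qed simp
  have VF_pos: "eventually (\<lambda>n. 1 \<le> n \<and> 0 < VF n) sequentially"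
    using VF_ge eventually_ge_at_top[of 1]
  proof eventually_elim
    case (elim n)
    have "0 < c * real n" using c elim by simp
    then show ?case using elim by linarith
  qed
  define X where "X n G = (F G - EF n) / sqrt (VF n)" for n G
  have trig: "eventually (\<lambda>n.
      \<bar>expect (N n) (\<lambda>p. cos (t * X n (matching_graph n (matching_on (\<eta> n) {0..<N n} p)))) - exp (- t\<^sup>2 / 2)\<bar> \<le> \<delta> n * (\<bar>t\<bar> + t\<^sup>2) * \<bar>t\<bar> \<and>
      \<bar>expect (N n) (\<lambda>p. sin (t * X n (matching_graph n (matching_on (\<eta> n) {0..<N n} p))))\<bar> \<le> \<delta> n * (\<bar>t\<bar> + t\<^sup>2) * \<bar>t\<bar>) sequentially" for t
    using VF_pos
  proof eventually_elim
    case (elim n)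
    have "0 < perm_variance (N n) (f n)" "0 \<le> K" using elim by (auto simp: VF K_def)
    from expect_trig_bound[OF lip this(2,1), of t] elim
    show ?case by (simp add: X_def f_def[symmetric] VF EF \<delta>_def VT_def)
  qed
  have \<delta>_t: "(\<lambda>n. \<delta> n * (\<bar>t\<bar> + t\<^sup>2) * \<bar>t\<bar>) \<longlonglongrightarrow> 0" for t
    using \<delta> by (auto intro!: tendsto_eq_intros)
  show ?thesis
  \<comment> \<open>The cosine and sine averages are the real and imaginary parts of the
    characteristic function; their limits \<open>exp (- t^2 / 2)\<close> and \<open>0\<close>
    identify the normal law.\<close>
  proof (rule levy_continuity)
    show "real_distribution (distr (measure_pmf (config_model n (d n))) borel (\<lambda>G. (F G - EF n) / sqrt (VF n)))" for n
      by (intro prob_space.real_distribution_distr measure_pmf.prob_space_axioms) simp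
    show "real_distribution std_normal_distribution" by (rule real_dist_normal_dist)
    fix t
    have "(\<lambda>n. expect (N n) (\<lambda>p. cos (t * X n (matching_graph n (matching_on (\<eta> n) {0..<N n} p)))) - exp (- t\<^sup>2 / 2)) \<longlonglongrightarrow> 0"
      by (rule Lim_null_comparison[OF _ \<delta>_t[of t]]) (use trig[of t] in \<open>auto elim: eventually_mono\<close>)
    then have 1: "(\<lambda>n. expect (N n) (\<lambda>p. cos (t * X n (matching_graph n (matching_on (\<eta> n) {0..<N n} p))))) \<longlonglongrightarrow> exp (- t\<^sup>2 / 2)"
      by (rule LIM_zero_cancel)
    have 2: "(\<lambda>n. expect (N n) (\<lambda>p. sin (t * X n (matching_graph n (matching_on (\<eta> n) {0..<N n} p))))) \<longlonglongrightarrow> 0"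
      by (rule Lim_null_comparison[OF _ \<delta>_t[of t]]) (use trig[of t] in \<open>auto elim: eventually_mono\<close>)
    have "char std_normal_distribution t = Complex (exp (- t\<^sup>2 / 2)) 0"
      by (simp add: char_std_normal_distribution complex_of_real_def)
    moreover have "char (distr (measure_pmf (config_model n (d n))) borel (\<lambda>G. (F G - EF n) / sqrt (VF n))) t
      = Complex (expect (N n) (\<lambda>p. cos (t * X n (matching_graph n (matching_on (\<eta> n) {0..<N n} p)))))
          (expect (N n) (\<lambda>p. sin (t * X n (matching_graph n (matching_on (\<eta> n) {0..<N n} p)))))" for n
      using char_config_model[OF \<eta> N_even, of n "X n" t] by (simp add: X_def[abs_def])
    ultimately show "(\<lambda>n. char (distr (measure_pmf (config_model n (d n))) borel (\<lambda>G. (F G - EF n) / sqrt (VF n))) t)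
      \<longlonglongrightarrow> char std_normal_distribution t"
      using tendsto_Complex[OF 1 2] by simp
  qed
qed

end
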